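(* Let $k\in\mathbb{N}$, $\ell\in\mathbb{R}_+$ with $k\le\ell$, let $\varphi_{\ell,k}$ be the Wu function, and define $\Phi(x)=\varphi_{\ell,k}(\|x\|_2)$ on $\mathbb{R}^{2k+1}$. Then for every $s$ with $k+1/2<s\le\ell+1$, the native space $\mathcal{N}_\Phi(\mathbb{R}^{2k+1})$ is a subspace of the Sobolev space $H^s(\mathbb{R}^{2k+1})$.
   Context: $\mathbb{R}_+=[0,\infty)$. For $\ell\ge0$ let $f_\ell(r)=(1-r^2)_+^\ell$, and let $f_\ell*f_\ell(r)=\int_{\mathbb{R}}f_\ell(|y|)f_\ell(|r-y|)\,dy$ (one-dimensional convolution), $r\ge0$. Let $\mathscr{D}\varphi(r):=-\frac1r\varphi'(r)$ and $\mathscr{D}^k$ its $k$-fold iterate. The Wu function is $\varphi_{\ell,k}(r):=\mathscr{D}^k(f_\ell*f_\ell)(r)$, $r\in\mathbb{R}_+$, for $k\in\mathbb{N}$, $\ell\in\mathbb{R}_+$, $k\le\ell$. The Fourier transform on $\mathbb{R}^d$ is $\hat f(\omega)=(2\pi)^{-d/2}\int_{\mathbb{R}^d}f(x)e^{-i\langle\omega,x\rangle}dx$. The Sobolev space is $H^s(\mathbb{R}^d)=\{f\in L^2(\mathbb{R}^d):\hat f(\cdot)(1+\|\cdot\|_2^2)^{s/2}\in L^2(\mathbb{R}^d)\}$ with inner product $\langle f,g\rangle_{H^s}=(2\pi)^{-d/2}\int\hat f\,\overline{\hat g}\,(1+\|\omega\|_2^2)^s\,d\omega$. For a (strictly) positive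 definite continuous function $\Phi$ on $\mathbb{R}^d$, the native space $\mathcal{N}_\Phi(\mathbb{R}^d)$ is the reproducing kernel Hilbert space of real functions on $\mathbb{R}^d$ whose reproducing kernel is $(x,y)\mapsto\Phi(x-y)$. *)

theory Defs
  imports "HOL-Analysis.Analysis"
begin

definition f_trunc :: "real \<Rightarrow> real \<Rightarrow> real" where
  "f_trunc l r = (max 0 (1 - r\<^sup>2)) powr l"

definition f_conv :: "real \<Rightarrow> real \<Rightarrow> real" where
  "f_conv l r = (\<integral>y. f_trunc l \<bar>y\<bar> * f_trunc l \<bar>r - y\<bar> \<partial>lborel)"

text \<open>The operator D phi (r) = - phi'(r) / r (used for r > 0).\<close>
definition Dop :: "(real \<Rightarrow> real) \<Rightarrow> real \<Rightarrow> real" where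
  "Dop \<phi> r = - deriv \<phi> r / r"

definition wu :: "real \<Rightarrow> nat \<Rightarrow> real \<Rightarrow> real" where
  "wu l k r = (if r = 0 then Lim (at_right 0) ((Dop ^^ k) (f_conv l))
               else ((Dop ^^ k) (f_conv l)) r)"

definition fourier_L1 :: "(real^'n \<Rightarrow> complex) \<Rightarrow> real^'n \<Rightarrow> complex" where
  "fourier_L1 \<phi> \<omega> = of_real ((2 * pi) powr (- real CARD('n) / 2)) *
     (\<integral>x. \<phi> x * cis (- (\<omega> \<bullet> x)) \<partial>lborel)"

definition square_integrable :: "(real^'n \<Rightarrow> complex) \<Rightarrow> bool" where
  "square_integrable g \<longleftrightarrow> g \<in> borel_measurable lborel \<and>
     integrable lborel (\<lambda>x. (norm (g x))\<^sup>2)"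

text \<open>g is the (L^2-, Plancherel) Fourier transform of f, characterised by the
  duality relation  int g phi = int f (hat phi)  for all phi in L^1 \<inter> L^2.\<close>
definition is_fourier_L2 :: "(real^'n \<Rightarrow> complex) \<Rightarrow> (real^'n \<Rightarrow> complex) \<Rightarrow> bool" where
  "is_fourier_L2 f g \<longleftrightarrow> square_integrable f \<and> square_integrable g \<and>
     (\<forall>\<phi>. integrable lborel \<phi> \<and> square_integrable \<phi> \<longrightarrow>
        (\<integral>\<omega>. g \<omega> * \<phi> \<omega> \<partial>lborel) = (\<integral>x. f x * fourier_L1 \<phi> x \<partial>lborel))"

definition sobolev_space :: "real \<Rightarrow> (real^'n \<Rightarrow> real) set" where
  "sobolev_space s = {f. \<exists>g. is_fourier_L2 (\<lambda>x. complex_of_real (f x)) g \<and>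
      integrable lborel (\<lambda>\<omega>. (norm (g \<omega>))\<^sup>2 * (1 + (norm \<omega>)\<^sup>2) powr s)}"

text \<open>Squared kernel norm of  sum_i a i Phi(. - c i) - sum_j b j Phi(. - d j).\<close>
definition knorm2_diff ::
  "(real^'n \<Rightarrow> real) \<Rightarrow> nat \<Rightarrow> (nat \<Rightarrow> real) \<Rightarrow> (nat \<Rightarrow> real^'n)
     \<Rightarrow> nat \<Rightarrow> (nat \<Rightarrow> real) \<Rightarrow> (nat \<Rightarrow> real^'n) \<Rightarrow> real" where
  "knorm2_diff \<Phi> m a c m' b d =
     (\<Sum>i<m. \<Sum>j<m. a i * a j * \<Phi> (c i - c j))
     - 2 * (\<Sum>i<m. \<Sum>j<m'. a i * b j * \<Phi> (c i - d j))
     + (\<Sum>i<m'. \<Sum>j<m'. b i * b j * \<Phi> (d i - d j))"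

text \<open>The native space: all pointwise limits of sequences of finite kernel
  combinations which are Cauchy in the kernel norm (Aronszajn's construction
  of the reproducing kernel Hilbert space).\<close>
definition native_space :: "(real^'n \<Rightarrow> real) \<Rightarrow> (real^'n \<Rightarrow> real) set" where
  "native_space \<Phi> = {f. \<exists>(m::nat \<Rightarrow> nat) (a::nat \<Rightarrow> nat \<Rightarrow> real) (c::nat \<Rightarrow> nat \<Rightarrow> real^'n).
      (\<forall>\<epsilon>>0. \<exists>N. \<forall>p\<ge>N. \<forall>q\<ge>N.
          knorm2_diff \<Phi> (m p) (a p) (c p) (m q) (a q) (c q) < \<epsilon>) \<and>
      (\<forall>x. (\<lambda>n. \<Sum>i<m n. a n i * \<Phi> (x - c n i)) \<longlonglongrightarrow> f x)}"

end

theory Submission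
  imports Defs "HOL-Probability.Probability"
begin

text \<open>Let \<open>F\<close> be the Fourier transform of \<open>f_trunc l\<close> on the line. By Parseval's identity
  \<open>f_conv l\<close> is the cosine transform of \<open>L = F\<^sup>2 / (2 pi) \<ge> 0\<close>. Integrating the radial function
  \<open>L(norm w)\<close> on \<open>(2k+1)\<close>-space over the hyperplanes orthogonal to a fixed direction is, one planar
  polar integration at a time, the \<open>k\<close>-fold iteration of replacing \<open>M(t)\<close> by
  the integral of \<open>2 pi r M(r)\<close> over \<open>r \<ge> \<bar>t\<bar>\<close>, and on
  cosine transforms each such step acts as \<open>2 pi\<close> times \<open>Dop\<close>. Hence \<open>wu l k (norm x)\<close> is, up to a
  constant, the Fourier transform of \<open>L(norm w)\<close> on \<open>(2k+1)\<close>-space. Recurrences for Bessel-type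
  integrals give \<open>L(t) = O((1 + t) powr (-2 (l + 1)))\<close>. Finally, a Cauchy sequence in the kernel norm
  is a Cauchy sequence \<open>P\<^sub>n\<close> in \<open>L\<^sup>2\<close> of the measure \<open>L dw\<close>; if \<open>h\<close> is its limit, then the Fourier
  transform of the pointwise limit is a multiple of \<open>L h\<close>, whose square times \<open>(1 + (norm w)\<^sup>2) powr s\<close> is
  dominated by \<open>L (norm h)\<^sup>2\<close>.\<close>

section \<open>Continuity of translation\<close>

text \<open>One exponent governs the argument. With \<open>a = 2 * (l + 1)\<close> the density
  decays like \<open>(1 + t) powr (- a)\<close>, and every planar integration costs two powers.
  After \<open>k\<close> of them at least 2 remain because k \<le> l; this makes the last marginal
  integrable and its cosine transform continuous at the origin, where \<open>wu\<close> is defined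
  as a limit. The same rate bounds the density times the Sobolev weight as long as s \<le> l + 1. As
  this endpoint is included, the rate must be sharp for every real \<open>l\<close>: integration by
  parts trades one unit of \<open>l\<close> for one power of \<open>t\<close>, and the descent ends
  at an exponent in \<open>(-1, 0]\<close>, where the weight may be singular and its oscillating
  integral is estimated directly. The duality in \<open>is_fourier_L2\<close> calls for Parseval's
  identity on the intersection of L^1 and L^2. It is obtained by Gaussian summation of the transform
  of a correlation, and continuity of translation in L^1 makes that correlation continuous at the
  origin.\<close>

lemma lborel_affine_integrable:
  fixes f :: "'a::euclidean_space \<Rightarrow> 'b :: {banach, second_countable_topology}"
  assumes f: "integrable lborel f" and c: "c \<noteq> 0"
  shows "integrable lborel (\<lambda>x. f (t + c *\<^sub>R x))"
    and "(\<integral>x. f (t + c *\<^sub>R x) \<partial>lborel) = (1 / \<bar>c\<bar> ^ DIM('a)) *\<^sub>R (\<integral>x. f x \<partial>lborel)"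
proof -
  note [measurable] = borel_measurable_integrable[OF f, simplified]
  have "integrable lborel f \<longleftrightarrow> integrable lborel (\<lambda>x. \<bar>c\<bar> ^ DIM('a) *\<^sub>R f (t + c *\<^sub>R x))"
    by (subst lborel_affine[OF c, of t]) (simp add: integrable_density integrable_distr_eq)
  with f have 1: "integrable lborel (\<lambda>x. \<bar>c\<bar> ^ DIM('a) *\<^sub>R f (t + c *\<^sub>R x))" by simp
  from integrable_scaleR_right[OF this, of "1 / \<bar>c\<bar> ^ DIM('a)"] show "integrable lborel (\<lambda>x. f (t + c *\<^sub>R x))"
    using c by simp
  have "(\<integral>x. f x \<partial>lborel) = (\<integral>x. \<bar>c\<bar> ^ DIM('a) *\<^sub>R f (t + c *\<^sub>R x) \<partial>lborel)"
    by (subst lborel_affine[OF c, of t]) (simp add: integral_density integral_distr)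
  then show "(\<integral>x. f (t + c *\<^sub>R x) \<partial>lborel) = (1 / \<bar>c\<bar> ^ DIM('a)) *\<^sub>R (\<integral>x. f x \<partial>lborel)"
    using c by simp
qed

lemma lborel_shift_integrable:
  fixes f :: "'a::euclidean_space \<Rightarrow> 'b :: {banach, second_countable_topology}"
  assumes f: "integrable lborel f"
  shows "integrable lborel (\<lambda>x. f (x - t))"
    and "(\<integral>x. f (x - t) \<partial>lborel) = (\<integral>x. f x \<partial>lborel)"
    and "integrable lborel (\<lambda>x. f (t - x))"
    and "(\<integral>x. f (t - x) \<partial>lborel) = (\<integral>x. f x \<partial>lborel)"
  using lborel_affine_integrable[OF f, of 1 "- t"] lborel_affine_integrable[OF f, of "-1" t]
  by (simp_all add: algebra_simps)

text \<open>Translation is an isometry of L^1, so the conclusion is stable under L^1 limits of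
  \<open>v\<close>, by a split into three errors. This serves twice: to pass from open to measurable
  sets, and in the limit step of the induction over integrable functions.\<close>

lemma L1_translation_approx:
  fixes v :: "'a::euclidean_space \<Rightarrow> complex"
  assumes v: "integrable lborel v"
    and approx: "\<And>e. e > 0 \<Longrightarrow> \<exists>w. integrable lborel w \<and> (\<integral>x. norm (v x - w x) \<partial>lborel) < e \<and>
         (\<lambda>n. \<integral>x. norm (w (x - z n) - w x) \<partial>lborel) \<longlonglongrightarrow> 0"
  shows "(\<lambda>n::nat. \<integral>x. norm (v (x - z n) - v x) \<partial>lborel) \<longlonglongrightarrow> 0"
proof (rule LIMSEQ_I)
  fix r :: real assume r: "0 < r"
  obtain w where w: "integrable lborel w" "(\<integral>x. norm (v x - w x) \<partial>lborel) < r/3"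
    "(\<lambda>n. \<integral>x. norm (w (x - z n) - w x) \<partial>lborel) \<longlonglongrightarrow> 0"
    using approx[of "r/3"] r by auto
  from LIMSEQ_D[OF w(3), of "r/3"] r obtain N where
    N: "\<And>n. n \<ge> N \<Longrightarrow> norm (\<integral>x. norm (w (x - z n) - w x) \<partial>lborel) < r/3" by auto
  have vw: "integrable lborel (\<lambda>x. norm (v x - w x))" using v w by auto
  show "\<exists>no. \<forall>n\<ge>no. norm ((\<integral>x. norm (v (x - z n) - v x) \<partial>lborel) - 0) < r"
  proof (intro exI allI impI)
    fix n assume n: "n \<ge> N"
    have "(\<integral>x. norm (v (x - z n) - v x) \<partial>lborel)
      \<le> (\<integral>x. norm (v (x - z n) - w (x - z n)) + norm (w (x - z n) - w x) + norm (v x - w x) \<partial>lborel)"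
    proof (intro integral_mono)
      show "norm (v (x - z n) - v x) \<le> norm (v (x - z n) - w (x - z n)) + norm (w (x - z n) - w x) + norm (v x - w x)" for x
        using norm_triangle_ineq[of "v (x - z n) - w (x - z n) + (w (x - z n) - w x)" "w x - v x"]
          norm_triangle_ineq[of "v (x - z n) - w (x - z n)" "w (x - z n) - w x"]
        by (simp add: norm_minus_commute)
    qed (intro Bochner_Integration.integrable_add integrable_norm Bochner_Integration.integrable_diff
          lborel_shift_integrable(1)[of v] lborel_shift_integrable(1)[of w] v w(1))+
    also have "\<dots> = (\<integral>x. norm (v (x - z n) - w (x - z n)) \<partial>lborel)
        + (\<integral>x. norm (w (x - z n) - w x) \<partial>lborel) + (\<integral>x. norm (v x - w x) \<partial>lborel)"
      using v w by (auto simp: lborel_shift_integrable)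
    also have "(\<integral>x. norm (v (x - z n) - w (x - z n)) \<partial>lborel) = (\<integral>x. norm (v x - w x) \<partial>lborel)"
      by (rule lborel_shift_integrable(2)[OF vw])
    also have "\<dots> + (\<integral>x. norm (w (x - z n) - w x) \<partial>lborel) + (\<integral>x. norm (v x - w x) \<partial>lborel) < r"
      using w(2) N[OF n] by simp
    finally show "norm ((\<integral>x. norm (v (x - z n) - v x) \<partial>lborel) - 0) < r" by simp
  qed
qed

text \<open>A set and its translate have equal measure, so the L^1 distance of their indicators is
  twice the measure of the part of \<open>U\<close> outside the translate. As \<open>U\<close> is
  open, each of its points lies in the translate for all large \<open>n\<close>, and dominated
  convergence applies.\<close>

lemma L1_translation_open:
  fixes U :: "'a::euclidean_space set"
  assumes U: "open U" "emeasure lborel U < \<infinity>" and z: "z \<longlonglongrightarrow> 0"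
  shows "(\<lambda>n::nat. \<integral>x. norm (indicator U (x - z n) *\<^sub>R c - indicator U x *\<^sub>R (c::complex)) \<partial>lborel) \<longlonglongrightarrow> 0"
proof -
  let ?u = "indicator U :: 'a \<Rightarrow> real"
  have [measurable]: "U \<in> sets borel" using U by auto
  have iu: "integrable lborel ?u" using U by auto
  have eq: "(\<integral>x. norm (?u (x - z n) *\<^sub>R c - ?u x *\<^sub>R c) \<partial>lborel) =
      2 * norm c * (\<integral>x. ?u x * (1 - ?u (x - z n)) \<partial>lborel)" for n
  proof -
    have i2: "integrable lborel (\<lambda>x. ?u x * ?u (x - z n))"
      by (rule Bochner_Integration.integrable_bound[OF iu]) (auto split: split_indicator)
    note i3 = lborel_shift_integrable[OF iu, of "z n"]
    have "norm (?u (x - z n) *\<^sub>R c - ?u x *\<^sub>R c) =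
        norm c * (?u (x - z n) + ?u x - 2 * (?u x * ?u (x - z n)))" for x
      by (auto split: split_indicator)
    then have "(\<integral>x. norm (?u (x - z n) *\<^sub>R c - ?u x *\<^sub>R c) \<partial>lborel) =
        norm c * (2 * (\<integral>x. ?u x \<partial>lborel) - 2 * (\<integral>x. ?u x * ?u (x - z n) \<partial>lborel))"
      using iu i2 i3 by simp
    also have "\<dots> = 2 * norm c * (\<integral>x. ?u x * (1 - ?u (x - z n)) \<partial>lborel)"
      using iu i2 by (simp add: right_diff_distrib)
    finally show ?thesis .
  qed
  have "(\<lambda>n. \<integral>x. ?u x * (1 - ?u (x - z n)) \<partial>lborel) \<longlonglongrightarrow> (\<integral>x. 0 \<partial>(lborel::'a measure))"
  proof (rule integral_dominated_convergence[where w = ?u])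
    show "AE x in lborel. (\<lambda>n. ?u x * (1 - ?u (x - z n))) \<longlonglongrightarrow> 0"
    proof (rule AE_I2)
      fix x
      show "(\<lambda>n. ?u x * (1 - ?u (x - z n))) \<longlonglongrightarrow> 0"
      proof (cases "x \<in> U")
        case True
        have "(\<lambda>n. x - z n) \<longlonglongrightarrow> x" using tendsto_diff[OF tendsto_const z, of x] by simp
        from topological_tendstoD[OF this U(1) True]
        have "\<forall>\<^sub>F n in sequentially. ?u x * (1 - ?u (x - z n)) = 0"
          by eventually_elim auto
        then show ?thesis by (rule tendsto_eventually)
      qed auto
    qed
  qed (use iu in \<open>auto split: split_indicator\<close>)
  from tendsto_mult_left[OF this, of "2 * norm c"] show ?thesis
    unfolding eq by simp
qed

lemma L1_translation_continuous:
  fixes v :: "'a::euclidean_space \<Rightarrow> complex"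
  assumes v: "integrable lborel v" and z: "z \<longlonglongrightarrow> 0"
  shows "(\<lambda>n::nat. \<integral>x. norm (v (x - z n) - v x) \<partial>lborel) \<longlonglongrightarrow> 0"
  using v
proof (induction rule: integrable_induct)
  case (base A c)
  show ?case
  proof (rule L1_translation_approx)
    have [measurable]: "A \<in> sets borel" using base by simp
    fix e :: real assume e: "e > 0"
    \<comment> \<open>The summand 1 covers the case \<open>c = 0\<close>.\<close>
    define d where "d = e / (norm c + 1)"
    have d: "d > 0" "norm c * d < e" using e unfolding d_def
      by (auto simp: add_nonneg_pos divide_simps mult.commute intro!: add_nonneg_pos)
    \<comment> \<open>Outer regularity: \<open>A\<close> is close to an open set, for which the
      convergence is known.\<close>
    obtain U where U: "open U" "A \<subseteq> U" "emeasure lborel (U - A) < d"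
      using outer_regular_lborel[of A d] d base by auto
    have [measurable]: "U \<in> sets borel" using U by auto
    have "emeasure lborel U \<le> emeasure lborel (U - A) + emeasure lborel A"
      using U(2) by (subst plus_emeasure) (auto intro!: emeasure_mono)
    also have "\<dots> < \<infinity>" using U(3) base(2) by (auto simp: less_top[symmetric])
    finally have fU: "emeasure lborel U < \<infinity>" .
    have fUA: "emeasure lborel (U - A) < \<infinity>" using U(3) by (auto intro: less_trans)
    have "(\<integral>x. norm (indicator A x *\<^sub>R c - indicator U x *\<^sub>R c) \<partial>lborel) =
        (\<integral>x. indicator (U - A) x * norm c \<partial>lborel)"
      using U(2) by (intro Bochner_Integration.integral_cong) (auto split: split_indicator)
    also have "\<dots> = measure lborel (U - A) * norm c" by simp
    also have "\<dots> \<le> d * norm c"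
      using U(3) fUA d by (intro mult_right_mono) (auto simp: measure_def intro!: enn2real_leI)
    also have "\<dots> < e" using d by (simp add: mult.commute)
    finally show "\<exists>w. integrable lborel w \<and> (\<integral>x. norm (indicator A x *\<^sub>R c - w x) \<partial>lborel) < e \<and>
         (\<lambda>n. \<integral>x. norm (w (x - z n) - w x) \<partial>lborel) \<longlonglongrightarrow> 0"
      using L1_translation_open[OF U(1) fU z, of c] fU
      by (intro exI[of _ "\<lambda>x. indicator U x *\<^sub>R c"]) auto
  qed (use base in auto)
next
  case (add f g)
  show ?case
  proof (rule Lim_null_comparison)
    show "(\<lambda>n. (\<integral>x. norm (f (x - z n) - f x) \<partial>lborel) + (\<integral>x. norm (g (x - z n) - g x) \<partial>lborel)) \<longlonglongrightarrow> 0"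
      using tendsto_add[OF add(3,4)] by simp
    have "(\<integral>x. norm (f (x - z n) + g (x - z n) - (f x + g x)) \<partial>lborel)
      \<le> (\<integral>x. norm (f (x - z n) - f x) + norm (g (x - z n) - g x) \<partial>lborel)" for n
      by (intro integral_mono norm_diff_triangle_ineq Bochner_Integration.integrable_add integrable_norm
          Bochner_Integration.integrable_diff lborel_shift_integrable(1)[of f] lborel_shift_integrable(1)[of g] add)
    then show "\<forall>\<^sub>F n in sequentially. norm (\<integral>x. norm (f (x - z n) + g (x - z n) - (f x + g x)) \<partial>lborel)
      \<le> (\<integral>x. norm (f (x - z n) - f x) \<partial>lborel) + (\<integral>x. norm (g (x - z n) - g x) \<partial>lborel)"
      using lborel_shift_integrable(1)[OF add(1)] lborel_shift_integrable(1)[OF add(2)] add(1,2)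
      by (intro always_eventually allI) simp
  qed
next
  case (lim f s)
  show ?case
  proof (rule L1_translation_approx)
    fix e :: real assume e: "e > 0"
    have "(\<lambda>i. \<integral>x. norm (f x - s i x) \<partial>lborel) \<longlonglongrightarrow> (\<integral>x. 0 \<partial>(lborel::'a measure))"
    proof (rule integral_dominated_convergence[where w = "\<lambda>x. 3 * norm (f x)"])
      show "AE x in lborel. (\<lambda>i. norm (f x - s i x)) \<longlonglongrightarrow> 0"
      proof (rule AE_I2)
        fix x
        from tendsto_norm[OF tendsto_diff[OF tendsto_const[of "f x"] lim(2)[of x]]]
        show "(\<lambda>i. norm (f x - s i x)) \<longlonglongrightarrow> 0" by simp
      qed
      show "AE x in lborel. norm (norm (f x - s i x)) \<le> 3 * norm (f x)" for i
      proof (rule AE_I2)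
        fix x show "norm (norm (f x - s i x)) \<le> 3 * norm (f x)"
          using lim(3)[of x i] norm_triangle_ineq4[of "f x" "s i x"] by auto
      qed
    qed (use lim(1)[THEN borel_measurable_integrable] lim(4) in auto)
    from LIMSEQ_D[OF this e] obtain i where "norm (\<integral>x. norm (f x - s i x) \<partial>lborel) < e" by auto
    then show "\<exists>w. integrable lborel w \<and> (\<integral>x. norm (f x - w x) \<partial>lborel) < e \<and>
         (\<lambda>n. \<integral>x. norm (w (x - z n) - w x) \<partial>lborel) \<longlonglongrightarrow> 0"
      using lim(1,5) by (intro exI[of _ "s i"]) auto
  qed (use lim in auto)
qed

section \<open>Parseval's identity\<close>

text \<open>Left without the normalising factor of \<open>fourier_L1\<close>, so that products of
  transforms carry no constants; the factor returns at the end of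
  \<open>native_space_subset_sobolev_space\<close>. The domain is any Euclidean space because both
  the line and \<open>real^'n\<close> occur.\<close>

definition ft :: "('a::euclidean_space \<Rightarrow> complex) \<Rightarrow> 'a \<Rightarrow> complex" where
  "ft u w = (\<integral>x. u x * cis (- (w \<bullet> x)) \<partial>lborel)"

text \<open>The integrability that \<open>is_fourier_L2\<close> demands of its test functions: the
  transform is an absolutely convergent integral and is again square integrable.\<close>

definition L1_L2 :: "('a::euclidean_space \<Rightarrow> complex) \<Rightarrow> bool" where
  "L1_L2 u \<longleftrightarrow> integrable lborel u \<and> integrable lborel (\<lambda>x. (norm (u x))\<^sup>2)"

text \<open>The convolution of \<open>u\<close> with the reflected conjugate of \<open>v\<close>.
  Its value at 0 is the L^2 inner product and its transform is the product in Parseval's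
  identity.\<close>

definition correlation :: "('a::euclidean_space \<Rightarrow> complex) \<Rightarrow> ('a \<Rightarrow> complex) \<Rightarrow> 'a \<Rightarrow> complex" where
  "correlation u v z = (\<integral>x. u x * cnj (v (x - z)) \<partial>lborel)"

text \<open>The standard normal density, kept as a product so that its Fourier integral factors into
  one-dimensional characteristic functions.\<close>

definition gauss :: "'a::euclidean_space \<Rightarrow> real" where
  "gauss w = (\<Prod>b\<in>Basis. std_normal_density (w \<bullet> b))"

lemma measurable_cis[measurable]: "cis \<in> borel_measurable borel"
  by (intro borel_measurable_continuous_onI continuous_intros)

lemma measurable_cnj[measurable]: "cnj \<in> borel_measurable borel"
  by (intro borel_measurable_continuous_onI continuous_intros)

lemma mult_le_sum_squares: "(a::real) * b \<le> a\<^sup>2 + b\<^sup>2"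
proof -
  have "2 * (a * b) \<le> a\<^sup>2 + b\<^sup>2" using sum_squares_bound[of a b] by (simp add: mult.assoc)
  moreover have "0 \<le> a\<^sup>2 + b\<^sup>2" by simp
  ultimately show ?thesis by linarith
qed

lemma integrable_mult_cis:
  fixes f :: "'a \<Rightarrow> complex"
  assumes "integrable M f" "g \<in> borel_measurable M"
  shows "integrable M (\<lambda>x. f x * cis (g x))"
proof (rule Bochner_Integration.integrable_bound[OF assms(1)])
  show "(\<lambda>x. f x * cis (g x)) \<in> borel_measurable M" using assms by measurable
qed (simp add: norm_mult)

lemma integrable_product_sq:
  fixes f g :: "'a \<Rightarrow> complex"
  assumes [measurable]: "f \<in> borel_measurable M" "g \<in> borel_measurable M"
    and "integrable M (\<lambda>x. (norm (f x))\<^sup>2)" "integrable M (\<lambda>x. (norm (g x))\<^sup>2)"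
  shows "integrable M (\<lambda>x. f x * g x)"
proof (rule Bochner_Integration.integrable_bound)
  show "integrable M (\<lambda>x. (norm (f x))\<^sup>2 + (norm (g x))\<^sup>2)" using assms by simp
  have "norm (f x * g x) \<le> (norm (f x))\<^sup>2 + (norm (g x))\<^sup>2" for x
    by (simp add: norm_mult mult_le_sum_squares)
  then show "AE x in M. norm (f x * g x) \<le> norm ((norm (f x))\<^sup>2 + (norm (g x))\<^sup>2)" by simp
qed measurable

lemma ft_measurable:
  assumes [measurable]: "u \<in> borel_measurable borel"
  shows "ft u \<in> borel_measurable borel"
  unfolding ft_def[abs_def] by measurable

lemma correlation_bound:
  assumes u: "L1_L2 u" and v: "L1_L2 v"
  shows "norm (correlation u v z) \<le> (\<integral>x. (norm (u x))\<^sup>2 \<partial>lborel) + (\<integral>x. (norm (v x))\<^sup>2 \<partial>lborel)"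
proof -
  have u': "integrable lborel u" "integrable lborel (\<lambda>x. (norm (u x))\<^sup>2)"
    and v': "integrable lborel v" "integrable lborel (\<lambda>x. (norm (v x))\<^sup>2)"
    using u v by (auto simp: L1_L2_def)
  note [measurable] = borel_measurable_integrable[OF u'(1), simplified] borel_measurable_integrable[OF v'(1), simplified]
  have s: "integrable lborel (\<lambda>x. (norm (v (x - z)))\<^sup>2)"
    "(\<integral>x. (norm (v (x - z)))\<^sup>2 \<partial>lborel) = (\<integral>x. (norm (v x))\<^sup>2 \<partial>lborel)"
    using lborel_shift_integrable(1,2)[OF v'(2), of z] by auto
  have "integrable lborel (\<lambda>x. u x * cnj (v (x - z)))"
    by (rule integrable_product_sq) (use u' s in auto)
  then have "norm (correlation u v z) \<le> (\<integral>x. norm (u x * cnj (v (x - z))) \<partial>lborel)"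
    unfolding correlation_def by (intro integral_norm_bound)
  also have "\<dots> \<le> (\<integral>x. (norm (u x))\<^sup>2 + (norm (v (x - z)))\<^sup>2 \<partial>lborel)"
  proof (intro integral_mono)
    show "norm (u x * cnj (v (x - z))) \<le> (norm (u x))\<^sup>2 + (norm (v (x - z)))\<^sup>2" for x
      by (simp add: norm_mult mult_le_sum_squares)
  qed (use u' s \<open>integrable lborel (\<lambda>x. u x * cnj (v (x - z)))\<close> in auto)
  also have "\<dots> = (\<integral>x. (norm (u x))\<^sup>2 \<partial>lborel) + (\<integral>x. (norm (v x))\<^sup>2 \<partial>lborel)"
    using u' s by simp
  finally show ?thesis .
qed

text \<open>Since \<open>u\<close> may be unbounded, L^1 continuity of the translates of
  \<open>v\<close> alone does not suffice. It handles the set where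
  \<open>norm (u x) \<le> M\<close>; on the rest a weighted arithmetic-geometric mean inequality
  leaves a tail of the squared L^2 norm of \<open>u\<close> and a small multiple of that of the
  difference of \<open>v\<close> and its translate.\<close>

lemma correlation_continuous_0:
  fixes u v :: "'a::euclidean_space \<Rightarrow> complex"
  assumes u: "L1_L2 u" and v: "L1_L2 v" and z: "z \<longlonglongrightarrow> 0"
  shows "(\<lambda>n::nat. correlation u v (z n)) \<longlonglongrightarrow> correlation u v 0"
proof (rule LIMSEQ_I)
  have u': "integrable lborel u" "integrable lborel (\<lambda>x. (norm (u x))\<^sup>2)"
    and v': "integrable lborel v" "integrable lborel (\<lambda>x. (norm (v x))\<^sup>2)"
    using u v by (auto simp: L1_L2_def)
  note [measurable] = borel_measurable_integrable[OF u'(1), simplified] borel_measurable_integrable[OF v'(1), simplified]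
  define V where "V = (\<integral>x. (norm (v x))\<^sup>2 \<partial>lborel)"
  have V: "V \<ge> 0" unfolding V_def by simp
  fix e :: real assume e: "0 < e"
  \<comment> \<open>\<open>4 * V\<close> bounds the squared L^2 norm of every difference
    \<open>v (x - z n) - v x\<close>, so \<open>d\<close> times that quantity stays below
    \<open>e / 3\<close>; the summand 1 covers \<open>V = 0\<close>.\<close>
  define d where "d = e / (3 * (4 * V + 1))"
  have d: "d > 0" "d * (4 * V) < e / 3" using e V unfolding d_def
    by (auto simp: divide_simps intro!: add_nonneg_pos)
  define T where "T = (\<lambda>(M::nat) x. indicator {x. norm (u x) > real M} x * (norm (u x))\<^sup>2)"
  have Tint: "integrable lborel (T M)" for M
    by (rule Bochner_Integration.integrable_bound[OF u'(2)]) (auto simp: T_def split: split_indicator)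
  have "(\<lambda>M. \<integral>x. T M x \<partial>lborel) \<longlonglongrightarrow> (\<integral>x. 0 \<partial>(lborel :: 'a measure))"
  proof (rule integral_dominated_convergence[where w = "\<lambda>x. (norm (u x))\<^sup>2"])
    show "AE x in lborel. (\<lambda>M. T M x) \<longlonglongrightarrow> 0"
    proof (rule AE_I2)
      fix x
      obtain N :: nat where N: "norm (u x) \<le> real N" using real_arch_simple by blast
      have "\<forall>\<^sub>F M in sequentially. T M x = 0"
        unfolding T_def using N by (intro eventually_sequentiallyI[of N]) auto
      then show "(\<lambda>M. T M x) \<longlonglongrightarrow> 0" by (rule tendsto_eventually)
    qed
  qed (use u'(2) in \<open>auto simp: T_def split: split_indicator\<close>)
  \<comment> \<open>\<open>M\<close> depends on \<open>d\<close>, because the tail of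
    \<open>u\<close> enters divided by \<open>d\<close>.\<close>
  from LIMSEQ_D[OF this, of "e * d / 3"] e d obtain M where M: "norm (\<integral>x. T M x \<partial>lborel) < e * d / 3" by auto
  have M': "(\<integral>x. T M x \<partial>lborel) / d < e / 3" using M d(1) by (auto simp: field_simps)
  have "(\<lambda>n. real M * (\<integral>x. norm (v (x - z n) - v x) \<partial>lborel)) \<longlonglongrightarrow> 0"
    by (intro tendsto_mult_right_zero L1_translation_continuous[OF v'(1) z])
  from LIMSEQ_D[OF this, of "e/3"] e obtain N where
    N: "\<And>n. n \<ge> N \<Longrightarrow> norm (real M * (\<integral>x. norm (v (x - z n) - v x) \<partial>lborel)) < e / 3" by auto
  show "\<exists>no. \<forall>n\<ge>no. norm (correlation u v (z n) - correlation u v 0) < e"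
  proof (intro exI allI impI)
    fix n assume n: "N \<le> n"
    define w where "w = (\<lambda>x. v (x - z n) - v x)"
    have [measurable]: "w \<in> borel_measurable borel" unfolding w_def by measurable
    have s: "integrable lborel (\<lambda>x. (norm (v (x - z n)))\<^sup>2)"
      "(\<integral>x. (norm (v (x - z n)))\<^sup>2 \<partial>lborel) = V"
      using lborel_shift_integrable(1,2)[OF v'(2), of "z n"] by (auto simp: V_def)
    have wsq: "(norm (w x))\<^sup>2 \<le> 2 * (norm (v (x - z n)))\<^sup>2 + 2 * (norm (v x))\<^sup>2" for x
    proof -
      have "(norm (w x))\<^sup>2 \<le> (norm (v (x - z n)) + norm (v x))\<^sup>2"
        unfolding w_def by (intro power_mono norm_triangle_ineq4) auto
      also have "\<dots> \<le> 2 * (norm (v (x - z n)))\<^sup>2 + 2 * (norm (v x))\<^sup>2"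
        using sum_squares_bound[of "norm (v (x - z n))" "norm (v x)"] by (simp add: power2_sum)
      finally show ?thesis .
    qed
    have w2: "integrable lborel (\<lambda>x. (norm (w x))\<^sup>2)"
      by (rule Bochner_Integration.integrable_bound[where f = "\<lambda>x. 2 * (norm (v (x - z n)))\<^sup>2 + 2 * (norm (v x))\<^sup>2"])
        (use s v' wsq in auto)
    have "(\<integral>x. (norm (w x))\<^sup>2 \<partial>lborel) \<le> (\<integral>x. 2 * (norm (v (x - z n)))\<^sup>2 + 2 * (norm (v x))\<^sup>2 \<partial>lborel)"
      by (intro integral_mono w2 wsq) (use s v' in auto)
    also have "\<dots> = 4 * V" using s v' by (simp add: V_def)
    finally have w2V: "(\<integral>x. (norm (w x))\<^sup>2 \<partial>lborel) \<le> 4 * V" .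
    have w1: "integrable lborel w" unfolding w_def using v'(1)
      by (intro Bochner_Integration.integrable_diff lborel_shift_integrable(1)[of v])
    have i1: "integrable lborel (\<lambda>x. u x * cnj (v (x - z n)))"
      by (rule integrable_product_sq) (use u' s in auto)
    have i2: "integrable lborel (\<lambda>x. u x * cnj (v x))"
      by (rule integrable_product_sq) (use u' v' in auto)
    have i3: "integrable lborel (\<lambda>x. u x * cnj (w x))"
      by (rule integrable_product_sq) (use u' w2 in auto)
    have pt: "norm (u x * cnj (w x)) \<le> real M * norm (w x) + T M x / d + d * (norm (w x))\<^sup>2" for x
    proof (cases "norm (u x) \<le> real M")
      case True
      then have "norm (u x) * norm (w x) \<le> real M * norm (w x)" by (intro mult_right_mono) auto
      moreover have "0 \<le> T M x / d" "0 \<le> d * (norm (w x))\<^sup>2" using d(1) by (auto simp: T_def)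
      ultimately show ?thesis by (simp add: norm_mult)
    next
      case False
      have "2 * (norm (u x) / sqrt d) * (sqrt d * norm (w x)) \<le> (norm (u x) / sqrt d)\<^sup>2 + (sqrt d * norm (w x))\<^sup>2"
        by (rule sum_squares_bound)
      then have "2 * (norm (u x) * norm (w x)) \<le> T M x / d + d * (norm (w x))\<^sup>2"
        using d(1) False by (simp add: T_def power_divide power_mult_distrib)
      moreover have "0 \<le> real M * norm (w x)" "0 \<le> norm (u x) * norm (w x)" by auto
      ultimately show ?thesis unfolding norm_mult complex_mod_cnj by linarith
    qed
    have "correlation u v (z n) - correlation u v 0 = (\<integral>x. u x * cnj (w x) \<partial>lborel)"
      unfolding correlation_def using i1 i2
      by (subst Bochner_Integration.integral_diff[symmetric]) (auto simp: w_def algebra_simps)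
    then have "norm (correlation u v (z n) - correlation u v 0) \<le> (\<integral>x. norm (u x * cnj (w x)) \<partial>lborel)"
      by (simp only:) (rule integral_norm_bound)
    also have "\<dots> \<le> (\<integral>x. real M * norm (w x) + T M x / d + d * (norm (w x))\<^sup>2 \<partial>lborel)"
      by (intro integral_mono pt integrable_norm i3 Bochner_Integration.integrable_add
          integrable_mult_right integrable_divide w1 w2 Tint)
    also have "\<dots> = real M * (\<integral>x. norm (w x) \<partial>lborel) + (\<integral>x. T M x \<partial>lborel) / d + d * (\<integral>x. (norm (w x))\<^sup>2 \<partial>lborel)"
      using w1 w2 Tint by simp
    also have "\<dots> < e / 3 + e / 3 + e / 3"
    proof -
      have "real M * (\<integral>x. norm (w x) \<partial>lborel) < e / 3" using N[OF n] by (simp add: w_def)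
      moreover have "d * (\<integral>x. (norm (w x))\<^sup>2 \<partial>lborel) < e / 3"
        using mult_left_mono[OF w2V, of d] d by linarith
      ultimately show ?thesis using M' by linarith
    qed
    finally show "norm (correlation u v (z n) - correlation u v 0) < e" by simp
  qed
qed


text \<open>Fubini with the substitution \<open>y = x - z\<close>: the phase at \<open>z\<close> is
  the phase at \<open>x\<close> times the conjugate of the phase at \<open>x - z\<close>.\<close>

lemma ft_correlation:
  fixes u v :: "'a::euclidean_space \<Rightarrow> complex"
  assumes u: "integrable lborel u" and v: "integrable lborel v"
  shows "integrable lborel (correlation u v)" "ft (correlation u v) w = ft u w * cnj (ft v w)"
proof -
  note [measurable] = borel_measurable_integrable[OF u, simplified] borel_measurable_integrable[OF v, simplified]
  define H where "H = (\<lambda>x z. u x * cnj (v (x - z)))"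
  have H[measurable]: "case_prod H \<in> borel_measurable (lborel \<Otimes>\<^sub>M lborel)"
    unfolding H_def by measurable
  have iv: "integrable lborel (\<lambda>x. norm (v x))" using v by auto
  have iH: "integrable (lborel \<Otimes>\<^sub>M lborel) (case_prod H)"
  proof (rule lborel_pair.Fubini_integrable[OF H])
    have "(\<integral>z. norm (case (x, z) of (x, xa) \<Rightarrow> H x xa) \<partial>lborel) = norm (u x) * (\<integral>z. norm (v z) \<partial>lborel)" for x
      unfolding H_def using lborel_shift_integrable(3,4)[OF iv, of x] by (simp add: norm_mult)
    then show "integrable lborel (\<lambda>x. \<integral>z. norm (case (x, z) of (x, xa) \<Rightarrow> H x xa) \<partial>lborel)"
      using u by simp
    show "AE x in lborel. integrable lborel (\<lambda>z. case (x, z) of (x, xa) \<Rightarrow> H x xa)"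
      unfolding H_def using lborel_shift_integrable(3)[OF v] by auto
  qed
  show "integrable lborel (correlation u v)"
    using lborel_pair.integrable_snd[OF iH] by (simp add: correlation_def[abs_def] H_def)
  have iHc: "integrable (lborel \<Otimes>\<^sub>M lborel) (\<lambda>(x, z). H x z * cis (- (w \<bullet> z)))"
    using integrable_mult_cis[OF iH, of "\<lambda>p. - (w \<bullet> snd p)"] by (simp add: case_prod_unfold)
  have "ft (correlation u v) w = (\<integral>z. \<integral>x. H x z * cis (- (w \<bullet> z)) \<partial>lborel \<partial>lborel)"
    unfolding ft_def correlation_def H_def by simp
  also have "\<dots> = (\<integral>x. \<integral>z. H x z * cis (- (w \<bullet> z)) \<partial>lborel \<partial>lborel)"
    by (rule lborel_pair.Fubini_integral[OF iHc])
  also have "\<dots> = (\<integral>x. u x * cis (- (w \<bullet> x)) * cnj (ft v w) \<partial>lborel)"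
  proof (rule Bochner_Integration.integral_cong[OF refl])
    fix x
    define g where "g = (\<lambda>y. cnj (v y * cis (- (w \<bullet> y))))"
    have g: "integrable lborel g" unfolding g_def
      using v by (intro integrable_cnj integrable_mult_cis) auto
    have "H x z * cis (- (w \<bullet> z)) = u x * cis (- (w \<bullet> x)) * g (x - z)" for z
      by (simp add: H_def g_def cis_cnj cis_mult inner_diff_right algebra_simps)
    then have "(\<integral>z. H x z * cis (- (w \<bullet> z)) \<partial>lborel) = u x * cis (- (w \<bullet> x)) * (\<integral>z. g (x - z) \<partial>lborel)"
      using lborel_shift_integrable(3)[OF g] by simp
    also have "(\<integral>z. g (x - z) \<partial>lborel) = cnj (ft v w)"
      unfolding lborel_shift_integrable(4)[OF g] unfolding ft_def g_def by (rule integral_bounded_linear'[OF bounded_linear_cnj bounded_linear_cnj]) auto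
    finally show "(\<integral>z. H x z * cis (- (w \<bullet> z)) \<partial>lborel) = u x * cis (- (w \<bullet> x)) * cnj (ft v w)" .
  qed
  also have "\<dots> = ft u w * cnj (ft v w)"
    unfolding ft_def using u by simp
  finally show "ft (correlation u v) w = ft u w * cnj (ft v w)" .
qed

section \<open>Gaussians and Fourier inversion at the origin\<close>

lemma gauss_measurable[measurable]: "gauss \<in> borel_measurable borel"
  unfolding gauss_def[abs_def] by measurable

lemma gauss_pos: "0 < gauss w"
  unfolding gauss_def by (intro prod_pos) (auto simp: normal_density_pos)

lemma gauss_eq: "gauss (w::'a::euclidean_space) = (1 / sqrt (2 * pi)) ^ DIM('a) * exp (- (norm w)\<^sup>2 / 2)"
proof -
  have "(norm w)\<^sup>2 = (\<Sum>b\<in>Basis. (w \<bullet> b)\<^sup>2)"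
    by (subst power2_norm_eq_inner, subst euclidean_inner) (simp add: power2_eq_square)
  then have "exp (- (norm w)\<^sup>2 / 2) = (\<Prod>b\<in>Basis. exp (- (w \<bullet> b)\<^sup>2 / 2))"
    by (simp add: exp_sum[symmetric] sum_negf[symmetric] sum_divide_distrib)
  then show ?thesis
    unfolding gauss_def std_normal_density_def prod.distrib by simp
qed

lemma gauss_le: "gauss (w::'a::euclidean_space) \<le> gauss (0::'a::euclidean_space)"
  unfolding gauss_eq by (intro mult_left_mono) auto

text \<open>Coordinatewise this is the characteristic function of the standard normal distribution;
  the factor \<open>sqrt (2 * pi)\<close> expresses it through the normal density again.\<close>

lemma gauss_fourier:
  fixes z :: "'a::euclidean_space"
  shows "integrable lborel (gauss :: 'a \<Rightarrow> real)" "(\<integral>w. gauss w \<partial>(lborel::'a measure)) = 1"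
    and "(\<integral>w. of_real (gauss w) * cis (- (z \<bullet> w)) \<partial>lborel) = of_real ((sqrt (2 * pi)) ^ DIM('a) * gauss z)"
proof -
  interpret product_sigma_finite "\<lambda>_::'a. lborel :: real measure" ..
  have *: "(\<Sum>b\<in>Basis. x b *\<^sub>R b) \<bullet> c = x c" if "c \<in> Basis" for x and c :: 'a
    using that by simp
  have g: "gauss (\<Sum>b\<in>Basis. x b *\<^sub>R b :: 'a) = (\<Prod>b\<in>Basis. std_normal_density (x b))" for x
    unfolding gauss_def by (intro prod.cong refl) (simp add: *)
  have c: "of_real (gauss (\<Sum>b\<in>Basis. x b *\<^sub>R b :: 'a)) * cis (- (z \<bullet> (\<Sum>b\<in>Basis. x b *\<^sub>R b)))
      = (\<Prod>b\<in>Basis. of_real (std_normal_density (x b)) * iexp (- (z \<bullet> b) * x b))" for x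
    unfolding g prod.distrib of_real_prod
    by (simp add: inner_sum_right exp_sum[symmetric] cis_conv_exp sum_negf[symmetric] sum_distrib_left mult.commute)
  show "integrable lborel (gauss :: 'a \<Rightarrow> real)"
    unfolding lborel_eq[where 'a='a]
    by (subst integrable_distr_eq) (auto simp: g intro!: product_integrable_prod)
  show "(\<integral>w. gauss w \<partial>(lborel::'a measure)) = 1"
    unfolding lborel_eq[where 'a='a]
    by (subst integral_distr, simp, simp, unfold g, subst product_integral_prod) auto
  have i1: "integrable lborel (\<lambda>x. of_real (std_normal_density x) * iexp (t * x))" for t :: real
    using integrable_mult_cis[of lborel "\<lambda>x. of_real (std_normal_density x)" "\<lambda>x. t * x"]
    by (simp add: cis_conv_exp)
  have i2: "(\<integral>x. of_real (std_normal_density x) * iexp (t * x) \<partial>lborel) = of_real (sqrt (2 * pi) * std_normal_density t)" for t :: real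
    using fun_cong[OF char_std_normal_distribution, of t]
    by (simp add: char_def integral_density scaleR_conv_of_real std_normal_density_def)
  show "(\<integral>w. of_real (gauss w) * cis (- (z \<bullet> w)) \<partial>lborel) = of_real ((sqrt (2 * pi)) ^ DIM('a) * gauss z)"
    unfolding lborel_eq[where 'a='a]
  proof (subst integral_distr, simp, simp, unfold c, subst product_integral_prod)
    show "(\<Prod>b\<in>Basis. \<integral>x. of_real (std_normal_density x) * iexp (- (z \<bullet> b) * x) \<partial>lborel) = complex_of_real (sqrt (2 * pi) ^ DIM('a) * gauss z)"
      unfolding i2 gauss_def by (simp add: prod.distrib prod_dividef std_normal_density_def)
    show "integrable lborel (\<lambda>x. of_real (std_normal_density x) * iexp (- (z \<bullet> b) * x))" for b
      by (rule i1)
  qed simp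
qed

text \<open>Inversion in summed form, as \<open>ft C\<close> need not be integrable. Moving the
  transform from \<open>C\<close> to the Gaussian turns the widening weight into a concentrating
  one: up to a constant the integral is the mean of \<open>C (e *\<^sub>R w)\<close> against
  \<open>gauss\<close>, which tends to \<open>C 0\<close>.\<close>

lemma ft_gauss_limit:
  fixes C :: "'a::euclidean_space \<Rightarrow> complex"
  assumes C: "integrable lborel C" and bound: "\<And>z. norm (C z) \<le> B"
    and cont: "\<And>z. z \<longlonglongrightarrow> 0 \<Longrightarrow> (\<lambda>n::nat. C (z n)) \<longlonglongrightarrow> C 0"
  shows "(\<lambda>n. \<integral>w. ft C w * of_real (gauss ((1 / real (Suc n)) *\<^sub>R w)) \<partial>lborel)
    \<longlonglongrightarrow> of_real (sqrt (2 * pi) ^ DIM('a)) * C 0"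
proof -
  note [measurable] = borel_measurable_integrable[OF C, simplified]
  define K where "K = sqrt (2 * pi) ^ DIM('a)"
  note gi = gauss_fourier(1)[where 'a='a]
  have Cg: "integrable lborel (\<lambda>w. C (e *\<^sub>R w) * of_real (gauss w))" for e
  proof (rule Bochner_Integration.integrable_bound[where f = "\<lambda>w. B * gauss w"])
    have "0 \<le> B" using bound[of 0] norm_ge_zero[of "C 0"] by linarith
    then show "AE w in lborel. norm (C (e *\<^sub>R w) * of_real (gauss w)) \<le> norm (B * gauss w)"
      using bound by (auto simp: norm_mult abs_mult intro!: mult_right_mono AE_I2)
  qed (use gi in auto)
  have eq: "(\<integral>w. ft C w * of_real (gauss (e *\<^sub>R w)) \<partial>lborel) = of_real K * (\<integral>w. C (e *\<^sub>R w) * of_real (gauss w) \<partial>lborel)"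
    if e: "e > 0" for e
  proof -
    have gie: "integrable lborel (\<lambda>w::'a. gauss (e *\<^sub>R w))"
      using lborel_affine_integrable(1)[OF gi, of e 0] e by simp
    have gie': "integrable lborel (\<lambda>w::'a. complex_of_real (gauss (e *\<^sub>R w)))"
      by (rule integrable_of_real[OF gie])
    have inner: "(\<integral>w. of_real (gauss (e *\<^sub>R w)) * cis (- (z \<bullet> w)) \<partial>lborel)
        = of_real (K / e ^ DIM('a) * gauss ((1 / e) *\<^sub>R z))" for z :: 'a
    proof -
      define f where "f = (\<lambda>y. complex_of_real (gauss y) * cis (- (((1 / e) *\<^sub>R z) \<bullet> y)))"
      have f: "integrable lborel f" unfolding f_def
        using gi by (intro integrable_mult_cis) auto
      have "(\<integral>w. of_real (gauss (e *\<^sub>R w)) * cis (- (z \<bullet> w)) \<partial>lborel) = (\<integral>w. f (0 + e *\<^sub>R w) \<partial>lborel)"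
        using e by (simp add: f_def)
      also have "\<dots> = (1 / \<bar>e\<bar> ^ DIM('a)) *\<^sub>R (\<integral>w. f w \<partial>lborel)"
        by (rule lborel_affine_integrable(2)[OF f]) (use e in simp)
      also have "(\<integral>w. f w \<partial>lborel) = of_real (K * gauss ((1 / e) *\<^sub>R z))"
        unfolding f_def gauss_fourier(3) K_def ..
      finally show ?thesis using e by (simp add: scaleR_conv_of_real)
    qed
    have iP: "integrable (lborel \<Otimes>\<^sub>M lborel) (\<lambda>(z, w :: 'a). C z * of_real (gauss (e *\<^sub>R w)))"
    proof (rule lborel_pair.Fubini_integrable)
      show "integrable lborel (\<lambda>z. \<integral>w. norm (case (z, w :: 'a) of (z, w) \<Rightarrow> C z * of_real (gauss (e *\<^sub>R w))) \<partial>lborel)"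
        using C by (auto simp: norm_mult)
      show "AE z in lborel. integrable lborel (\<lambda>w :: 'a. case (z, w) of (z, w) \<Rightarrow> C z * of_real (gauss (e *\<^sub>R w)))"
        unfolding prod.case by (intro AE_I2 integrable_mult_right gie')
    qed measurable
    have iP': "integrable (lborel \<Otimes>\<^sub>M lborel) (\<lambda>(z, w). C z * of_real (gauss (e *\<^sub>R w)) * cis (- (z \<bullet> w)))"
      using integrable_mult_cis[OF iP, of "\<lambda>p. - (fst p \<bullet> snd p)"] by (simp add: case_prod_unfold)
    have "(\<integral>w. ft C w * of_real (gauss (e *\<^sub>R w)) \<partial>lborel)
        = (\<integral>w. \<integral>z. C z * of_real (gauss (e *\<^sub>R w)) * cis (- (z \<bullet> w)) \<partial>lborel \<partial>lborel)"
    proof (rule Bochner_Integration.integral_cong[OF refl])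
      fix w :: 'a
      have "ft C w * of_real (gauss (e *\<^sub>R w)) = (\<integral>z. C z * cis (- (w \<bullet> z)) * of_real (gauss (e *\<^sub>R w)) \<partial>lborel)"
        unfolding ft_def by simp
      then show "ft C w * of_real (gauss (e *\<^sub>R w)) = (\<integral>z. C z * of_real (gauss (e *\<^sub>R w)) * cis (- (z \<bullet> w)) \<partial>lborel)"
        by (simp add: mult_ac inner_commute)
    qed
    also have "\<dots> = (\<integral>z. \<integral>w. C z * of_real (gauss (e *\<^sub>R w)) * cis (- (z \<bullet> w)) \<partial>lborel \<partial>lborel)"
      by (rule lborel_pair.Fubini_integral[OF iP'])
    also have "\<dots> = (\<integral>z. C z * (of_real (K / e ^ DIM('a) * gauss ((1 / e) *\<^sub>R z))) \<partial>lborel)"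
      unfolding inner[symmetric] by (simp add: mult.assoc)
    also have "\<dots> = (\<integral>z. (of_real (K / e ^ DIM('a))) * (C z * of_real (gauss ((1 / e) *\<^sub>R z))) \<partial>lborel)"
      by (simp add: mult_ac)
    also have "\<dots> = of_real (K / e ^ DIM('a)) * (\<integral>z. C z * of_real (gauss ((1 / e) *\<^sub>R z)) \<partial>lborel)"
      by simp
    \<comment> \<open>A dilation by \<open>1 / e\<close>; its Jacobian cancels the factor
      \<open>1 / e ^ DIM('a)\<close> of the inner integral.\<close>
    also have "(\<integral>z. C z * of_real (gauss ((1 / e) *\<^sub>R z)) \<partial>lborel) =
        (\<integral>z. C (e *\<^sub>R (0 + (1 / e) *\<^sub>R z)) * of_real (gauss (0 + (1 / e) *\<^sub>R z)) \<partial>lborel)"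
      using e by simp
    also have "\<dots> = (1 / \<bar>1 / e\<bar> ^ DIM('a)) *\<^sub>R (\<integral>w. C (e *\<^sub>R w) * of_real (gauss w) \<partial>lborel)"
      by (rule lborel_affine_integrable(2)[OF Cg]) (use e in simp)
    also have "of_real (K / e ^ DIM('a)) * \<dots> = of_real K * (\<integral>w. C (e *\<^sub>R w) * of_real (gauss w) \<partial>lborel)"
      using e by (simp add: scaleR_conv_of_real power_divide)
    finally show ?thesis .
  qed
  have "(\<lambda>n. \<integral>w. C ((1 / real (Suc n)) *\<^sub>R w) * of_real (gauss w) \<partial>lborel) \<longlonglongrightarrow> (\<integral>w. C 0 * of_real (gauss (w :: 'a)) \<partial>lborel)"
  proof (rule integral_dominated_convergence[where w = "\<lambda>w. B * gauss w"])
    show "AE w in lborel. (\<lambda>n. C ((1 / real (Suc n)) *\<^sub>R w) * of_real (gauss w)) \<longlonglongrightarrow> C 0 * of_real (gauss w)"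
    proof (rule AE_I2)
      fix w :: 'a
      have "(\<lambda>n. (1 / real (Suc n)) *\<^sub>R w) \<longlonglongrightarrow> 0 *\<^sub>R w"
        by (intro tendsto_scaleR tendsto_const LIMSEQ_inverse_real_of_nat[unfolded inverse_eq_divide])
      then show "(\<lambda>n. C ((1 / real (Suc n)) *\<^sub>R w) * of_real (gauss w)) \<longlonglongrightarrow> C 0 * of_real (gauss w)"
        by (intro tendsto_mult tendsto_const cont) simp
    qed
    show "AE w in lborel. norm (C ((1 / real (Suc n)) *\<^sub>R w) * of_real (gauss w)) \<le> B * gauss w" for n
      using bound by (auto simp: norm_mult gauss_pos less_imp_le intro!: mult_right_mono)
  qed (use gi in auto)
  also have "(\<integral>w. C 0 * of_real (gauss (w :: 'a)) \<partial>lborel) = C 0"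
    using gauss_fourier(1,2)[where 'a='a] by simp
  finally show ?thesis
    unfolding K_def[symmetric] by (subst eq) (auto intro: tendsto_mult_left)
qed

section \<open>From Gaussian means to the Plancherel theorem\<close>

lemma L1_L2_measurable: "L1_L2 u \<Longrightarrow> u \<in> borel_measurable borel"
  unfolding L1_L2_def using borel_measurable_integrable by auto

text \<open>\<open>Suc n\<close> avoids the factor \<open>1 / 0\<close>. The values increase to
  \<open>gauss 0\<close> rather than to 1; this constant is cancelled at the end of
  \<open>parseval\<close>.\<close>

definition gauss_dilate :: "nat \<Rightarrow> 'a::euclidean_space \<Rightarrow> real" where
  "gauss_dilate n w = gauss ((1 / real (Suc n)) *\<^sub>R w)"

lemma gauss_dilate_bounds:
  fixes w :: "'a::euclidean_space"
  shows "0 < gauss_dilate n w" "gauss_dilate n w \<le> gauss (0::'a)"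
  unfolding gauss_dilate_def using gauss_pos gauss_le by auto

lemma gauss_dilate_measurable[measurable]: "gauss_dilate n \<in> borel_measurable borel"
  unfolding gauss_dilate_def[abs_def] by measurable

lemma gauss_dilate_integrable: "integrable lborel (gauss_dilate n)"
  unfolding gauss_dilate_def[abs_def]
  using lborel_affine_integrable(1)[OF gauss_fourier(1), of "1 / real (Suc n)" 0] by simp

lemma gauss_dilate_tendsto:
  fixes w :: "'a::euclidean_space"
  shows "(\<lambda>n. gauss_dilate n w) \<longlonglongrightarrow> gauss (0::'a)"
proof -
  have "(\<lambda>n. gauss ((1 / real (Suc n)) *\<^sub>R w)) \<longlonglongrightarrow> gauss (0 *\<^sub>R w)"
    unfolding gauss_eq by (intro tendsto_intros LIMSEQ_inverse_real_of_nat[unfolded inverse_eq_divide]) simp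
  then show ?thesis unfolding gauss_dilate_def by simp
qed

lemma gauss_dilate_mono: "mono (\<lambda>n. gauss_dilate n w)"
proof (rule monoI)
  fix m n :: nat assume "m \<le> n"
  then have "(norm ((1 / real (Suc n)) *\<^sub>R w))\<^sup>2 \<le> (norm ((1 / real (Suc m)) *\<^sub>R w))\<^sup>2"
    by (intro power_mono) (auto simp: intro!: divide_left_mono)
  then show "gauss_dilate m w \<le> gauss_dilate n w" unfolding gauss_dilate_def gauss_eq by (intro mult_left_mono) auto
qed

lemma correlation_gauss_limit:
  fixes u v :: "'a::euclidean_space \<Rightarrow> complex"
  assumes u: "L1_L2 u" and v: "L1_L2 v"
  shows "(\<lambda>n. \<integral>w. (ft u w * cnj (ft v w)) * of_real (gauss_dilate n w) \<partial>lborel)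
    \<longlonglongrightarrow> of_real (sqrt (2 * pi) ^ DIM('a)) * correlation u v 0"
  unfolding gauss_dilate_def
  using ft_gauss_limit[OF ft_correlation(1)[of u v] correlation_bound[OF u v] correlation_continuous_0[OF u v]] u v
  by (simp add: ft_correlation L1_L2_def)

lemma norm_ft_le: "norm (ft u w) \<le> (\<integral>x. norm (u x) \<partial>lborel)"
  unfolding ft_def by (rule order_trans[OF integral_norm_bound]) (simp add: norm_mult)

text \<open>For \<open>v = u\<close> the integrand of the Gaussian means is nonnegative and
  increases with \<open>n\<close>, so monotone convergence turns their finite limit into
  integrability.\<close>

lemma ft_square_integrable:
  fixes u :: "'a::euclidean_space \<Rightarrow> complex"
  assumes u: "L1_L2 u"
  shows "integrable lborel (\<lambda>w. (norm (ft u w))\<^sup>2)"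
proof -
  have "integrable lborel (\<lambda>w. (norm (ft u w))\<^sup>2 * gauss (0::'a))"
  proof (rule integral_monotone_convergence_nonneg(1)[where f = "\<lambda>n w. (norm (ft u w))\<^sup>2 * gauss_dilate n w"])
    have "(\<lambda>n. Re (\<integral>w. (ft u w * cnj (ft u w)) * of_real (gauss_dilate n w) \<partial>lborel)) \<longlonglongrightarrow>
      Re (of_real (sqrt (2 * pi) ^ DIM('a)) * correlation u u 0)"
      by (intro tendsto_Re correlation_gauss_limit u)
    moreover have "(\<integral>w. (ft u w * cnj (ft u w)) * of_real (gauss_dilate n w) \<partial>lborel) = of_real (\<integral>w. (norm (ft u w))\<^sup>2 * gauss_dilate n w \<partial>lborel)" for n
      unfolding integral_complex_of_real[symmetric] complex_norm_square[symmetric] by (simp add: complex_norm_square)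
    ultimately show "(\<lambda>n. \<integral>w. (norm (ft u w))\<^sup>2 * gauss_dilate n w \<partial>lborel) \<longlonglongrightarrow> Re (of_real (sqrt (2 * pi) ^ DIM('a)) * correlation u u 0)"
      by simp
    show "integrable lborel (\<lambda>w. (norm (ft u w))\<^sup>2 * gauss_dilate n w)" for n
    proof (rule Bochner_Integration.integrable_bound[where f = "\<lambda>w. (\<integral>x. norm (u x) \<partial>lborel)\<^sup>2 * gauss_dilate n w"])
      show "AE w in lborel. norm ((norm (ft u w))\<^sup>2 * gauss_dilate n w) \<le> norm ((\<integral>x. norm (u x) \<partial>lborel)\<^sup>2 * gauss_dilate n w)"
        using norm_ft_le[of u] gauss_dilate_bounds by (auto simp: abs_mult intro!: mult_right_mono power_mono)
    qed (use gauss_dilate_integrable ft_measurable[OF L1_L2_measurable[OF u]] in auto)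
    show "AE w in lborel. mono (\<lambda>n. (norm (ft u w))\<^sup>2 * gauss_dilate n w)"
      by (intro AE_I2 monoI mult_left_mono monoD[OF gauss_dilate_mono]) auto
    show "AE w in lborel. (\<lambda>n. (norm (ft u w))\<^sup>2 * gauss_dilate n w) \<longlonglongrightarrow> (norm (ft u w))\<^sup>2 * gauss (0::'a)"
      by (intro AE_I2 tendsto_mult_left gauss_dilate_tendsto)
  qed (use gauss_dilate_bounds ft_measurable[OF L1_L2_measurable[OF u]] in \<open>auto intro!: AE_I2 mult_nonneg_nonneg less_imp_le[OF gauss_dilate_bounds(1)]\<close>)
  then show ?thesis
    using gauss_pos[of "0::'a"] by simp
qed

text \<open>The product of the transforms is integrable by now, so the Gaussian means converge by
  domination to the integral times \<open>gauss 0\<close>; this is compared with the limit given by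
  \<open>correlation_gauss_limit\<close>.\<close>

theorem parseval:
  fixes u v :: "'a::euclidean_space \<Rightarrow> complex"
  assumes u: "L1_L2 u" and v: "L1_L2 v"
  shows "(\<integral>w. ft u w * cnj (ft v w) \<partial>lborel) = of_real ((2 * pi) ^ DIM('a)) * (\<integral>x. u x * cnj (v x) \<partial>lborel)"
proof -
  have prod: "integrable lborel (\<lambda>w. ft u w * cnj (ft v w))"
    by (rule integrable_product_sq)
      (use ft_square_integrable u v ft_measurable[OF L1_L2_measurable[OF u]] ft_measurable[OF L1_L2_measurable[OF v]] in auto)
  have "(\<lambda>n. \<integral>w. (ft u w * cnj (ft v w)) * of_real (gauss_dilate n w) \<partial>lborel) \<longlonglongrightarrow>
      (\<integral>w. (ft u w * cnj (ft v w)) * of_real (gauss (0::'a)) \<partial>lborel)"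
  proof (rule integral_dominated_convergence[where w = "\<lambda>w. norm (ft u w * cnj (ft v w)) * gauss (0::'a)"])
    show "AE w in lborel. (\<lambda>n. (ft u w * cnj (ft v w)) * of_real (gauss_dilate n w)) \<longlonglongrightarrow> (ft u w * cnj (ft v w)) * of_real (gauss (0::'a))"
      by (intro AE_I2 tendsto_intros gauss_dilate_tendsto)
    show "AE w in lborel. norm ((ft u w * cnj (ft v w)) * of_real (gauss_dilate n w)) \<le> norm (ft u w * cnj (ft v w)) * gauss (0::'a)" for n
      by (auto simp: norm_mult abs_of_pos[OF gauss_dilate_bounds(1)] intro!: mult_left_mono gauss_dilate_bounds(2))
    show "integrable lborel (\<lambda>w. norm (ft u w * cnj (ft v w)) * gauss (0::'a))"
      using prod by (intro integrable_mult_left integrable_norm)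
  qed (use borel_measurable_integrable[OF prod] in auto)
  from LIMSEQ_unique[OF this correlation_gauss_limit[OF u v]]
  have "(\<integral>w. ft u w * cnj (ft v w) \<partial>lborel) * of_real (gauss (0::'a)) = of_real (sqrt (2 * pi) ^ DIM('a)) * correlation u v 0"
    using prod by simp
  then have "(\<integral>w. ft u w * cnj (ft v w) \<partial>lborel) * of_real (gauss (0::'a)) * of_real (sqrt (2 * pi) ^ DIM('a)) =
     of_real (sqrt (2 * pi) ^ DIM('a) * sqrt (2 * pi) ^ DIM('a)) * correlation u v 0"
    by simp
  \<comment> \<open>Multiplying by one more \<open>sqrt (2 * pi) ^ DIM('a)\<close> thus removes
    \<open>gauss 0\<close> on one side and completes the power of \<open>2 * pi\<close> on the
    other.\<close>
  moreover have "complex_of_real (gauss (0::'a)) * of_real (sqrt (2 * pi) ^ DIM('a)) = 1"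
    unfolding of_real_mult[symmetric] gauss_eq by (simp flip: power_mult_distrib)
  ultimately show "(\<integral>w. ft u w * cnj (ft v w) \<partial>lborel) = of_real ((2 * pi) ^ DIM('a)) * (\<integral>x. u x * cnj (v x) \<partial>lborel)"
    unfolding mult.assoc power_mult_distrib[symmetric] by (simp add: correlation_def)
qed

section \<open>Native spaces of kernels with a decaying spectral density\<close>

text \<open>Riesz-Fischer: a subsequence with geometrically small steps converges almost everywhere,
  and Fatou's lemma identifies its limit as the L^2 limit of the whole sequence.\<close>

lemma L2_complete:
  fixes h :: "nat \<Rightarrow> 'a \<Rightarrow> complex"
  assumes m[measurable]: "\<And>n. h n \<in> borel_measurable M"
    and i: "\<And>n. integrable M (\<lambda>x. (norm (h n x))\<^sup>2)"
    and cauchy: "\<And>e. e > 0 \<Longrightarrow> \<exists>N. \<forall>p\<ge>N. \<forall>q\<ge>N. (\<integral>x. (norm (h p x - h q x))\<^sup>2 \<partial>M) < e"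
  obtains g where "g \<in> borel_measurable M" "integrable M (\<lambda>x. (norm (g x))\<^sup>2)"
    "\<And>n. integrable M (\<lambda>x. (norm (h n x - g x))\<^sup>2)"
    "(\<lambda>n. \<integral>x. (norm (h n x - g x))\<^sup>2 \<partial>M) \<longlonglongrightarrow> 0"
proof -
  have sq: "(norm (x - y))\<^sup>2 \<le> 2 * (norm x)\<^sup>2 + 2 * (norm y)\<^sup>2" for x y :: complex
  proof -
    have "(norm (x - y))\<^sup>2 \<le> (norm x + norm y)\<^sup>2" by (intro power_mono norm_triangle_ineq4) auto
    also have "\<dots> \<le> 2 * (norm x)\<^sup>2 + 2 * (norm y)\<^sup>2"
      using sum_squares_bound[of "norm x" "norm y"] by (simp add: power2_sum)
    finally show ?thesis .
  qed
  have id: "integrable M (\<lambda>x. (norm (h p x - h q x))\<^sup>2)" for p q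
    by (rule Bochner_Integration.integrable_bound[where f = "\<lambda>x. 2 * (norm (h p x))\<^sup>2 + 2 * (norm (h q x))\<^sup>2"])
      (use i sq in auto)
  have "\<exists>N. \<forall>p\<ge>N. \<forall>q\<ge>N. (\<integral>x. (norm (h p x - h q x))\<^sup>2 \<partial>M) < (1/4) ^ k" for k
    by (rule cauchy) simp
  then obtain N where N: "\<And>k p q. p \<ge> N k \<Longrightarrow> q \<ge> N k \<Longrightarrow> (\<integral>x. (norm (h p x - h q x))\<^sup>2 \<partial>M) < (1/4) ^ k"
    by metis
  \<comment> \<open>Adding all thresholds makes \<open>R\<close> nondecreasing; the summand
    \<open>k\<close> makes it unbounded, which the Fatou step needs.\<close>
  define R where "R k = k + (\<Sum>j\<le>k. N j)" for k
  have R: "N k \<le> R k" "R k \<le> R (Suc k)" for k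
    using member_le_sum[of k "{..k}" N] unfolding R_def by auto
  define D where "D k x = (norm (h (R (Suc k)) x - h (R k) x))\<^sup>2" for k x
  have D0: "0 \<le> D k x" for k x by (simp add: D_def)
  have [measurable]: "D k \<in> borel_measurable M" for k unfolding D_def by measurable
  \<comment> \<open>The integrals of \<open>D k\<close> are below \<open>(1/4) ^ k\<close> and stay
    summable after weighting by \<open>2 ^ k\<close>. So almost everywhere \<open>D k x\<close> is
    at most a constant times \<open>(1/2) ^ k\<close>, and the increments are dominated by a
    geometric series.\<close>
  have "(\<integral>\<^sup>+x. (\<Sum>k. ennreal (2 ^ k * D k x)) \<partial>M) = (\<Sum>k. \<integral>\<^sup>+x. ennreal (2 ^ k * D k x) \<partial>M)"
    by (rule nn_integral_suminf) measurable
  also have "\<dots> \<le> (\<Sum>k. ennreal ((1/2) ^ k))"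
  proof (intro suminf_le allI summableI)
    fix k
    have "(\<integral>\<^sup>+x. ennreal (2 ^ k * D k x) \<partial>M) = ennreal (\<integral>x. 2 ^ k * D k x \<partial>M)"
      unfolding D_def using id by (intro nn_integral_eq_integral) auto
    also have "(\<integral>x. 2 ^ k * D k x \<partial>M) \<le> 2 ^ k * (1/4) ^ k"
      using N[of k "R (Suc k)" "R k"] R[of k] by (simp add: D_def)
    also have "2 ^ k * (1/4::real) ^ k = (1/2) ^ k" by (simp flip: power_mult_distrib)
    finally show "(\<integral>\<^sup>+x. ennreal (2 ^ k * D k x) \<partial>M) \<le> ennreal ((1/2) ^ k)" by (simp add: ennreal_leI)
  qed
  also have "\<dots> = ennreal (\<Sum>k. (1/2) ^ k)" by (intro suminf_ennreal2) auto
  also have "\<dots> < \<infinity>" by simp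
  finally have "(\<integral>\<^sup>+x. (\<Sum>k. ennreal (2 ^ k * D k x)) \<partial>M) \<noteq> \<infinity>" by simp
  then have "AE x in M. (\<Sum>k. ennreal (2 ^ k * D k x)) \<noteq> \<infinity>"
    by (intro nn_integral_noteq_infinite) measurable
  then have conv: "AE x in M. (\<lambda>k. h (R k) x) \<longlonglongrightarrow> lim (\<lambda>k. h (R k) x)"
  proof eventually_elim
    case (elim x)
    obtain B where B: "(\<Sum>k. ennreal (2 ^ k * D k x)) = ennreal B" "B \<ge> 0"
      using elim by (cases "\<Sum>k. ennreal (2 ^ k * D k x)") auto
    have "2 ^ k * D k x \<le> B" for k
    proof -
      have "(\<Sum>j\<in>{k}. ennreal (2 ^ j * D j x)) \<le> (\<Sum>j. ennreal (2 ^ j * D j x))"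
        by (intro sum_le_suminf) auto
      then show ?thesis using B by simp
    qed
    then have "D k x \<le> B * (1/2) ^ k" for k
      by (simp add: field_simps)
    then have "sqrt (D k x) \<le> sqrt B * sqrt (1/2) ^ k" for k
      by (metis real_sqrt_le_iff real_sqrt_mult real_sqrt_power)
    then have n: "norm (h (R (Suc k)) x - h (R k) x) \<le> sqrt B * sqrt (1/2) ^ k" for k
      by (simp add: D_def)
    have "summable (\<lambda>k. sqrt B * sqrt (1/2) ^ k)"
      by (intro summable_mult summable_geometric) (simp add: real_sqrt_divide)
    then have "summable (\<lambda>k. h (R (Suc k)) x - h (R k) x)"
      by (rule summable_comparison_test') (use n in simp)
    then have "convergent (\<lambda>k. h (R k) x)"
      unfolding summable_iff_convergent sum_lessThan_telescope[of "\<lambda>k. h (R k) x"]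
      using convergent_add[OF _ convergent_const[of "h (R 0) x"]] by fastforce
    then show ?case by (simp add: convergent_LIMSEQ_iff)
  qed
  define g where "g x = lim (\<lambda>k. h (R k) x)" for x
  have gm[measurable]: "g \<in> borel_measurable M" unfolding g_def by measurable
  have fatou: "(\<integral>\<^sup>+x. ennreal ((norm (h p x - g x))\<^sup>2) \<partial>M) \<le> ennreal e"
    if e: "e > 0" and N: "\<And>p q. p \<ge> N \<Longrightarrow> q \<ge> N \<Longrightarrow> (\<integral>x. (norm (h p x - h q x))\<^sup>2 \<partial>M) < e" and p: "p \<ge> N" for e N p
  proof -
    have "(\<integral>\<^sup>+x. ennreal ((norm (h p x - g x))\<^sup>2) \<partial>M) = (\<integral>\<^sup>+x. liminf (\<lambda>k. ennreal ((norm (h p x - h (R k) x))\<^sup>2)) \<partial>M)"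
    proof (rule nn_integral_cong_AE)
      show "AE x in M. ennreal ((norm (h p x - g x))\<^sup>2) = liminf (\<lambda>k. ennreal ((norm (h p x - h (R k) x))\<^sup>2))"
        using conv
      proof eventually_elim
        case (elim x)
        then have "(\<lambda>k. ennreal ((norm (h p x - h (R k) x))\<^sup>2)) \<longlonglongrightarrow> ennreal ((norm (h p x - g x))\<^sup>2)"
          unfolding g_def[symmetric] by (intro tendsto_intros tendsto_ennrealI)
        from lim_imp_Liminf[OF _ this] show ?case by simp
      qed
    qed
    also have "\<dots> \<le> liminf (\<lambda>k. \<integral>\<^sup>+x. ennreal ((norm (h p x - h (R k) x))\<^sup>2) \<partial>M)"
      by (rule nn_integral_liminf) measurable
    also have "\<dots> \<le> ennreal e"
    proof -
      have "(\<integral>\<^sup>+x. ennreal ((norm (h p x - h (R k) x))\<^sup>2) \<partial>M) \<le> ennreal e" if "k \<ge> N" for k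
      proof -
        have "(\<integral>x. (norm (h p x - h (R k) x))\<^sup>2 \<partial>M) \<le> e"
          using N[OF p, of "R k"] that by (simp add: R_def less_imp_le)
        then show ?thesis using id by (subst nn_integral_eq_integral) (auto intro!: ennreal_leI)
      qed
      then have "liminf (\<lambda>k. \<integral>\<^sup>+x. ennreal ((norm (h p x - h (R k) x))\<^sup>2) \<partial>M) \<le> liminf (\<lambda>k::nat. ennreal e)"
        by (intro Liminf_mono eventually_sequentiallyI[of N])
      then show ?thesis by (simp add: Liminf_const)
    qed
    finally show ?thesis .
  qed
  obtain N1 where "\<forall>p\<ge>N1. \<forall>q\<ge>N1. (\<integral>x. (norm (h p x - h q x))\<^sup>2 \<partial>M) < 1" using cauchy[of 1] by auto
  then have "(\<integral>\<^sup>+x. ennreal ((norm (h N1 x - g x))\<^sup>2) \<partial>M) \<le> ennreal 1" by (intro fatou[of 1 N1]) auto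
  then have i1: "integrable M (\<lambda>x. (norm (h N1 x - g x))\<^sup>2)"
    by (intro integrableI_bounded) (auto intro: le_less_trans)
  have ig: "integrable M (\<lambda>x. (norm (g x))\<^sup>2)"
  proof (rule Bochner_Integration.integrable_bound[where f = "\<lambda>x. 2 * (norm (h N1 x))\<^sup>2 + 2 * (norm (h N1 x - g x))\<^sup>2"])
    show "AE x in M. norm ((norm (g x))\<^sup>2) \<le> norm (2 * (norm (h N1 x))\<^sup>2 + 2 * (norm (h N1 x - g x))\<^sup>2)"
      proof (rule AE_I2)
      fix x show "norm ((norm (g x))\<^sup>2) \<le> norm (2 * (norm (h N1 x))\<^sup>2 + 2 * (norm (h N1 x - g x))\<^sup>2)"
        using sq[of "h N1 x" "h N1 x - g x"] by simp
    qed
  qed (use i i1 in auto)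
  have ih: "integrable M (\<lambda>x. (norm (h n x - g x))\<^sup>2)" for n
    by (rule Bochner_Integration.integrable_bound[where f = "\<lambda>x. 2 * (norm (h n x))\<^sup>2 + 2 * (norm (g x))\<^sup>2"])
      (use i ig sq in auto)
  have "(\<lambda>n. \<integral>x. (norm (h n x - g x))\<^sup>2 \<partial>M) \<longlonglongrightarrow> 0"
  proof (rule LIMSEQ_I)
    fix e :: real assume e: "0 < e"
    obtain N where N: "\<forall>p\<ge>N. \<forall>q\<ge>N. (\<integral>x. (norm (h p x - h q x))\<^sup>2 \<partial>M) < e / 2" using cauchy[of "e / 2"] e by auto
    show "\<exists>no. \<forall>n\<ge>no. norm ((\<integral>x. (norm (h n x - g x))\<^sup>2 \<partial>M) - 0) < e"
    proof (intro exI allI impI)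
      fix n assume "n \<ge> N"
      then have "(\<integral>\<^sup>+x. ennreal ((norm (h n x - g x))\<^sup>2) \<partial>M) \<le> ennreal (e / 2)"
        using e N by (intro fatou[of "e / 2" N]) auto
      then have "(\<integral>x. (norm (h n x - g x))\<^sup>2 \<partial>M) \<le> e / 2"
        using ih[of n] e by (subst (asm) nn_integral_eq_integral) auto
      then show "norm ((\<integral>x. (norm (h n x - g x))\<^sup>2 \<partial>M) - 0) < e" using e by simp
    qed
  qed
  with gm ig ih show ?thesis by (rule that)
qed

text \<open>The factor \<open>sqrt L\<close> is put into the functions: \<open>h n\<close> is
  \<open>sqrt L\<close> times \<open>P n\<close> and lies in L^2 of Lebesgue measure, so no weighted
  space and no division by \<open>L\<close> occur. With \<open>g\<close> the limit of
  \<open>h n\<close>, the product \<open>G\<close> of \<open>sqrt L\<close> and \<open>g\<close> is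
  integrable, and \<open>f\<close> is its inverse Fourier integral at every point.\<close>

lemma native_space_subset_sobolev_space:
  fixes L :: "real^'n \<Rightarrow> real"
  assumes Lm[measurable]: "L \<in> borel_measurable borel" and L0: "\<And>w. 0 \<le> L w" and Li: "integrable lborel L"
    and even: "\<And>w. L (- w) = L w" and s: "0 \<le> s"
    and LC: "\<And>w. L w * (1 + (norm w)\<^sup>2) powr s \<le> C"
    and Phi: "\<And>x. \<Phi> x = (\<integral>w. L w * cos (w \<bullet> x) \<partial>lborel)"
  shows "native_space \<Phi> \<subseteq> sobolev_space s"
proof
  fix f assume "f \<in> native_space \<Phi>"
  then obtain m :: "nat \<Rightarrow> nat" and a :: "nat \<Rightarrow> nat \<Rightarrow> real" and c :: "nat \<Rightarrow> nat \<Rightarrow> real^'n"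
    where cauchy: "\<And>e. e > 0 \<Longrightarrow> \<exists>N. \<forall>p\<ge>N. \<forall>q\<ge>N. knorm2_diff \<Phi> (m p) (a p) (c p) (m q) (a q) (c q) < e"
      and flim: "\<And>x. (\<lambda>n. \<Sum>i<m n. a n i * \<Phi> (x - c n i)) \<longlonglongrightarrow> f x"
    unfolding native_space_def by blast
  have Lci: "integrable lborel (\<lambda>w. complex_of_real (L w))" by (rule integrable_of_real[OF Li])
  have Lint: "integrable lborel (\<lambda>w. of_real (L w) * cis (w \<bullet> y))" for y
    by (rule integrable_mult_cis[OF Lci]) simp
  have Leq: "(\<integral>w. of_real (L w) * cis (w \<bullet> y) \<partial>lborel) = of_real (\<Phi> y)" for y
  proof (rule complex_eqI)
    show "Re (\<integral>w. of_real (L w) * cis (w \<bullet> y) \<partial>lborel) = Re (of_real (\<Phi> y))"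
      using integral_Re[OF Lint[of y]] by (simp add: Phi)
    \<comment> \<open>The sine part is odd in \<open>w\<close>, so reflection shows that it
      vanishes.\<close>
    define J where "J = (\<integral>w. L w * sin (w \<bullet> y) \<partial>lborel)"
    have "integrable lborel (\<lambda>w. L w * sin (w \<bullet> y))" using integrable_Im[OF Lint[of y]] by simp
    from lborel_shift_integrable(4)[OF this, of 0] have "- J = J" unfolding J_def by (simp add: even)
    then have "J = 0" by simp
    then show "Im (\<integral>w. of_real (L w) * cis (w \<bullet> y) \<partial>lborel) = Im (of_real (\<Phi> y))"
      using integral_Im[OF Lint[of y]] by (simp add: J_def)
  qed
  define P where "P n w = (\<Sum>i<m n. of_real (a n i) * cis (- (w \<bullet> c n i)))" for n w
  have [measurable]: "P n \<in> borel_measurable borel" for n unfolding P_def by measurable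
  define A where "A n = (\<Sum>i<m n. \<bar>a n i\<bar>)" for n
  have PA: "norm (P n w) \<le> A n" for n w
    unfolding P_def A_def by (rule order_trans[OF norm_sum]) (simp add: norm_mult)
  define Q where "Q p q = (\<Sum>i<m p. \<Sum>j<m q. a p i * a q j * \<Phi> (c p i - c q j))" for p q
  have PP: "has_bochner_integral lborel (\<lambda>w. of_real (L w) * (P p w * cnj (P q w))) (of_real (Q p q))" for p q
  proof -
    have Phi_even: "\<Phi> (- y) = \<Phi> y" for y by (simp add: Phi)
    have e: "of_real (L w) * (P p w * cnj (P q w)) =
        (\<Sum>i<m p. \<Sum>j<m q. of_real (a p i * a q j) * (of_real (L w) * cis (w \<bullet> (c q j - c p i))))" for w
      unfolding P_def cnj_sum sum_product unfolding sum_distrib_left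
      by (intro sum.cong refl) (simp add: cis_cnj inner_diff_right mult_ac, simp add: cis_mult)
    have "of_real (Q p q) = (\<Sum>i<m p. \<Sum>j<m q. of_real (a p i * a q j) * complex_of_real (\<Phi> (c q j - c p i)))"
      unfolding Q_def using Phi_even[of "c q _ - c p _"] by simp
    then show ?thesis unfolding e
      by (auto intro!: has_bochner_integral_sum has_bochner_integral_mult_right simp: has_bochner_integral_iff Lint Leq)
  qed
  define h where "h n w = of_real (sqrt (L w)) * P n w" for n w
  have [measurable]: "h n \<in> borel_measurable borel" for n unfolding h_def by measurable
  have hh: "h p w * cnj (h q w) = of_real (L w) * (P p w * cnj (P q w))" for p q w
    using L0[of w] by (simp add: h_def mult_ac flip: of_real_mult)
  have hint: "has_bochner_integral lborel (\<lambda>w. h p w * cnj (h q w)) (of_real (Q p q))" for p q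
    unfolding hh by (rule PP)
  have h2: "integrable lborel (\<lambda>w. (norm (h n w))\<^sup>2)" for n
  proof -
    have "(norm (h n w))\<^sup>2 = Re (h n w * cnj (h n w))" for w
      unfolding cmod_power2 by (simp add: power2_eq_square)
    then show ?thesis using has_bochner_integral_Re[OF hint[of n n]] by (simp add: has_bochner_integral_iff)
  qed
  have kn: "(\<integral>w. (norm (h p w - h q w))\<^sup>2 \<partial>lborel) = knorm2_diff \<Phi> (m p) (a p) (c p) (m q) (a q) (c q)" for p q
  proof -
    have "(norm (h p w - h q w))\<^sup>2 = Re (h p w * cnj (h p w)) - 2 * Re (h p w * cnj (h q w)) + Re (h q w * cnj (h q w))" for w
      unfolding cmod_power2 by (simp add: power2_eq_square algebra_simps)
    then have "(\<integral>w. (norm (h p w - h q w))\<^sup>2 \<partial>lborel) = Q p p - 2 * Q p q + Q q q"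
      using has_bochner_integral_Re[OF hint[of p p], unfolded has_bochner_integral_iff]
        has_bochner_integral_Re[OF hint[of p q], unfolded has_bochner_integral_iff]
        has_bochner_integral_Re[OF hint[of q q], unfolded has_bochner_integral_iff]
      by (simp only: Bochner_Integration.integral_add Bochner_Integration.integral_diff integrable_mult_right
          Bochner_Integration.integrable_diff integral_mult_right_zero Re_complex_of_real)
    then show ?thesis by (simp add: knorm2_diff_def Q_def)
  qed
  obtain g where g: "g \<in> borel_measurable lborel" "integrable lborel (\<lambda>w. (norm (g w))\<^sup>2)"
    "\<And>n. integrable lborel (\<lambda>w. (norm (h n w - g w))\<^sup>2)"
    "(\<lambda>n. \<integral>w. (norm (h n w - g w))\<^sup>2 \<partial>lborel) \<longlonglongrightarrow> 0"
    by (rule L2_complete[of h lborel]) (use h2 cauchy in \<open>auto simp: kn\<close>)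
  have [measurable]: "g \<in> borel_measurable borel" using g(1) by simp
  have s2: "(norm (complex_of_real (sqrt (L w))))\<^sup>2 = L w" for w using L0 by simp
  define G where "G w = of_real (sqrt (L w)) * g w" for w
  have [measurable]: "G \<in> borel_measurable borel" unfolding G_def by measurable
  have iG: "integrable lborel G" unfolding G_def
    by (rule integrable_product_sq) (use g Li s2 in auto)
  have G2: "(norm (G w))\<^sup>2 = L w * (norm (g w))\<^sup>2" for w
    using L0[of w] by (simp add: G_def norm_mult power_mult_distrib)
  have GC: "integrable lborel (\<lambda>w. (norm (G w))\<^sup>2 * (1 + (norm w)\<^sup>2) powr s)"
  proof (rule Bochner_Integration.integrable_bound[where f = "\<lambda>w. C * (norm (g w))\<^sup>2"])
    have "\<bar>(norm (G w))\<^sup>2 * (1 + (norm w)\<^sup>2) powr s\<bar> \<le> \<bar>C * (norm (g w))\<^sup>2\<bar>" for w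
    proof -
      have "(norm (G w))\<^sup>2 * (1 + (norm w)\<^sup>2) powr s = (L w * (1 + (norm w)\<^sup>2) powr s) * (norm (g w))\<^sup>2"
        by (simp add: G2)
      also have "\<bar>\<dots>\<bar> \<le> \<bar>C * (norm (g w))\<^sup>2\<bar>"
        using LC[of w] L0[of w] by (auto simp: abs_mult intro!: mult_right_mono)
      finally show ?thesis .
    qed
    then show "AE w in lborel. norm ((norm (G w))\<^sup>2 * (1 + (norm w)\<^sup>2) powr s) \<le> norm (C * (norm (g w))\<^sup>2)" by simp
  qed (use g in auto)
  \<comment> \<open>The weight is at least 1 for \<open>s \<ge> 0\<close>, so the weighted bound
    contains square integrability.\<close>
  have GI: "integrable lborel (\<lambda>w. (norm (G w))\<^sup>2)"
  proof (rule Bochner_Integration.integrable_bound[OF GC])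
    have "1 \<le> (1 + (norm w)\<^sup>2) powr s" for w :: "real^'n" using s by (intro ge_one_powr_ge_zero) auto
    then show "AE w in lborel. norm ((norm (G w))\<^sup>2) \<le> norm ((norm (G w))\<^sup>2 * (1 + (norm w)\<^sup>2) powr s)"
      by (auto simp: abs_mult mult_le_cancel_left1)
  qed measurable
  have f_eq: "of_real (f x) = (\<integral>w. G w * cis (w \<bullet> x) \<partial>lborel)" for x
  proof -
    define T where "T n = (\<integral>w. of_real (sqrt (L w)) * h n w * cis (w \<bullet> x) \<partial>lborel)" for n
    have T: "T n = of_real (\<Sum>i<m n. a n i * \<Phi> (x - c n i))" for n
    proof -
      have "of_real (sqrt (L w)) * h n w * cis (w \<bullet> x) = of_real (sqrt (L w) * sqrt (L w)) * P n w * cis (w \<bullet> x)" for w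
        unfolding h_def of_real_mult by (simp only: mult.assoc)
      also have "\<dots> w = (\<Sum>i<m n. of_real (a n i) * (of_real (L w) * cis (w \<bullet> (x - c n i))))" for w
        using L0[of w] unfolding P_def sum_distrib_left sum_distrib_right
        by (intro sum.cong refl) (simp add: inner_diff_right mult_ac, simp add: cis_mult)
      finally have "T n = (\<Sum>i<m n. \<integral>w. of_real (a n i) * (of_real (L w) * cis (w \<bullet> (x - c n i))) \<partial>lborel)"
        unfolding T_def using Lint by (subst Bochner_Integration.integral_sum[symmetric]) auto
      then show ?thesis by (simp add: Leq)
    qed
    have ih: "integrable lborel (\<lambda>w. of_real (sqrt (L w)) * h n w)" for n
      by (rule integrable_product_sq) (use h2 Li s2 in auto)
    have "(\<lambda>n. T n) \<longlonglongrightarrow> (\<integral>w. G w * cis (w \<bullet> x) \<partial>lborel)"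
    proof (rule LIMSEQ_I)
      fix e :: real assume e: "0 < e"
      define LL where "LL = (\<integral>w. L w \<partial>lborel)"
      have LL: "LL \<ge> 0" unfolding LL_def using L0 by simp
      \<comment> \<open>The error is split by a weighted arithmetic-geometric mean inequality into
        \<open>d * L w\<close>, with integral below \<open>e / 2\<close>, and the squared L^2
        distance over \<open>d\<close>, which \<open>N\<close> makes small.\<close>
      define d where "d = e / (2 * (LL + 1))"
      have d: "d > 0" "d * LL < e / 2 + 0" using e LL unfolding d_def by (auto simp: field_simps)
      from LIMSEQ_D[OF g(4), of "e * d / 2"] e d obtain N where
        N: "\<And>n. n \<ge> N \<Longrightarrow> norm (\<integral>w. (norm (h n w - g w))\<^sup>2 \<partial>lborel) < e * d / 2" by auto
      show "\<exists>no. \<forall>n\<ge>no. norm (T n - (\<integral>w. G w * cis (w \<bullet> x) \<partial>lborel)) < e"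
      proof (intro exI allI impI)
        fix n assume n: "N \<le> n"
        have "T n - (\<integral>w. G w * cis (w \<bullet> x) \<partial>lborel) = (\<integral>w. of_real (sqrt (L w)) * h n w * cis (w \<bullet> x) - G w * cis (w \<bullet> x) \<partial>lborel)"
          unfolding T_def using ih iG by (subst Bochner_Integration.integral_diff) (auto intro!: integrable_mult_cis)
        also have "norm \<dots> \<le> (\<integral>w. norm (of_real (sqrt (L w)) * h n w * cis (w \<bullet> x) - G w * cis (w \<bullet> x)) \<partial>lborel)"
          by (rule integral_norm_bound)
        also have "\<dots> \<le> (\<integral>w. d * L w + (norm (h n w - g w))\<^sup>2 / d \<partial>lborel)"
        proof (intro integral_mono)
          fix w
          have "of_real (sqrt (L w)) * h n w * cis (w \<bullet> x) - G w * cis (w \<bullet> x) = of_real (sqrt (L w)) * (h n w - g w) * cis (w \<bullet> x)"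
            by (simp add: G_def algebra_simps)
          then have "norm (of_real (sqrt (L w)) * h n w * cis (w \<bullet> x) - G w * cis (w \<bullet> x)) = (sqrt d * sqrt (L w)) * (norm (h n w - g w) / sqrt d)"
            using L0[of w] d(1) by (simp add: norm_mult)
          also have "\<dots> \<le> (sqrt d * sqrt (L w))\<^sup>2 + (norm (h n w - g w) / sqrt d)\<^sup>2" by (rule mult_le_sum_squares)
          also have "\<dots> = d * L w + (norm (h n w - g w))\<^sup>2 / d"
            using d(1) L0[of w] by (simp add: power_mult_distrib power_divide)
          finally show "norm (of_real (sqrt (L w)) * h n w * cis (w \<bullet> x) - G w * cis (w \<bullet> x)) \<le> d * L w + (norm (h n w - g w))\<^sup>2 / d" .
        qed (use ih iG Li g in \<open>auto intro!: integrable_mult_cis integrable_norm Bochner_Integration.integrable_diff\<close>)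
        also have "\<dots> = d * LL + (\<integral>w. (norm (h n w - g w))\<^sup>2 \<partial>lborel) / d"
          using Li g by (simp add: LL_def)
        also have "\<dots> < e"
        proof -
          have "(\<integral>w. (norm (h n w - g w))\<^sup>2 \<partial>lborel) / d < e / 2" using N[OF n] d(1) by (simp add: field_simps)
          then show ?thesis using d(2) by linarith
        qed
        finally show "norm (T n - (\<integral>w. G w * cis (w \<bullet> x) \<partial>lborel)) < e" .
      qed
    qed
    moreover have "(\<lambda>n. T n) \<longlonglongrightarrow> of_real (f x)" unfolding T by (intro tendsto_of_real flim)
    ultimately show ?thesis using LIMSEQ_unique by blast
  qed
  \<comment> \<open>Conjugation turns the inverse integral into a forward one: \<open>f\<close> is
    the conjugate of \<open>ft G'\<close>. Plancherel then puts \<open>f\<close> into L^2, and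
    Parseval against a test function gives the duality relation.\<close>
  define G' where "G' w = cnj (G w)" for w
  have L1_L2: "L1_L2 G'" using iG GI by (simp add: L1_L2_def G'_def[abs_def])
  have fG: "of_real (f x) = cnj (ft G' x)" for x
  proof -
    have "cnj (ft G' x) = (\<integral>w. cnj (G' w * cis (- (x \<bullet> w))) \<partial>lborel)" unfolding ft_def
      by (rule integral_bounded_linear'[OF bounded_linear_cnj bounded_linear_cnj, symmetric]) auto
    then show ?thesis unfolding f_eq by (simp add: G'_def cis_cnj inner_commute)
  qed
  have nf: "norm (complex_of_real (f x)) = norm (ft G' x)" for x unfolding fG by simp
  have [measurable]: "ft G' \<in> borel_measurable borel" by (rule ft_measurable[OF L1_L2_measurable[OF L1_L2]])
  \<comment> \<open>The unitary normalisation: Parseval contributes \<open>k * k\<close> and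
    \<open>fourier_L1\<close> contributes \<open>1 / k\<close>, so the transform of \<open>f\<close>
    is \<open>k\<close> times \<open>G\<close>.\<close>
  define k where "k = (2 * pi) powr (real CARD('n) / 2)"
  have k: "k > 0" by (simp add: k_def)
  have "is_fourier_L2 (\<lambda>x. complex_of_real (f x)) (\<lambda>w. of_real k * G w)"
    unfolding is_fourier_L2_def
  proof (intro conjI allI impI)
    show "square_integrable (\<lambda>x. complex_of_real (f x))"
      unfolding square_integrable_def nf using ft_square_integrable[OF L1_L2] by (simp add: fG)
    show "square_integrable (\<lambda>w. of_real k * G w)"
      unfolding square_integrable_def using GI by (simp add: norm_mult power_mult_distrib)
    fix \<phi> :: "real^'n \<Rightarrow> complex" assume phi: "integrable lborel \<phi> \<and> square_integrable \<phi>"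
    then have "L1_L2 \<phi>" by (simp add: L1_L2_def square_integrable_def)
    from parseval[OF this L1_L2]
    have p: "(\<integral>x. ft \<phi> x * cnj (ft G' x) \<partial>lborel) = of_real ((2 * pi) ^ CARD('n)) * (\<integral>x. \<phi> x * G x \<partial>lborel)"
      by (simp add: G'_def)
    have F: "fourier_L1 \<phi> x = of_real (1 / k) * ft \<phi> x" for x
      by (simp add: fourier_L1_def ft_def k_def powr_minus inverse_eq_divide)
    have kk: "(2 * pi) ^ CARD('n) = k * k"
      by (simp add: k_def powr_realpow flip: powr_add)
    have "(\<integral>x. of_real (f x) * fourier_L1 \<phi> x \<partial>lborel) = (\<integral>x. of_real (1 / k) * (ft \<phi> x * cnj (ft G' x)) \<partial>lborel)"
      unfolding F fG by (simp only: mult_ac)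
    also have "\<dots> = of_real (1 / k) * (of_real (k * k) * (\<integral>x. \<phi> x * G x \<partial>lborel))"
      unfolding integral_mult_right_zero p kk ..
    also have "\<dots> = of_real k * (\<integral>x. \<phi> x * G x \<partial>lborel)" using k by simp
    also have "\<dots> = (\<integral>x. of_real k * (\<phi> x * G x) \<partial>lborel)" by simp
    finally show "(\<integral>w. of_real k * G w * \<phi> w \<partial>lborel) = (\<integral>x. of_real (f x) * fourier_L1 \<phi> x \<partial>lborel)"
      by (simp only: mult_ac)
  qed
  moreover have "integrable lborel (\<lambda>w. (norm (of_real k * G w))\<^sup>2 * (1 + (norm w)\<^sup>2) powr s)"
    using integrable_mult_right[OF GC, of "k\<^sup>2"] by (simp add: norm_mult power_mult_distrib mult.assoc)
  ultimately show "f \<in> sobolev_space s" unfolding sobolev_space_def by blast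
qed

section \<open>Decay of the Fourier transform of a truncated power\<close>

text \<open>Up to powers of \<open>t\<close> and constants these are Bessel functions of the first kind of
  orders \<open>l + 1/2\<close> and \<open>l + 3/2\<close>. The range \<open>-1 < l \<le> 0\<close> starts the induction on \<open>l\<close>.\<close>

definition Icos :: "real \<Rightarrow> real \<Rightarrow> real" where
  "Icos l t = integral {0..1} (\<lambda>y. (1 - y\<^sup>2) powr l * cos (t * y))"

definition Isin :: "real \<Rightarrow> real \<Rightarrow> real" where
  "Isin l t = integral {0..1} (\<lambda>y. y * (1 - y\<^sup>2) powr l * sin (t * y))"

text \<open>In \<open>1 - y^2 = (1 + y) * (1 - y)\<close> the first factor lies between 1 and 2, so
  its power is at most \<open>max 1 (2 powr l)\<close> for either sign of \<open>l\<close>; the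
  power of the second is integrable for \<open>l > -1\<close>.\<close>

lemma absolutely_integrable_one_minus_sq_powr:
  assumes l: "-1 < l"
  shows "(\<lambda>y::real. (1 - y\<^sup>2) powr l) absolutely_integrable_on {0..1}"
proof (rule measurable_bounded_by_integrable_imp_absolutely_integrable)
  define c where "c = max 1 (2 powr l)"
  have "(\<lambda>x::real. x powr l) integrable_on {0..1}"
    using integrable_on_powr_from_0[OF l, of 1] by simp
  then have "(\<lambda>x::real. (1 - x) powr l) integrable_on {0..1}"
    using integrable_affinity[of "\<lambda>x. x powr l" 0 1 "-1" 1] by simp
  then show "(\<lambda>x. c * (1 - x) powr l) integrable_on {0..1}" by (rule integrable_on_mult_right)
  show "norm ((1 - y\<^sup>2) powr l) \<le> c * (1 - y) powr l" if "y \<in> {0..1}" for y :: real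
  proof -
    have "1 - y\<^sup>2 = (1 + y) * (1 - y)" by (simp add: algebra_simps power2_eq_square)
    then have "(1 - y\<^sup>2) powr l = (1 + y) powr l * (1 - y) powr l"
      using that by (simp add: powr_mult)
    moreover have "(1 + y) powr l \<le> c"
    proof (cases "l \<ge> 0")
      case True
      then have "(1 + y) powr l \<le> 2 powr l" using that by (intro powr_mono2) auto
      then show ?thesis by (simp add: c_def)
    next
      case False
      then have "(1 + y) powr l \<le> (1 + y) powr 0" using that by (intro powr_mono) auto
      then show ?thesis using that by (simp add: c_def split: if_splits)
    qed
    ultimately show ?thesis by (simp add: mult_right_mono)
  qed
  show "(\<lambda>y::real. (1 - y\<^sup>2) powr l) \<in> borel_measurable (lebesgue_on {0..1})"
    by (intro measurable_restrict_space1 measurable_completion) simp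
qed simp

lemma one_minus_sq_powr_times_integrable:
  assumes l: "-1 < l" and g: "continuous_on {0..1} g"
  shows "(\<lambda>y::real. (1 - y\<^sup>2) powr l * g y) integrable_on {0..1}"
proof -
  have "(\<lambda>y::real. g y * (1 - y\<^sup>2) powr l) absolutely_integrable_on {0..1}"
  proof (rule absolutely_integrable_bounded_measurable_product_real[OF _ _ _ absolutely_integrable_one_minus_sq_powr[OF l]])
    show "bounded (g ` {0..1})" using g by (intro compact_imp_bounded compact_continuous_image) auto
    show "g \<in> borel_measurable (lebesgue_on {0..1})"
      using g by (intro continuous_imp_measurable_on_sets_lebesgue) auto
  qed auto
  then show ?thesis
    by (simp add: mult.commute set_lebesgue_integral_eq_integral(1))
qed

lemma has_integral_Icos_Isin:
  assumes "-1 < l"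
  shows "((\<lambda>y. (1 - y\<^sup>2) powr l * cos (t * y)) has_integral Icos l t) {0..1}"
    and "((\<lambda>y. y * (1 - y\<^sup>2) powr l * sin (t * y)) has_integral Isin l t) {0..1}"
proof -
  show "((\<lambda>y. (1 - y\<^sup>2) powr l * cos (t * y)) has_integral Icos l t) {0..1}"
    unfolding Icos_def by (intro integrable_integral one_minus_sq_powr_times_integrable[OF assms] continuous_intros)
  have "(\<lambda>y. (1 - y\<^sup>2) powr l * (y * sin (t * y))) integrable_on {0..1}"
    by (intro one_minus_sq_powr_times_integrable[OF assms] continuous_intros)
  then show "((\<lambda>y. y * (1 - y\<^sup>2) powr l * sin (t * y)) has_integral Isin l t) {0..1}"
    unfolding Isin_def by (intro integrable_integral) (simp add: mult_ac)
qed

text \<open>Integrate over \<open>{0..1}\<close> the derivatives of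
  \<open>(1 - y^2) powr (l + 1) * sin (t * y)\<close> and
  \<open>y * (1 - y^2) powr (l + 1) * cos (t * y)\<close>; the boundary terms vanish. In the second,
  \<open>y^2 = 1 - (1 - y^2)\<close> produces \<open>Icos l\<close> and
  \<open>Icos (l + 1)\<close>.\<close>

lemma Icos_Isin_rec:
  assumes l: "-1 < l"
  shows "t * Icos (l + 1) t = 2 * (l + 1) * Isin l t"
    and "t * Isin (l + 1) t = (2 * l + 3) * Icos (l + 1) t - 2 * (l + 1) * Icos l t"
proof -
  have l1: "-1 < l + 1" using l by simp
  \<comment> \<open>At \<open>y = 1\<close> both sides are 0, since \<open>0 powr x = 0\<close> for
    every \<open>x\<close>.\<close>
  have pw: "(1 - y\<^sup>2) powr (l + 1) = (1 - y\<^sup>2) * (1 - y\<^sup>2) powr l" if "y \<in> {0..1}" for y :: real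
    using that by (cases "y = 1") (auto simp: powr_add mult.commute power2_eq_square mult_le_one)
  have cont: "continuous_on {0..1} (\<lambda>y::real. (1 - y\<^sup>2) powr (l + 1))"
    using l by (intro continuous_on_powr' continuous_intros) (auto simp: power_le_one)
  have der: "((\<lambda>y::real. (1 - y\<^sup>2) powr (l + 1)) has_real_derivative (- 2 * (l + 1) * y * (1 - y\<^sup>2) powr l)) (at y)"
    if "y \<in> {0<..<1}" for y
  proof -
    have "y\<^sup>2 < 1" using that by (simp add: power_less_one_iff abs_square_less_1)
    then show ?thesis by (auto intro!: derivative_eq_intros simp: algebra_simps)
  qed
  have cA: "continuous_on {0..1} (\<lambda>y. (1 - y\<^sup>2) powr (l + 1) * sin (t * y))"
    by (intro continuous_on_mult cont continuous_on_sin continuous_on_id continuous_on_const)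
  have cA2: "continuous_on {0..1} (\<lambda>y. y * (1 - y\<^sup>2) powr (l + 1) * cos (t * y))"
    by (intro continuous_on_mult cont continuous_on_cos continuous_on_id continuous_on_const)
  \<comment> \<open>For \<open>l < 0\<close> the derivative is unbounded near 1; this version of the
    fundamental theorem asks for derivatives only in the open interval and for continuity on the
    closed one.\<close>
  have A: "((\<lambda>y. -2 * (l + 1) * y * (1 - y\<^sup>2) powr l * sin (t * y) + t * ((1 - y\<^sup>2) powr (l + 1) * cos (t * y))) has_integral
      ((1 - 1\<^sup>2) powr (l + 1) * sin (t * 1) - (1 - 0\<^sup>2) powr (l + 1) * sin (t * 0))) {0..1::real}"
    by (rule fundamental_theorem_of_calculus_interior[OF zero_le_one cA])
      (auto intro!: derivative_eq_intros
        simp: algebra_simps abs_square_less_1 simp flip: has_real_derivative_iff_has_vector_derivative)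
  have B: "((\<lambda>y. -2 * (l + 1) * (y * (1 - y\<^sup>2) powr l * sin (t * y)) + t * ((1 - y\<^sup>2) powr (l + 1) * cos (t * y))) has_integral
      (-2 * (l + 1) * Isin l t + t * Icos (l + 1) t)) {0..1::real}"
    by (intro has_integral_add has_integral_mult_right has_integral_Icos_Isin l l1)
  show "t * Icos (l + 1) t = 2 * (l + 1) * Isin l t"
    using has_integral_unique[OF A[unfolded mult.assoc] B[unfolded mult.assoc]] by (simp add: algebra_simps)
  have A2: "((\<lambda>y. (1 - y\<^sup>2) powr (l + 1) * cos (t * y) + (- 2 * (l + 1) * (y * (y * ((1 - y\<^sup>2) powr l * cos (t * y)))) - t * (y * (1 - y\<^sup>2) powr (l + 1) * sin (t * y)))) has_integral
      (1 * (1 - 1\<^sup>2) powr (l + 1) * cos (t * 1) - 0 * (1 - 0\<^sup>2) powr (l + 1) * cos (t * 0))) {0..1::real}"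
    by (rule fundamental_theorem_of_calculus_interior[OF zero_le_one cA2])
      (auto intro!: derivative_eq_intros
        simp: algebra_simps abs_square_less_1 simp flip: has_real_derivative_iff_has_vector_derivative)
  have B2: "((\<lambda>y. (1 - y\<^sup>2) powr (l + 1) * cos (t * y) +
      (- 2 * (l + 1) * ((1 - y\<^sup>2) powr l * cos (t * y) - (1 - y\<^sup>2) powr (l + 1) * cos (t * y)) - t * (y * (1 - y\<^sup>2) powr (l + 1) * sin (t * y)))) has_integral
      (Icos (l + 1) t + (- 2 * (l + 1) * (Icos l t - Icos (l + 1) t) - t * Isin (l + 1) t))) {0..1::real}"
    by (intro has_integral_add has_integral_diff has_integral_mult_right has_integral_Icos_Isin l l1)
  have "((\<lambda>y. (1 - y\<^sup>2) powr (l + 1) * cos (t * y) + (- 2 * (l + 1) * (y * (y * ((1 - y\<^sup>2) powr l * cos (t * y)))) - t * (y * (1 - y\<^sup>2) powr (l + 1) * sin (t * y)))) has_integral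
      (Icos (l + 1) t + (- 2 * (l + 1) * (Icos l t - Icos (l + 1) t) - t * Isin (l + 1) t))) {0..1::real}"
    by (rule has_integral_eq[OF _ B2]) (simp add: pw, simp add: algebra_simps power2_eq_square)
  from has_integral_unique[OF A2 this]
  show "t * Isin (l + 1) t = (2 * l + 3) * Icos (l + 1) t - 2 * (l + 1) * Icos l t"
    by (simp add: algebra_simps)
qed

text \<open>Split at \<open>1 - 1/t\<close>: the second mean value theorem on the left, the size of \<open>g\<close> on the right.\<close>

lemma monotone_oscillatory_bound:
  fixes g h :: "real \<Rightarrow> real"
  assumes t: "t \<ge> 1" and l: "-1 < l" "l \<le> 0" and C: "C > 0"
    and mono: "\<And>x y. 0 \<le> x \<Longrightarrow> x \<le> y \<Longrightarrow> y < 1 \<Longrightarrow> g x \<le> g y"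
    and pos: "\<And>x. 0 \<le> x \<Longrightarrow> x \<le> 1 \<Longrightarrow> 0 \<le> g x"
    and up: "\<And>x. 0 \<le> x \<Longrightarrow> x \<le> 1 \<Longrightarrow> g x \<le> C * (1 - x) powr l"
    and h: "continuous_on UNIV h" "\<And>x. \<bar>h x\<bar> \<le> 1" "\<And>a b. a \<le> b \<Longrightarrow> \<bar>integral {a..b} h\<bar> \<le> 2 / t"
    and int: "(\<lambda>y. g y * h y) integrable_on {0..1}"
  shows "\<bar>integral {0..1} (\<lambda>y. g y * h y)\<bar> \<le> C * (4 + 1 / (l + 1)) * t powr (- l - 1)"
proof -
  \<comment> \<open>This cut balances the two parts: on the left \<open>g\<close> is at most
    \<open>C * t powr (- l)\<close> and each of the two oscillating integrals gains
    \<open>2 / t\<close>; on the right the integral of \<open>(1 - x) powr l\<close> also has order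
    \<open>t powr (- l - 1)\<close>.\<close>
  define b where "b = 1 - 1 / t"
  have b: "0 \<le> b" "b < 1" "1 - b = 1 / t" using t by (auto simp: b_def)
  have split: "integral {0..1} (\<lambda>y. g y * h y) = integral {0..b} (\<lambda>y. g y * h y) + integral {b..1} (\<lambda>y. g y * h y)"
    using b int by (intro Henstock_Kurzweil_Integration.integral_combine[symmetric]) auto
  have gb: "g x \<le> C * t powr (- l)" if "0 \<le> x" "x \<le> b" for x
  proof -
    have "g x \<le> g b" using mono that b by auto
    also have "\<dots> \<le> C * (1 / t) powr l" using up[of b] b by simp
    also have "(1 / t) powr l = t powr (- l)" using t by (simp add: powr_minus powr_divide inverse_eq_divide)
    finally show ?thesis .
  qed
  have "h integrable_on {0..b}" by (intro integrable_continuous_interval continuous_on_subset[OF h(1)]) auto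
  from second_mean_value_theorem[OF this b(1), of g] mono b
  obtain c where c: "c \<in> {0..b}"
    "integral {0..b} (\<lambda>x. g x * h x) = g 0 * integral {0..c} h + g b * integral {c..b} h" by auto
  note c(2)
  also have "\<bar>\<dots>\<bar> \<le> g 0 * \<bar>integral {0..c} h\<bar> + g b * \<bar>integral {c..b} h\<bar>"
    using pos[of 0] pos[of b] b by (intro order_trans[OF abs_triangle_ineq]) (simp add: abs_mult)
  also have "\<dots> \<le> (C * t powr (- l)) * (2 / t) + (C * t powr (- l)) * (2 / t)"
    using pos[of 0] pos[of b] b c(1) gb[of 0] gb[of b] h(3) C by (intro add_mono mult_mono) auto
  also have "\<dots> = 4 * C * t powr (- l - 1)"
    using t by (simp add: powr_diff)
  finally have 1: "\<bar>integral {0..b} (\<lambda>y. g y * h y)\<bar> \<le> 4 * C * t powr (- l - 1)" .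
  have "((\<lambda>x. x powr l) has_integral ((1 - b) powr (l + 1) / (l + 1))) {0..1 - b}"
    using has_integral_powr_from_0[of l "1 - b"] l b t by simp
  from has_integral_affinity[OF this[folded cbox_interval], of "-1" 1]
  have i: "((\<lambda>x. (1 - x) powr l) has_integral ((1 - b) powr (l + 1) / (l + 1))) {b..1}"
    by simp
  have "norm (integral {b..1} (\<lambda>y. g y * h y)) \<le> integral {b..1} (\<lambda>y. C * (1 - y) powr l)"
  proof (rule integral_norm_bound_integral)
    show "(\<lambda>y. g y * h y) integrable_on {b..1}" using b by (intro integrable_subinterval_real[OF int]) auto
    show "(\<lambda>y. C * (1 - y) powr l) integrable_on {b..1}" using i by (intro integrable_on_mult_right) auto
    show "norm (g x * h x) \<le> C * (1 - x) powr l" if "x \<in> {b..1}" for x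
    proof -
      have "\<bar>g x\<bar> * \<bar>h x\<bar> \<le> g x * 1" using pos[of x] h(2)[of x] that b by (intro mult_mono) auto
      then show ?thesis using up[of x] that b by (simp add: abs_mult)
    qed
  qed
  also have "\<dots> = C * ((1 - b) powr (l + 1) / (l + 1))" using i by (simp add: integral_unique)
  also have "(1 - b) powr (l + 1) = t powr (- l - 1)"
  proof -
    have "(1 / t) powr (l + 1) = t powr (- (l + 1))" using t by (simp only: powr_minus) (simp add: powr_divide inverse_eq_divide)
    then show ?thesis unfolding b(3) by (simp add: minus_diff_commute)
  qed
  finally have 2: "\<bar>integral {b..1} (\<lambda>y. g y * h y)\<bar> \<le> C / (l + 1) * t powr (- l - 1)" by simp
  show ?thesis unfolding split using 1 2
    by (intro order_trans[OF abs_triangle_ineq]) (simp add: algebra_simps)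
qed

text \<open>For \<open>l \<le> 0\<close> the weight \<open>(1 - y^2) powr l\<close> is nondecreasing
  on \<open>{0..<1}\<close>, and so is its product with \<open>y\<close>; both are at most
  \<open>(1 - y) powr l\<close>. At 1 the weight is 0 by convention, so monotonicity is claimed only
  below 1.\<close>

lemma Icos_Isin_decay_base:
  assumes l: "-1 < l" "l \<le> 0"
  shows "\<exists>C. \<forall>t\<ge>1. \<bar>Icos l t\<bar> \<le> C * t powr (- l - 1) \<and> \<bar>Isin l t\<bar> \<le> C * t powr (- l - 1)"
proof (intro exI allI impI)
  fix t :: real assume t: "1 \<le> t"
  have pw: "(1 - x\<^sup>2) powr l \<le> 1 * (1 - x) powr l" if "0 \<le> x" "x \<le> 1" for x :: real
  proof (cases "x = 1")
    case False
    then have "(1 - x\<^sup>2) powr l \<le> (1 - x) powr l"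
      using that l by (intro powr_mono2') (auto simp: power2_eq_square mult_left_le)
    then show ?thesis by simp
  qed auto
  have mono: "(1 - x\<^sup>2) powr l \<le> (1 - y\<^sup>2) powr l" if "0 \<le> x" "x \<le> y" "y < 1" for x y :: real
    using that l by (intro powr_mono2') (auto simp: power_mono abs_square_less_1)
  have intc: "\<bar>integral {a..b} (\<lambda>y. cos (t * y))\<bar> \<le> 2 / t" if "a \<le> b" for a b
  proof -
    have "((\<lambda>y. cos (t * y)) has_integral (sin (t * b) / t - sin (t * a) / t)) {a..b}"
      using t that by (intro fundamental_theorem_of_calculus)
        (auto intro!: derivative_eq_intros simp flip: has_real_derivative_iff_has_vector_derivative)
    then have "integral {a..b} (\<lambda>y. cos (t * y)) = (sin (t * b) - sin (t * a)) / t"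
      by (simp add: integral_unique diff_divide_distrib)
    moreover have "\<bar>sin (t * b) - sin (t * a)\<bar> \<le> 2"
      using abs_sin_le_one[of "t * a"] abs_sin_le_one[of "t * b"] by linarith
    ultimately show ?thesis using t by (simp add: divide_right_mono)
  qed
  have ints: "\<bar>integral {a..b} (\<lambda>y. sin (t * y))\<bar> \<le> 2 / t" if "a \<le> b" for a b
  proof -
    have "((\<lambda>y. sin (t * y)) has_integral (- cos (t * b) / t - - cos (t * a) / t)) {a..b}"
      using t that by (intro fundamental_theorem_of_calculus)
        (auto intro!: derivative_eq_intros simp flip: has_real_derivative_iff_has_vector_derivative)
    then have "integral {a..b} (\<lambda>y. sin (t * y)) = (cos (t * a) - cos (t * b)) / t"
      by (simp add: integral_unique diff_divide_distrib)
    moreover have "\<bar>cos (t * a) - cos (t * b)\<bar> \<le> 2"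
      using abs_cos_le_one[of "t * a"] abs_cos_le_one[of "t * b"] by linarith
    ultimately show ?thesis using t by (simp add: divide_right_mono)
  qed
  have A: "\<bar>Icos l t\<bar> \<le> 1 * (4 + 1 / (l + 1)) * t powr (- l - 1)" unfolding Icos_def
    by (rule monotone_oscillatory_bound[OF t l])
      (use mono pw intc has_integral_Icos_Isin[OF l(1)] in \<open>auto intro!: continuous_intros simp: power_le_one has_integral_iff\<close>)
  have B: "\<bar>Isin l t\<bar> \<le> 1 * (4 + 1 / (l + 1)) * t powr (- l - 1)" unfolding Isin_def
  proof (rule monotone_oscillatory_bound[OF t l])
    show "x * (1 - x\<^sup>2) powr l \<le> y * (1 - y\<^sup>2) powr l" if "0 \<le> x" "x \<le> y" "y < 1" for x y :: real
      using mono[OF that] that by (intro mult_mono) auto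
    show "x * (1 - x\<^sup>2) powr l \<le> 1 * (1 - x) powr l" if "0 \<le> x" "x \<le> 1" for x :: real
      using mult_mono[OF that(2) pw[OF that]] that by simp
  qed (use ints has_integral_Icos_Isin[OF l(1)] in \<open>auto intro!: continuous_intros simp: has_integral_iff\<close>)
  show "\<bar>Icos l t\<bar> \<le> (1 * (4 + 1 / (l + 1))) * t powr (- l - 1) \<and> \<bar>Isin l t\<bar> \<le> (1 * (4 + 1 / (l + 1))) * t powr (- l - 1)"
    using A B by simp
qed

text \<open>\<open>Icos_Isin_rec\<close> expresses \<open>t\<close> times each new integral through
  integrals already bounded, and dividing by \<open>t\<close> gains one power. In the case of
  \<open>Isin\<close> the term with \<open>Icos (l + 1)\<close> already has the better order and is
  enlarged by the factor \<open>t \<ge> 1\<close>.\<close>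

lemma Icos_Isin_decay_step:
  assumes l: "-1 < l"
    and IH: "\<exists>C. \<forall>t\<ge>1. \<bar>Icos l t\<bar> \<le> C * t powr (- l - 1) \<and> \<bar>Isin l t\<bar> \<le> C * t powr (- l - 1)"
  shows "\<exists>C. \<forall>t\<ge>1. \<bar>Icos (l + 1) t\<bar> \<le> C * t powr (- (l + 1) - 1) \<and> \<bar>Isin (l + 1) t\<bar> \<le> C * t powr (- (l + 1) - 1)"
proof -
  obtain C where C: "\<And>t. t \<ge> 1 \<Longrightarrow> \<bar>Icos l t\<bar> \<le> C * t powr (- l - 1)"
    "\<And>t. t \<ge> 1 \<Longrightarrow> \<bar>Isin l t\<bar> \<le> C * t powr (- l - 1)" using IH by blast
  have C0: "C \<ge> 0" using C(1)[of 1] by simp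
  define D where "D = 2 * (l + 1) * C"
  have D0: "D \<ge> 0" using C0 l by (simp add: D_def)
  have pt: "t powr (- l - 1) = t * t powr (- (l + 1) - 1)" if "t \<ge> 1" for t :: real
    using that powr_mult_base[of t "- (l + 1) - 1"] by (simp add: algebra_simps minus_diff_commute)
  have c: "\<bar>Icos (l + 1) t\<bar> \<le> D * t powr (- (l + 1) - 1)" if t: "t \<ge> 1" for t
  proof -
    have "t * \<bar>Icos (l + 1) t\<bar> = 2 * (l + 1) * \<bar>Isin l t\<bar>"
      using arg_cong[OF Icos_Isin_rec(1)[OF l, of t], of abs] t l by (simp add: abs_mult)
    also have "\<dots> \<le> 2 * (l + 1) * (C * t powr (- l - 1))" using C(2)[OF t] l by (intro mult_left_mono) auto
    also have "\<dots> = t * (D * t powr (- (l + 1) - 1))" unfolding pt[OF t] D_def by simp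
    finally show ?thesis using t by simp
  qed
  have s: "\<bar>Isin (l + 1) t\<bar> \<le> ((2 * l + 3) * D + D) * t powr (- (l + 1) - 1)" if t: "t \<ge> 1" for t
  proof -
    have "t * \<bar>Isin (l + 1) t\<bar> = \<bar>(2 * l + 3) * Icos (l + 1) t - 2 * (l + 1) * Icos l t\<bar>"
      using arg_cong[OF Icos_Isin_rec(2)[OF l, of t], of abs] t by (simp add: abs_mult)
    also have "\<dots> \<le> (2 * l + 3) * \<bar>Icos (l + 1) t\<bar> + 2 * (l + 1) * \<bar>Icos l t\<bar>"
      using l by (intro order_trans[OF abs_triangle_ineq4]) (simp add: abs_mult)
    also have "\<dots> \<le> (2 * l + 3) * (D * t powr (- (l + 1) - 1)) + 2 * (l + 1) * (C * t powr (- l - 1))"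
      using l c[OF t] C(1)[OF t] by (intro add_mono mult_left_mono) auto
    also have "\<dots> = (2 * l + 3) * (D * t powr (- (l + 1) - 1)) + t * (D * t powr (- (l + 1) - 1))"
      unfolding pt[OF t] D_def by simp
    also have "\<dots> \<le> t * ((2 * l + 3) * (D * t powr (- (l + 1) - 1))) + t * (D * t powr (- (l + 1) - 1))"
      using t l D0 mult_right_mono[of 1 t "(2 * l + 3) * (D * t powr (- (l + 1) - 1))"]
      by (intro add_right_mono) auto
    also have "\<dots> = t * (((2 * l + 3) * D + D) * t powr (- (l + 1) - 1))" by (simp add: algebra_simps)
    finally show ?thesis using t by simp
  qed
  show ?thesis
  proof (intro exI allI impI conjI)
    fix t :: real assume t: "1 \<le> t"
    show "\<bar>Isin (l + 1) t\<bar> \<le> ((2 * l + 3) * D + D) * t powr (- (l + 1) - 1)" by (rule s[OF t])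
    have "D * t powr (- (l + 1) - 1) \<le> ((2 * l + 3) * D + D) * t powr (- (l + 1) - 1)"
      using D0 l by (intro mult_right_mono) auto
    then show "\<bar>Icos (l + 1) t\<bar> \<le> ((2 * l + 3) * D + D) * t powr (- (l + 1) - 1)" using c[OF t] by simp
  qed
qed

text \<open>Lowering \<open>l\<close> by ones ends in \<open>(-1, 0]\<close>, also for non-integral
  \<open>l\<close>; the induction runs over a natural upper bound \<open>n\<close> of
  \<open>l\<close>.\<close>

lemma Icos_Isin_decay:
  assumes l: "-1 < l"
  shows "\<exists>C. \<forall>t\<ge>1. \<bar>Icos l t\<bar> \<le> C * t powr (- l - 1) \<and> \<bar>Isin l t\<bar> \<le> C * t powr (- l - 1)"
proof -
  define n where "n = nat \<lceil>l\<rceil>"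
  have "\<exists>C. \<forall>t\<ge>1. \<bar>Icos l t\<bar> \<le> C * t powr (- l - 1) \<and> \<bar>Isin l t\<bar> \<le> C * t powr (- l - 1)"
    if "-1 < l" "l \<le> real n" for n l using that
  proof (induction n arbitrary: l)
    case 0 then show ?case using Icos_Isin_decay_base by simp
  next
    case (Suc n)
    show ?case
    proof (cases "l \<le> 0")
      case False
      with Suc.prems Suc.IH[of "l - 1"] have "\<exists>C. \<forall>t\<ge>1. \<bar>Icos (l - 1) t\<bar> \<le> C * t powr (- (l - 1) - 1) \<and> \<bar>Isin (l - 1) t\<bar> \<le> C * t powr (- (l - 1) - 1)"
        by simp
      from Icos_Isin_decay_step[OF _ this] False show ?thesis by simp
    qed (use Icos_Isin_decay_base Suc.prems in simp)
  qed
  moreover have "l \<le> real n" unfolding n_def by linarith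
  ultimately show ?thesis using l by blast
qed

section \<open>Marginals of radial functions\<close>

text \<open>\<open>p\<close> is the length of the coordinates already fixed, and the map gives the
  length after two more are added. The measures are compared on half-lines \<open>{..x}\<close>,
  whose preimage for \<open>x > p\<close> is a disc of area \<open>pi * (x^2 - p^2)\<close>.\<close>

lemma polar_planar_distr:
  assumes ab: "a \<noteq> b" and p: "0 \<le> p"
  shows "distr (Pi\<^sub>M {a, b} (\<lambda>_. lborel)) borel (\<lambda>f. sqrt (p\<^sup>2 + ((f a)\<^sup>2 + (f b)\<^sup>2)))
    = density lborel (\<lambda>r. if p \<le> r then ennreal (2 * pi * r) else 0)" (is "?M = ?N")
proof (rule measure_eqI_generator_eq[where E = "range atMost" and \<Omega> = UNIV and A = "\<lambda>i. {..real i}"])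
  let ?P = "Pi\<^sub>M {a, b} (\<lambda>_. lborel :: real measure)"
  let ?S = "\<lambda>f. sqrt (p\<^sup>2 + ((f a)\<^sup>2 + (f b)\<^sup>2))"
  have [measurable]: "?S \<in> borel_measurable ?P" by measurable
  have ball: "emeasure ?P ({f. sqrt ((f a)\<^sup>2 + (f b)\<^sup>2) \<le> r} \<inter> space ?P) = ennreal (pi * r\<^sup>2)" if "r > 0" for r
    using emeasure_cball_aux[of "{a, b}" r] that ab by (simp add: unit_ball_vol_2 card_insert_if power2_eq_square)
  have M: "emeasure ?M {..x} = ennreal (pi * (x\<^sup>2 - p\<^sup>2)) * indicator {p..} x" for x
  proof -
    have e: "emeasure ?M {..x} = emeasure ?P ({f. ?S f \<le> x} \<inter> space ?P)"
      by (subst emeasure_distr) (auto intro!: arg_cong[where f = "emeasure ?P"])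
    show ?thesis
    proof (cases "p < x")
      case True
      have "?S f \<le> x \<longleftrightarrow> sqrt ((f a)\<^sup>2 + (f b)\<^sup>2) \<le> sqrt (x\<^sup>2 - p\<^sup>2)" for f
        using True p real_sqrt_le_iff[of "p\<^sup>2 + ((f a)\<^sup>2 + (f b)\<^sup>2)" "x\<^sup>2"] by (auto simp: algebra_simps)
      then have "emeasure ?M {..x} = ennreal (pi * (sqrt (x\<^sup>2 - p\<^sup>2))\<^sup>2)"
        unfolding e using True p by (subst ball[symmetric]) (auto simp: power_strict_mono)
      then show ?thesis using True p by (simp add: power_mono)
    next
      case False
      \<comment> \<open>For \<open>x \<le> p\<close> the preimage is empty or the origin, while the
        area formula \<open>ball\<close> asks for a positive radius; so it is enclosed in discs of
        arbitrarily small area \<open>y\<close>.\<close>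
      have "emeasure ?M {..x} \<le> ennreal 0 + ennreal y" if "y > 0" for y
      proof -
        have "?S f \<le> x \<Longrightarrow> sqrt ((f a)\<^sup>2 + (f b)\<^sup>2) \<le> sqrt (y / pi)" for f
        proof -
          assume "?S f \<le> x"
          then have "?S f \<le> sqrt (p\<^sup>2)" using False p by simp
          then have "(f a)\<^sup>2 + (f b)\<^sup>2 \<le> 0" unfolding real_sqrt_le_iff by simp
          then show ?thesis using \<open>y > 0\<close> by (intro real_sqrt_le_mono) (auto intro: order_trans)
        qed
        then have "emeasure ?M {..x} \<le> emeasure ?P ({f. sqrt ((f a)\<^sup>2 + (f b)\<^sup>2) \<le> sqrt (y / pi)} \<inter> space ?P)"
          unfolding e by (intro emeasure_mono) auto
        also have "\<dots> = ennreal (pi * (sqrt (y / pi))\<^sup>2)" using \<open>y > 0\<close> by (intro ball) simp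
        finally show ?thesis using \<open>y > 0\<close> by simp
      qed
      then have "emeasure ?M {..x} \<le> ennreal 0" by (rule ennreal_le_epsilon)
      then have "emeasure ?M {..x} = 0" by simp
      then show ?thesis using False by (auto simp: indicator_def)
    qed
  qed
  have N: "emeasure ?N {..x} = ennreal (pi * (x\<^sup>2 - p\<^sup>2)) * indicator {p..} x" for x
  proof -
    have "emeasure ?N {..x} = (\<integral>\<^sup>+r. (if p \<le> r then ennreal (2 * pi * r) else 0) * indicator {..x} r \<partial>lborel)"
      by (subst emeasure_density) auto
    also have "\<dots> = (\<integral>\<^sup>+r. ennreal (2 * pi * r) * indicator {p..x} r \<partial>lborel)"
      by (intro nn_integral_cong) (auto split: split_indicator)
    also have "\<dots> = ennreal (pi * (x\<^sup>2 - p\<^sup>2)) * indicator {p..} x"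
    proof (cases "p \<le> x")
      case True
      then have "(\<integral>\<^sup>+r. ennreal (2 * pi * r) * indicator {p..x} r \<partial>lborel) = ennreal (pi * x\<^sup>2 - pi * p\<^sup>2)"
        using p by (intro nn_integral_FTC_Icc) (auto intro!: derivative_eq_intros)
      then show ?thesis using True by (simp add: right_diff_distrib)
    qed auto
    finally show ?thesis .
  qed
  show "emeasure ?M X = emeasure ?N X" if "X \<in> range atMost" for X
    using that M N by auto
  show "emeasure ?M {..real i} \<noteq> \<infinity>" for i :: nat
    unfolding M by (auto split: split_indicator)
  show "sets ?M = sigma_sets UNIV (range atMost)" "sets ?N = sigma_sets UNIV (range atMost)"
    by (simp_all add: borel_eq_atMost)
  show "Int_stable (range atMost :: real set set)"
    by (auto simp: Int_stable_def)
  show "(\<Union>i. {..real i}) = UNIV" using real_arch_simple by auto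
qed auto

text \<open>The integral of \<open>g\<close> of the distance to the origin over a plane at distance
  \<open>\<bar>t\<bar>\<close> from it, written in that distance \<open>r\<close>. Values in
  \<open>ennreal\<close> keep the iteration free of integrability conditions.\<close>

definition radial_marginal :: "(real \<Rightarrow> ennreal) \<Rightarrow> real \<Rightarrow> ennreal" where
  "radial_marginal g t = (\<integral>\<^sup>+r. (if \<bar>t\<bar> \<le> r then ennreal (2 * pi * r) * g r else 0) \<partial>lborel)"

lemma radial_marginal_measurable[measurable]:
  assumes [measurable]: "g \<in> borel_measurable borel"
  shows "radial_marginal g \<in> borel_measurable borel"
  unfolding radial_marginal_def[abs_def] by measurable

text \<open>Integrating out one pair of coordinates with the others fixed replaces \<open>g\<close>
  by \<open>radial_marginal g\<close>, so the induction must keep \<open>g\<close>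
  arbitrary.\<close>

lemma nn_integral_radial_PiM:
  assumes "finite A" "card A = 2 * k" and g: "g \<in> borel_measurable borel" and t: "0 \<le> t"
  shows "(\<integral>\<^sup>+x. g (sqrt (t\<^sup>2 + (\<Sum>i\<in>A. (x i)\<^sup>2))) \<partial>Pi\<^sub>M A (\<lambda>_. lborel)) = (radial_marginal ^^ k) g t"
  using assms
proof (induction k arbitrary: A g)
  case 0
  interpret product_sigma_finite "\<lambda>_. lborel :: real measure" ..
  from 0 show ?case by (simp add: PiM_empty nn_integral_count_space_finite)
next
  case (Suc k)
  interpret product_sigma_finite "\<lambda>_. lborel :: real measure" ..
  note [measurable] = Suc.prems(3)
  from Suc.prems obtain a where a: "a \<in> A" by fastforce
  with Suc.prems have "card (A - {a}) = Suc (2 * k)" by simp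
  then obtain b where b: "b \<in> A" "b \<noteq> a"
    by (metis Diff_iff card.empty ex_in_conv insertI1 nat.distinct(1))
  define B where "B = A - {a, b}"
  have B: "finite B" "card B = 2 * k" "A = B \<union> {a, b}" "B \<inter> {a, b} = {}"
    using Suc.prems a b by (auto simp: B_def card_Diff_subset)
  have "(\<integral>\<^sup>+x. g (sqrt (t\<^sup>2 + (\<Sum>i\<in>A. (x i)\<^sup>2))) \<partial>Pi\<^sub>M A (\<lambda>_. lborel)) =
    (\<integral>\<^sup>+x. \<integral>\<^sup>+y. g (sqrt (t\<^sup>2 + (\<Sum>i\<in>A. (merge B {a, b} (x, y) i)\<^sup>2))) \<partial>Pi\<^sub>M {a, b} (\<lambda>_. lborel) \<partial>Pi\<^sub>M B (\<lambda>_. lborel))"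
    unfolding B(3) by (rule product_nn_integral_fold) (use B in auto)
  also have "\<dots> = (\<integral>\<^sup>+x. radial_marginal g (sqrt (t\<^sup>2 + (\<Sum>i\<in>B. (x i)\<^sup>2))) \<partial>Pi\<^sub>M B (\<lambda>_. lborel))"
  proof (rule nn_integral_cong)
    fix x :: "'a \<Rightarrow> real"
    define p where "p = sqrt (t\<^sup>2 + (\<Sum>i\<in>B. (x i)\<^sup>2))"
    have p: "0 \<le> p" "p\<^sup>2 = t\<^sup>2 + (\<Sum>i\<in>B. (x i)\<^sup>2)" unfolding p_def by (auto simp: sum_nonneg)
    have "(\<Sum>i\<in>A. (merge B {a, b} (x, y) i)\<^sup>2) = (\<Sum>i\<in>B. (x i)\<^sup>2) + ((y a)\<^sup>2 + (y b)\<^sup>2)" for y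
    proof -
      have "(\<Sum>i\<in>A. (merge B {a, b} (x, y) i)\<^sup>2) = (\<Sum>i\<in>B. (merge B {a, b} (x, y) i)\<^sup>2) + (\<Sum>i\<in>{a, b}. (merge B {a, b} (x, y) i)\<^sup>2)"
        unfolding B(3) using B by (intro sum.union_disjoint) auto
      also have "(\<Sum>i\<in>B. (merge B {a, b} (x, y) i)\<^sup>2) = (\<Sum>i\<in>B. (x i)\<^sup>2)"
        using B by (intro sum.cong) (auto simp: merge_def)
      finally show ?thesis using b B(4) by (auto simp: merge_def)
    qed
    then have "(\<integral>\<^sup>+y. g (sqrt (t\<^sup>2 + (\<Sum>i\<in>A. (merge B {a, b} (x, y) i)\<^sup>2))) \<partial>Pi\<^sub>M {a, b} (\<lambda>_. lborel))
      = (\<integral>\<^sup>+y. g (sqrt (p\<^sup>2 + ((y a)\<^sup>2 + (y b)\<^sup>2))) \<partial>Pi\<^sub>M {a, b} (\<lambda>_. lborel))"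
      unfolding p(2) by (simp add: add.assoc)
    also have "\<dots> = (\<integral>\<^sup>+r. g r \<partial>distr (Pi\<^sub>M {a, b} (\<lambda>_. lborel)) borel (\<lambda>f. sqrt (p\<^sup>2 + ((f a)\<^sup>2 + (f b)\<^sup>2))))"
      by (subst nn_integral_distr) measurable
    also have "\<dots> = radial_marginal g p"
      unfolding polar_planar_distr[OF b(2)[symmetric] p(1)] radial_marginal_def
      using p(1) by (subst nn_integral_density) (auto intro!: nn_integral_cong)
    finally show "(\<integral>\<^sup>+y. g (sqrt (t\<^sup>2 + (\<Sum>i\<in>A. (merge B {a, b} (x, y) i)\<^sup>2))) \<partial>Pi\<^sub>M {a, b} (\<lambda>_. lborel)) =
      radial_marginal g (sqrt (t\<^sup>2 + (\<Sum>i\<in>B. (x i)\<^sup>2)))" unfolding p_def .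
  qed
  also have "\<dots> = (radial_marginal ^^ k) (radial_marginal g) t"
    using Suc.prems B by (intro Suc.IH) auto
  finally show ?case by (simp add: funpow_swap1)
qed

text \<open>In odd dimension the coordinates other than \<open>b\<close> pair off. The free factor
  \<open>u\<close> makes the identity determine the distribution of \<open>w \<bullet> b\<close>
  under the density \<open>g (norm w)\<close>.\<close>

lemma nn_integral_radial_marginal:
  fixes b :: "'a::euclidean_space"
  assumes b: "b \<in> Basis" and dim: "DIM('a) = 2 * k + 1"
    and g[measurable]: "g \<in> borel_measurable borel" and u[measurable]: "u \<in> borel_measurable borel"
  shows "(\<integral>\<^sup>+w. g (norm (w::'a)) * u (w \<bullet> b) \<partial>lborel) = (\<integral>\<^sup>+t. (radial_marginal ^^ k) g \<bar>t\<bar> * u t \<partial>lborel)"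
proof -
  interpret product_sigma_finite "\<lambda>_::'a. lborel :: real measure" ..
  define A where "A = (Basis :: 'a set) - {b}"
  have A: "finite A" "b \<notin> A" "insert b A = Basis" "card A = 2 * k" using b dim by (auto simp: A_def)
  let ?v = "\<lambda>f. \<Sum>c\<in>Basis. f c *\<^sub>R c :: 'a"
  have vb: "?v f \<bullet> b = f b" for f using b by simp
  have vn: "norm (?v f) = sqrt ((f b)\<^sup>2 + (\<Sum>c\<in>A. (f c)\<^sup>2))" for f
  proof -
    have "(norm (?v f))\<^sup>2 = (\<Sum>c\<in>Basis. (?v f \<bullet> c)\<^sup>2)"
      by (subst power2_norm_eq_inner, subst euclidean_inner) (simp add: power2_eq_square)
    also have "\<dots> = (\<Sum>c\<in>Basis. (f c)\<^sup>2)" by (intro sum.cong) auto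
    also have "\<dots> = (f b)\<^sup>2 + (\<Sum>c\<in>A. (f c)\<^sup>2)" using A(1,2) unfolding A(3)[symmetric] by simp
    finally show ?thesis by (metis norm_ge_zero real_sqrt_unique)
  qed
  have m: "(\<lambda>f. g (sqrt ((f b)\<^sup>2 + (\<Sum>c\<in>A. (f c)\<^sup>2))) * u (f b)) \<in> borel_measurable (Pi\<^sub>M (insert b A) (\<lambda>_. lborel))"
    by measurable
  have "(\<integral>\<^sup>+w. g (norm (w::'a)) * u (w \<bullet> b) \<partial>lborel) =
      (\<integral>\<^sup>+f. g (sqrt ((f b)\<^sup>2 + (\<Sum>c\<in>A. (f c)\<^sup>2))) * u (f b) \<partial>Pi\<^sub>M Basis (\<lambda>_. lborel))"
    by (subst lborel_eq, subst nn_integral_distr) (auto simp: vn vb)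
  also have "\<dots> = (\<integral>\<^sup>+t. \<integral>\<^sup>+x. g (sqrt (((x(b := t)) b)\<^sup>2 + (\<Sum>c\<in>A. ((x(b := t)) c)\<^sup>2))) * u ((x(b := t)) b) \<partial>Pi\<^sub>M A (\<lambda>_. lborel) \<partial>lborel)"
    unfolding A(3)[symmetric] using A(1,2) m by (rule product_nn_integral_insert_rev)
  also have "\<dots> = (\<integral>\<^sup>+t. (radial_marginal ^^ k) g \<bar>t\<bar> * u t \<partial>lborel)"
  proof (rule nn_integral_cong)
    fix t :: real
    have "(\<integral>\<^sup>+x. g (sqrt (((x(b := t)) b)\<^sup>2 + (\<Sum>c\<in>A. ((x(b := t)) c)\<^sup>2))) * u ((x(b := t)) b) \<partial>Pi\<^sub>M A (\<lambda>_. lborel))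
      = (\<integral>\<^sup>+x. g (sqrt (\<bar>t\<bar>\<^sup>2 + (\<Sum>c\<in>A. (x c)\<^sup>2))) * u t \<partial>Pi\<^sub>M A (\<lambda>_. lborel))"
      using A(2) by (intro nn_integral_cong) (auto intro!: arg_cong[where f = g] arg_cong2[where f = "(*)"] sum.cong)
    also have "\<dots> = (radial_marginal ^^ k) g \<bar>t\<bar> * u t"
      using A g by (subst nn_integral_multc) (auto simp: nn_integral_radial_PiM[symmetric])
    finally show "(\<integral>\<^sup>+x. g (sqrt (((x(b := t)) b)\<^sup>2 + (\<Sum>c\<in>A. ((x(b := t)) c)\<^sup>2))) * u ((x(b := t)) b) \<partial>Pi\<^sub>M A (\<lambda>_. lborel))
      = (radial_marginal ^^ k) g \<bar>t\<bar> * u t" .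
  qed
  finally show ?thesis .
qed

text \<open>The argument for uniqueness of Haar measure: evaluate the double integral of
  \<open>B x * h (x + f y)\<close>, with \<open>B\<close> the indicator of the unit ball, in both orders. (The change of
  variables theorems of the library need a well-ordered index type.)\<close>

lemma nn_integral_lborel_orthogonal:
  fixes f :: "'a::euclidean_space \<Rightarrow> 'a"
  assumes f: "orthogonal_transformation f" and h[measurable]: "h \<in> borel_measurable borel"
  shows "(\<integral>\<^sup>+x. h (f x) \<partial>lborel) = (\<integral>\<^sup>+x. h x \<partial>lborel)"
proof -
  have lin: "linear f" using f by (simp add: orthogonal_transformation_linear)
  have f_meas[measurable]: "f \<in> borel_measurable borel"
    using lin by (intro borel_measurable_continuous_onI linear_continuous_on) (simp add: linear_conv_bounded_linear)
  have nf: "norm (f x) = norm x" for x using f by (simp add: orthogonal_transformation_norm)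
  have surj: "\<exists>x'. f x' = x" for x
    using orthogonal_transformation_surj[OF f] by (metis surjD)
  have shift: "(\<integral>\<^sup>+y. k (t + y) \<partial>lborel) = (\<integral>\<^sup>+y. k y \<partial>lborel)" "(\<integral>\<^sup>+y. k (t - y) \<partial>lborel) = (\<integral>\<^sup>+y. k y \<partial>lborel)"
    if [measurable]: "k \<in> borel_measurable borel" for k :: "'a \<Rightarrow> ennreal" and t
    using arg_cong[OF lborel_affine[of 1 t], of "\<lambda>M. \<integral>\<^sup>+y. k y \<partial>M"]
      arg_cong[OF lborel_affine[of "-1" t], of "\<lambda>M. \<integral>\<^sup>+y. k y \<partial>M"]
    by (simp_all add: nn_integral_density nn_integral_distr)
  define B where "B = (indicator (ball 0 1) :: 'a \<Rightarrow> ennreal)"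
  have [measurable]: "B \<in> borel_measurable borel" unfolding B_def by (intro borel_measurable_indicator) simp
  define b where "b = (\<integral>\<^sup>+x. B x \<partial>lborel)"
  have b: "b = emeasure lborel (ball (0::'a) 1)" unfolding b_def B_def by simp
  have "b \<noteq> 0" "b \<noteq> \<infinity>" unfolding b
    using emeasure_lborel_ball_finite[of "0::'a" 1] less_imp_neq[OF unit_ball_vol_pos[OF of_nat_0_le_iff[of "DIM('a)"]]]
    by (auto simp: emeasure_ball)
  have "(\<integral>\<^sup>+x. \<integral>\<^sup>+y. B x * h (x + f y) \<partial>lborel \<partial>lborel) = (\<integral>\<^sup>+x. B x * (\<integral>\<^sup>+y. h (f y) \<partial>lborel) \<partial>lborel)"
  proof (rule nn_integral_cong)
    fix x
    obtain x' where x': "f x' = x" using surj by blast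
    have "(\<integral>\<^sup>+y. h (x + f y) \<partial>lborel) = (\<integral>\<^sup>+y. (h \<circ> f) (x' + y) \<partial>lborel)"
      unfolding x'[symmetric] by (simp add: linear_add[OF lin])
    also have "\<dots> = (\<integral>\<^sup>+y. h (f y) \<partial>lborel)" by (subst shift) (auto simp: o_def)
    finally show "(\<integral>\<^sup>+y. B x * h (x + f y) \<partial>lborel) = B x * (\<integral>\<^sup>+y. h (f y) \<partial>lborel)"
      by (simp add: nn_integral_cmult)
  qed
  also have "\<dots> = b * (\<integral>\<^sup>+y. h (f y) \<partial>lborel)" unfolding b_def by (rule nn_integral_multc) measurable
  finally have 1: "b * (\<integral>\<^sup>+y. h (f y) \<partial>lborel) = (\<integral>\<^sup>+x. \<integral>\<^sup>+y. B x * h (x + f y) \<partial>lborel \<partial>lborel)" ..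
  have "(\<integral>\<^sup>+x. \<integral>\<^sup>+y. B x * h (x + f y) \<partial>lborel \<partial>lborel) = (\<integral>\<^sup>+y. \<integral>\<^sup>+x. B x * h (x + f y) \<partial>lborel \<partial>lborel)"
    by (rule lborel_pair.Fubini'[symmetric]) measurable
  also have "\<dots> = (\<integral>\<^sup>+y. \<integral>\<^sup>+x. B (x - f y) * h x \<partial>lborel \<partial>lborel)"
  proof (rule nn_integral_cong)
    fix y
    show "(\<integral>\<^sup>+x. B x * h (x + f y) \<partial>lborel) = (\<integral>\<^sup>+x. B (x - f y) * h x \<partial>lborel)"
      using shift(1)[of "\<lambda>x. B x * h (x + f y)" "- f y"] by simp
  qed
  also have "\<dots> = (\<integral>\<^sup>+x. \<integral>\<^sup>+y. B (x - f y) * h x \<partial>lborel \<partial>lborel)"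
    by (rule lborel_pair.Fubini') measurable
  also have "\<dots> = (\<integral>\<^sup>+x. b * h x \<partial>lborel)"
  proof (rule nn_integral_cong)
    fix x
    obtain x' where x': "f x' = x" using surj by blast
    \<comment> \<open>Here \<open>x - f y = f (x' - y)\<close>, and \<open>f\<close> preserves the
      norm and hence the unit ball.\<close>
    have "B (x - f y) = B (x' - y)" for y
      unfolding x'[symmetric] linear_diff[OF lin, symmetric] B_def by (simp add: indicator_def nf)
    then have "(\<integral>\<^sup>+y. B (x - f y) \<partial>lborel) = b" unfolding b_def by (simp add: shift)
    then show "(\<integral>\<^sup>+y. B (x - f y) * h x \<partial>lborel) = b * h x" by (simp add: nn_integral_multc)
  qed
  also have "\<dots> = b * (\<integral>\<^sup>+x. h x \<partial>lborel)" by (rule nn_integral_cmult) measurable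
  finally have "b * (\<integral>\<^sup>+y. h (f y) \<partial>lborel) = b * (\<integral>\<^sup>+x. h x \<partial>lborel)" unfolding 1 .
  with \<open>b \<noteq> 0\<close> \<open>b \<noteq> \<infinity>\<close> show ?thesis by (simp add: ennreal_mult_cancel_left)
qed

lemma lborel_distr_orthogonal:
  fixes f :: "'a::euclidean_space \<Rightarrow> 'a"
  assumes f: "orthogonal_transformation f"
  shows "f \<in> borel_measurable borel" "distr lborel borel f = lborel"
proof -
  show m[measurable]: "f \<in> borel_measurable borel"
    using orthogonal_transformation_linear[OF f]
    by (intro borel_measurable_continuous_onI linear_continuous_on) (simp add: linear_conv_bounded_linear)
  show "distr lborel borel f = lborel"
  proof (rule measure_eqI)
    fix A assume "A \<in> sets (distr lborel borel f)"
    then have [measurable]: "A \<in> sets borel" by simp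
    have "emeasure (distr lborel borel f) A = (\<integral>\<^sup>+x. indicator A (f x) \<partial>lborel)"
      by (subst nn_integral_indicator[symmetric], simp, subst nn_integral_distr) auto
    also have "\<dots> = emeasure lborel A"
      by (subst nn_integral_lborel_orthogonal[OF f]) auto
    finally show "emeasure (distr lborel borel f) A = emeasure lborel A" .
  qed simp
qed

section \<open>The spectral density of the Wu functions\<close>

lemma integrable_one_plus_abs_powr:
  assumes "c \<ge> 2"
  shows "integrable lborel (\<lambda>t::real. (1 + \<bar>t\<bar>) powr (- c))"
proof (rule Bochner_Integration.integrable_bound)
  show "integrable lborel (\<lambda>t::real. inverse (1 + t\<^sup>2))"
    using integrable_inverse_1_plus_square by (simp add: set_integrable_def)
  have "(1 + \<bar>t\<bar>) powr (- c) \<le> inverse (1 + t\<^sup>2)" for t :: real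
  proof -
    have "(1 + \<bar>t\<bar>) powr (- c) \<le> (1 + \<bar>t\<bar>) powr (- 2)" using assms by (intro powr_mono) auto
    also have "\<dots> = inverse ((1 + \<bar>t\<bar>)\<^sup>2)" by (simp add: powr_minus powr_numeral)
    also have "\<dots> \<le> inverse (1 + t\<^sup>2)"
      by (intro le_imp_inverse_le) (auto simp: power2_sum add_pos_nonneg)
    finally show ?thesis .
  qed
  then show "AE t in lborel. norm ((1 + \<bar>t\<bar>) powr (- c)) \<le> norm (inverse (1 + (t::real)\<^sup>2))"
    by simp
qed simp

lemma integrable_powr_decay:
  fixes M :: "real \<Rightarrow> real"
  assumes [measurable]: "M \<in> borel_measurable borel" and M: "\<And>t. \<bar>M t\<bar> \<le> C * (1 + \<bar>t\<bar>) powr (- b)" and b: "b \<ge> real j + 2"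
  shows "integrable lborel (\<lambda>t. \<bar>t\<bar> ^ j * M t)"
proof (rule Bochner_Integration.integrable_bound)
  show "integrable lborel (\<lambda>t. C * (1 + \<bar>t\<bar>) powr (- (b - real j)))"
    using b by (intro integrable_mult_right integrable_one_plus_abs_powr) auto
  have C: "C \<ge> 0" using M[of 0] by simp
  have "\<bar>\<bar>t\<bar> ^ j * M t\<bar> \<le> C * (1 + \<bar>t\<bar>) powr (- (b - real j))" for t
  proof -
    have "\<bar>\<bar>t\<bar> ^ j * M t\<bar> \<le> (1 + \<bar>t\<bar>) ^ j * (C * (1 + \<bar>t\<bar>) powr (- b))"
      unfolding abs_mult using M[of t] by (intro mult_mono) (auto intro: power_mono)
    also have "(1 + \<bar>t\<bar>) ^ j = (1 + \<bar>t\<bar>) powr real j" by (simp add: powr_realpow)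
    also have "(1 + \<bar>t\<bar>) powr real j * (C * (1 + \<bar>t\<bar>) powr (- b)) = C * (1 + \<bar>t\<bar>) powr (- (b - real j))"
      by (simp flip: powr_add)
    finally show ?thesis .
  qed
  then show "AE t in lborel. norm (\<bar>t\<bar> ^ j * M t) \<le> norm (C * (1 + \<bar>t\<bar>) powr (- (b - real j)))"
    using C by (simp add: abs_mult)
qed simp

text \<open>The real-valued counterpart of \<open>radial_marginal\<close>, needed because cosine
  transforms integrate signed functions; \<open>iter_marginal_props\<close> matches the two for
  decaying \<open>L\<close>.\<close>

primrec iter_marginal :: "(real \<Rightarrow> real) \<Rightarrow> nat \<Rightarrow> real \<Rightarrow> real" where
  "iter_marginal L 0 t = L t"
| "iter_marginal L (Suc k) t = (\<integral>r. (if \<bar>t\<bar> \<le> r then 2 * pi * r * iter_marginal L k r else 0) \<partial>lborel)"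

text \<open>The factor \<open>r \<le> 1 + \<bar>r\<bar>\<close> uses up one power and the
  integration another, so the exponent drops from \<open>b\<close> to \<open>b - 2\<close>.\<close>

lemma marginal_tail_bound:
  assumes b: "b > 2" and C: "C \<ge> 0"
  shows "(\<integral>\<^sup>+r. (if \<bar>t\<bar> \<le> r then ennreal (2 * pi * r * (C * (1 + \<bar>r\<bar>) powr (- b))) else 0) \<partial>lborel)
    \<le> ennreal (2 * pi * C / (b - 2) * (1 + \<bar>t\<bar>) powr (- (b - 2)))"
proof -
  define f where "f r = 2 * pi * C * (1 + \<bar>r\<bar>) powr (1 - b)" for r :: real
  define F' where "F' r = - (2 * pi * C / (b - 2)) * (1 + r) powr (- (b - 2))" for r :: real
  have "(\<integral>\<^sup>+r. (if \<bar>t\<bar> \<le> r then ennreal (2 * pi * r * (C * (1 + \<bar>r\<bar>) powr (- b))) else 0) \<partial>lborel)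
    \<le> (\<integral>\<^sup>+r. ennreal (f r) * indicator {\<bar>t\<bar>..} r \<partial>lborel)"
  proof (rule nn_integral_mono)
    fix r :: real
    have "2 * pi * r * (C * (1 + \<bar>r\<bar>) powr (- b)) \<le> f r" if "\<bar>t\<bar> \<le> r"
    proof -
      have "r * (1 + \<bar>r\<bar>) powr (- b) \<le> (1 + \<bar>r\<bar>) * (1 + \<bar>r\<bar>) powr (- b)"
        using that by (intro mult_right_mono) auto
      also have "\<dots> = (1 + \<bar>r\<bar>) powr (1 - b)" using powr_mult_base[of "1 + \<bar>r\<bar>" "- b"] by simp
      finally have "(2 * pi * C) * (r * (1 + \<bar>r\<bar>) powr (- b)) \<le> (2 * pi * C) * (1 + \<bar>r\<bar>) powr (1 - b)"
        using C by (intro mult_left_mono) auto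
      then show ?thesis unfolding f_def by (simp add: mult_ac)
    qed
    then show "(if \<bar>t\<bar> \<le> r then ennreal (2 * pi * r * (C * (1 + \<bar>r\<bar>) powr (- b))) else 0) \<le> ennreal (f r) * indicator {\<bar>t\<bar>..} r"
      by (auto intro: ennreal_leI)
  qed
  also have "\<dots> = ennreal (0 - F' \<bar>t\<bar>)"
  proof (rule nn_integral_FTC_atLeast)
    show "DERIV F' r :> f r" if "\<bar>t\<bar> \<le> r" for r
    proof -
      have "1 + r > 0" "\<bar>r\<bar> = r" using that by auto
      then have "((\<lambda>r. (1 + r) powr (- (b - 2))) has_real_derivative (- (b - 2)) * (1 + r) powr (1 - b)) (at r)"
        by (auto intro!: derivative_eq_intros)
      note d = DERIV_cmult[OF this, of "- (2 * pi * C / (b - 2))"]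
      have "- (2 * pi * C / (b - 2)) * (- (b - 2) * (1 + r) powr (1 - b)) = 2 * pi * C * (1 + r) powr (1 - b)"
      proof -
        have "- (c / d) * (- d * P) = c * P" if "d \<noteq> 0" for c d P :: real using that by simp
        from this[of "b - 2"] b show ?thesis by simp
      qed
      then show ?thesis unfolding F'_def[abs_def] f_def \<open>\<bar>r\<bar> = r\<close> by (rule DERIV_cong[OF d])
    qed
    have "((\<lambda>r::real. (1 + r) powr (- (b - 2))) \<longlongrightarrow> 0) at_top"
      using b by (intro tendsto_neg_powr filterlim_tendsto_add_at_top[OF tendsto_const filterlim_ident]) auto
    from tendsto_mult_right_zero[OF this, of "- (2 * pi * C / (b - 2))"]
    show "(F' \<longlongrightarrow> 0) at_top" unfolding F'_def[abs_def] by simp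
  qed (use C in \<open>auto simp: f_def\<close>)
  finally show ?thesis by (simp add: F'_def)
qed

text \<open>A cosine transform suffices, the marginals being even. For decaying \<open>L\<close> it
  is, at \<open>r = norm x\<close>, the Fourier transform of \<open>L (norm w)\<close> in dimension
  \<open>2 * k + 1\<close>; see \<open>radial_ft_eq_integral\<close>.\<close>

definition radial_ft :: "(real \<Rightarrow> real) \<Rightarrow> nat \<Rightarrow> real \<Rightarrow> real" where
  "radial_ft L k r = (\<integral>t. iter_marginal L k t * cos (r * t) \<partial>lborel)"

section \<open>Marginals and cosine transforms of an even density of order a\<close>

context
  fixes L :: "real \<Rightarrow> real" and C a :: real
  assumes Lm: "L \<in> borel_measurable borel" and L0: "\<And>t. 0 \<le> L t" and Leven: "\<And>t. L (- t) = L t"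
    and LC: "\<And>t. L t \<le> C * (1 + \<bar>t\<bar>) powr (- a)"
begin

text \<open>The properties share one induction, since each marginal is a Bochner integral of the
  previous one: decay gives integrability, and integrability with the sign gives agreement with the
  \<open>ennreal\<close> version.\<close>

lemma iter_marginal_props:
  assumes "a - 2 * real k \<ge> 2"
  shows "iter_marginal L k \<in> borel_measurable borel \<and> (\<forall>t. 0 \<le> iter_marginal L k t) \<and>
    (\<forall>t. iter_marginal L k \<bar>t\<bar> = iter_marginal L k t) \<and>
    (\<exists>D. \<forall>t. iter_marginal L k t \<le> D * (1 + \<bar>t\<bar>) powr (- (a - 2 * real k))) \<and>
    (\<forall>t. (radial_marginal ^^ k) (\<lambda>r. ennreal (L r)) t = ennreal (iter_marginal L k t))"
  using assms
proof (induction k)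
  case 0
  have "L \<bar>t\<bar> = L t" for t using Leven[of t] by (simp add: abs_if)
  then show ?case using Lm L0 LC by auto
next
  case (Suc k)
  define M where "M = iter_marginal L k"
  define b where "b = a - 2 * real k"
  \<comment> \<open>Before the last marginal the exponent is still at least 4, enough to integrate
    \<open>r * M r\<close> and to keep \<open>b - 2\<close> positive.\<close>
  have b: "b \<ge> 4" "a - 2 * real (Suc k) = b - 2" using Suc.prems by (auto simp: b_def)
  from Suc.IH Suc.prems obtain D where M[measurable]: "M \<in> borel_measurable borel"
    and M0: "\<And>t. 0 \<le> M t" and Me: "\<And>t. M \<bar>t\<bar> = M t" and MD: "\<And>t. M t \<le> D * (1 + \<bar>t\<bar>) powr (- b)"
    and Mr: "(radial_marginal ^^ k) (\<lambda>r. ennreal (L r)) = (\<lambda>t. ennreal (M t))"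
    unfolding M_def b_def by fastforce
  have D: "D \<ge> 0" using MD[of 0] M0[of 0] by simp
  define N where "N t = (\<integral>r. (if \<bar>t\<bar> \<le> r then 2 * pi * r * M r else 0) \<partial>lborel)" for t
  have N_eq: "iter_marginal L (Suc k) = N" by (rule ext) (simp only: N_def M_def iter_marginal.simps)
  have [measurable]: "N \<in> borel_measurable borel" unfolding N_def[abs_def] by measurable
  have N0: "0 \<le> N t" for t unfolding N_def using M0 by (intro Bochner_Integration.integral_nonneg) (auto intro!: mult_nonneg_nonneg)
  have Ni: "integrable lborel (\<lambda>r. if \<bar>t\<bar> \<le> r then 2 * pi * r * M r else 0)" for t
  proof (rule Bochner_Integration.integrable_bound)
    have "integrable lborel (\<lambda>r. \<bar>r\<bar> ^ 1 * M r)"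
      using b M0 MD by (intro integrable_powr_decay[where C = D and b = b]) auto
    then show "integrable lborel (\<lambda>r. 2 * pi * (\<bar>r\<bar> * M r))" by simp
    show "AE r in lborel. norm (if \<bar>t\<bar> \<le> r then 2 * pi * r * M r else 0) \<le> norm (2 * pi * (\<bar>r\<bar> * M r))"
      by (auto simp: abs_mult)
  qed measurable
  have Nn: "radial_marginal (\<lambda>t. ennreal (M t)) t = ennreal (N t)" for t
  proof -
    have "radial_marginal (\<lambda>t. ennreal (M t)) t = (\<integral>\<^sup>+r. ennreal (if \<bar>t\<bar> \<le> r then 2 * pi * r * M r else 0) \<partial>lborel)"
      unfolding radial_marginal_def using M0 by (intro nn_integral_cong) (auto simp: ennreal_mult)
    also have "\<dots> = ennreal (N t)"
      unfolding N_def using M0 by (intro nn_integral_eq_integral Ni) auto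
    finally show ?thesis .
  qed
  have NB: "N t \<le> 2 * pi * D / (b - 2) * (1 + \<bar>t\<bar>) powr (- (b - 2))" for t
  proof -
    have "ennreal (N t) \<le> (\<integral>\<^sup>+r. (if \<bar>t\<bar> \<le> r then ennreal (2 * pi * r * (D * (1 + \<bar>r\<bar>) powr (- b))) else 0) \<partial>lborel)"
      unfolding Nn[symmetric] radial_marginal_def
    proof (intro nn_integral_mono)
      fix r :: real
      have "ennreal (2 * pi * r) * ennreal (M r) \<le> ennreal (2 * pi * r * (D * (1 + \<bar>r\<bar>) powr (- b)))" if "\<bar>t\<bar> \<le> r"
        using that M0[of r] MD[of r] by (subst ennreal_mult[symmetric]) (auto intro!: ennreal_leI mult_left_mono simp del: abs_of_nonneg)
      then show "(if \<bar>t\<bar> \<le> r then ennreal (2 * pi * r) * ennreal (M r) else 0)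
        \<le> (if \<bar>t\<bar> \<le> r then ennreal (2 * pi * r * (D * (1 + \<bar>r\<bar>) powr (- b))) else 0)" by simp
    qed
    also have "\<dots> \<le> ennreal (2 * pi * D / (b - 2) * (1 + \<bar>t\<bar>) powr (- (b - 2)))"
      using b D by (intro marginal_tail_bound) auto
    finally show ?thesis using b D by (subst (asm) ennreal_le_iff) auto
  qed
  have "(radial_marginal ^^ Suc k) (\<lambda>r. ennreal (L r)) t = ennreal (N t)" for t
    by (simp add: Mr Nn)
  moreover have "N \<bar>t\<bar> = N t" for t by (simp add: N_def)
  moreover have "\<exists>D. \<forall>t. N t \<le> D * (1 + \<bar>t\<bar>) powr (- (b - 2))" using NB by blast
  ultimately show ?case unfolding N_eq b(2) using N0 \<open>N \<in> borel_measurable borel\<close> by blast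
qed

text \<open>For use at \<open>r = 0\<close>, where \<open>wu\<close> is a limit and the formula for
  iterated \<open>Dop\<close> does not reach.\<close>

lemma radial_ft_continuous:
  assumes k: "a - 2 * real k \<ge> 2" and X: "X \<longlonglongrightarrow> r"
  shows "(\<lambda>n. radial_ft L k (X n)) \<longlonglongrightarrow> radial_ft L k r"
proof -
  define M where "M = iter_marginal L k"
  from iter_marginal_props[OF k] obtain D where M[measurable]: "M \<in> borel_measurable borel"
    and M0: "\<And>t. 0 \<le> M t" and MD: "\<And>t. M t \<le> D * (1 + \<bar>t\<bar>) powr (- (a - 2 * real k))"
    unfolding M_def by blast
  have Mi: "integrable lborel (\<lambda>t. \<bar>t\<bar> ^ 0 * M t)"
    using k M0 MD by (intro integrable_powr_decay[where C = D and b = "a - 2 * real k"]) auto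
  show ?thesis unfolding radial_ft_def M_def[symmetric]
  proof (rule integral_dominated_convergence[where w = M])
    show "AE t in lborel. (\<lambda>n. M t * cos (X n * t)) \<longlonglongrightarrow> M t * cos (r * t)"
      using X by (intro AE_I2 tendsto_intros)
    show "AE t in lborel. norm (M t * cos (X n * t)) \<le> M t" for n
      using M0 by (auto simp: abs_mult intro!: mult_left_le)
  qed (use Mi in auto)
qed

text \<open>Differentiation under the integral: the difference quotients of
  \<open>cos (r * t)\<close> are bounded by \<open>\<bar>t\<bar>\<close>, and the decay makes
  \<open>\<bar>t\<bar> * M t\<close> integrable.\<close>

lemma radial_ft_deriv:
  assumes k: "a - 2 * real k \<ge> 4"
  shows "(radial_ft L k has_real_derivative (- (\<integral>t. t * iter_marginal L k t * sin (r * t) \<partial>lborel))) (at r)"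
proof -
  define M where "M = iter_marginal L k"
  from iter_marginal_props[of k] k obtain D where M[measurable]: "M \<in> borel_measurable borel"
    and M0: "\<And>t. 0 \<le> M t" and MD: "\<And>t. M t \<le> D * (1 + \<bar>t\<bar>) powr (- (a - 2 * real k))"
    unfolding M_def by fastforce
  have Mi: "integrable lborel (\<lambda>t. \<bar>t\<bar> ^ 0 * M t)"
    using k M0 MD by (intro integrable_powr_decay[where C = D and b = "a - 2 * real k"]) auto
  have Mi1: "integrable lborel (\<lambda>t. \<bar>t\<bar> ^ 1 * M t)"
    using k M0 MD by (intro integrable_powr_decay[where C = D and b = "a - 2 * real k"]) auto
  have Mc: "integrable lborel (\<lambda>t. M t * cos (r * t))" for r
    by (rule Bochner_Integration.integrable_bound[where f = M])
      (use Mi M0 in \<open>auto simp: abs_mult intro!: mult_left_le\<close>)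
  have "((\<lambda>h. (radial_ft L k (r + h) - radial_ft L k r) / h) \<longlongrightarrow> (\<integral>t. M t * (- sin (r * t) * t) \<partial>lborel)) (at 0)"
  proof (subst tendsto_at_iff_sequentially, safe, unfold comp_def)
    fix X :: "nat \<Rightarrow> real" assume X: "\<forall>i. X i \<in> UNIV - {0}" "X \<longlonglongrightarrow> 0"
    have e: "(radial_ft L k (r + X n) - radial_ft L k r) / X n = (\<integral>t. M t * ((cos ((r + X n) * t) - cos (r * t)) / X n) \<partial>lborel)" for n
      unfolding radial_ft_def M_def[symmetric]
      by (subst Bochner_Integration.integral_diff[symmetric, OF Mc Mc]) (simp add: algebra_simps flip: integral_divide_zero)
    show "(\<lambda>n. (radial_ft L k (r + X n) - radial_ft L k r) / X n) \<longlonglongrightarrow> (\<integral>t. M t * (- sin (r * t) * t) \<partial>lborel)"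
      unfolding e
    proof (rule integral_dominated_convergence[where w = "\<lambda>t. \<bar>t\<bar> * M t"])
      show "AE t in lborel. (\<lambda>n. M t * ((cos ((r + X n) * t) - cos (r * t)) / X n)) \<longlonglongrightarrow> M t * (- sin (r * t) * t)"
      proof (rule AE_I2, rule tendsto_mult_left)
        fix t
        have "((\<lambda>r. cos (r * t)) has_real_derivative (- sin (r * t) * t)) (at r)"
          by (auto intro!: derivative_eq_intros)
        then have "((\<lambda>h. (cos ((r + h) * t) - cos (r * t)) / h) \<longlongrightarrow> - sin (r * t) * t) (at 0)"
          unfolding DERIV_def .
        then show "(\<lambda>n. (cos ((r + X n) * t) - cos (r * t)) / X n) \<longlonglongrightarrow> - sin (r * t) * t"
          using X by (auto simp: tendsto_at_iff_sequentially comp_def)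
      qed
      show "AE t in lborel. norm (M t * ((cos ((r + X n) * t) - cos (r * t)) / X n)) \<le> \<bar>t\<bar> * M t" for n
      proof (rule AE_I2)
        fix t
        have "\<bar>cos ((r + X n) * t) - cos (r * t)\<bar> \<le> \<bar>(r + X n) * t - r * t\<bar>"
        proof -
          have "cos ((r + X n) * t) - cos (r * t) = 2 * sin (((r + X n) * t + r * t) / 2) * sin ((r * t - (r + X n) * t) / 2)"
            by (rule cos_diff_cos)
          also have "\<bar>\<dots>\<bar> \<le> 2 * 1 * \<bar>(r * t - (r + X n) * t) / 2\<bar>"
            unfolding abs_mult by (intro mult_mono abs_sin_x_le_abs_x) auto
          finally show ?thesis by (simp add: abs_minus_commute)
        qed
        also have "\<dots> = \<bar>X n\<bar> * \<bar>t\<bar>" by (simp add: algebra_simps abs_mult)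
        finally have "\<bar>(cos ((r + X n) * t) - cos (r * t)) / X n\<bar> \<le> \<bar>t\<bar>"
          using X(1) by (simp add: abs_divide divide_le_eq mult.commute)
        then have "M t * \<bar>(cos ((r + X n) * t) - cos (r * t)) / X n\<bar> \<le> M t * \<bar>t\<bar>"
          using M0 by (intro mult_left_mono)
        then show "norm (M t * ((cos ((r + X n) * t) - cos (r * t)) / X n)) \<le> \<bar>t\<bar> * M t"
          using M0[of t] by (simp add: abs_mult mult.commute)
      qed
    qed (use Mi1 in auto)
  qed
  moreover have "(\<integral>t. M t * (- sin (r * t) * t) \<partial>lborel) = - (\<integral>t. t * M t * sin (r * t) \<partial>lborel)"
    by (subst Bochner_Integration.integral_minus[symmetric]) (simp add: mult_ac)
  ultimately show ?thesis unfolding DERIV_def M_def by simp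
qed

text \<open>Exchanging the integrals leaves the cosine over \<open>{-q..q}\<close>, which gives
  \<open>2 * sin (r * q) / r\<close>. The outcome is the sine integral of
  \<open>radial_ft_deriv\<close>, so \<open>Dop\<close> sends \<open>radial_ft L k\<close> to
  \<open>radial_ft L (Suc k) / (2 * pi)\<close> away from 0.\<close>

lemma radial_ft_Suc:
  assumes k: "a - 2 * real k \<ge> 4" and r: "r \<noteq> 0"
  shows "radial_ft L (Suc k) r = 2 * pi / r * (\<integral>t. t * iter_marginal L k t * sin (r * t) \<partial>lborel)"
proof -
  define M where "M = iter_marginal L k"
  from iter_marginal_props[of k] k obtain D where M[measurable]: "M \<in> borel_measurable borel"
    and M0: "\<And>t. 0 \<le> M t" and Me: "\<And>t. M \<bar>t\<bar> = M t" and MD: "\<And>t. M t \<le> D * (1 + \<bar>t\<bar>) powr (- (a - 2 * real k))"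
    unfolding M_def by fastforce
  have Mi1: "integrable lborel (\<lambda>t. \<bar>t\<bar> ^ 1 * M t)"
    using k M0 MD by (intro integrable_powr_decay[where C = D and b = "a - 2 * real k"]) auto
  \<comment> \<open>One factor \<open>q\<close> is the weight in \<open>H\<close>, the other comes
    from the length of \<open>{-q..q}\<close>; exponent 4 is the threshold of
    \<open>integrable_powr_decay\<close> for this second moment.\<close>
  have Mi2: "integrable lborel (\<lambda>t. \<bar>t\<bar> ^ 2 * M t)"
    using k M0 MD by (intro integrable_powr_decay[where C = D and b = "a - 2 * real k"]) auto
  define H where "H q t = (if \<bar>t\<bar> \<le> q then 2 * pi * q * M q else 0)" for q t
  have [measurable]: "case_prod H \<in> borel_measurable (lborel \<Otimes>\<^sub>M lborel)" unfolding H_def[abs_def] by measurable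
  have Hind: "H q t = (2 * pi * q * M q) * indicator {-q..q} t" for q t
    by (auto simp: H_def indicator_def)
  have iH: "integrable (lborel \<Otimes>\<^sub>M lborel) (\<lambda>(q, t). H q t * cos (r * t))"
  proof (rule Bochner_Integration.integrable_bound)
    show "integrable (lborel \<Otimes>\<^sub>M lborel) (case_prod H)"
    proof (rule lborel_pair.Fubini_integrable)
      have "(\<integral>t. norm (case (q, t) of (q, t) \<Rightarrow> H q t) \<partial>lborel) = (if 0 \<le> q then 4 * pi * (\<bar>q\<bar> ^ 2 * M q) else 0)" for q
        using M0[of q] by (auto simp: Hind abs_mult power2_eq_square)
      moreover have "integrable lborel (\<lambda>q. if 0 \<le> q then 4 * pi * (\<bar>q\<bar> ^ 2 * M q) else 0)"
        by (rule Bochner_Integration.integrable_bound[OF integrable_mult_right[OF Mi2, of "4 * pi"]]) auto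
      ultimately show "integrable lborel (\<lambda>q. \<integral>t. norm (case (q, t) of (q, t) \<Rightarrow> H q t) \<partial>lborel)" by simp
      show "AE q in lborel. integrable lborel (\<lambda>t. case (q, t) of (q, t) \<Rightarrow> H q t)"
        unfolding Hind by (intro AE_I2) (auto intro!: integrable_mult_right integrable_real_indicator simp: emeasure_lborel_Icc_eq)
    qed measurable
  qed (auto simp: abs_mult mult_left_le)
  have sint: "(\<integral>t. indicator {-q..q} t * cos (r * t) \<partial>lborel) = 2 * sin (r * q) / r" if q: "0 \<le> q" for q
  proof -
    have "has_bochner_integral lborel (\<lambda>t. cos (r * t) * indicator {-q..q} t) (sin (r * q) / r - sin (r * (- q)) / r)"
      using r q by (intro has_bochner_integral_FTC_Icc_real) (auto intro!: derivative_eq_intros continuous_intros)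
    then show ?thesis by (simp add: has_bochner_integral_iff mult.commute)
  qed
  have Hq: "(\<integral>t. H q t * cos (r * t) \<partial>lborel) = (if 0 \<le> q then (4 * pi / r) * (q * M q * sin (r * q)) else 0)" for q
  proof (cases "0 \<le> q")
    case True
    have "(\<integral>t. H q t * cos (r * t) \<partial>lborel) = (2 * pi * q * M q) * (\<integral>t. indicator {-q..q} t * cos (r * t) \<partial>lborel)"
      unfolding Hind mult.assoc by simp
    then show ?thesis unfolding sint[OF True] using True by (simp add: mult_ac)
  next
    case False
    then have "H q t = 0" for t by (auto simp: H_def)
    with False show ?thesis by simp
  qed
  define S where "S q = q * M q * sin (r * q)" for q
  have [measurable]: "S \<in> borel_measurable borel" unfolding S_def by measurable
  have Si: "integrable lborel S"
    by (rule Bochner_Integration.integrable_bound[OF Mi1])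
      (auto simp: S_def abs_mult intro!: AE_I2 mult_left_le mult_nonneg_nonneg)
  have Seven: "S (- q) = S q" for q
    using Me[of q] Me[of "- q"] by (simp add: S_def)
  have Shalf: "2 * (\<integral>q. (if 0 \<le> q then S q else 0) \<partial>lborel) = (\<integral>q. S q \<partial>lborel)"
  proof -
    have i: "integrable lborel (\<lambda>q. if 0 \<le> q then S q else 0)"
      by (rule Bochner_Integration.integrable_bound[OF Si]) (use borel_measurable_integrable[OF Si] in auto)
    note j = lborel_shift_integrable(3,4)[OF i, of 0]
    have "(\<integral>q. S q \<partial>lborel) = (\<integral>q. (if 0 \<le> q then S q else 0) + (if 0 \<le> 0 - q then S (0 - q) else 0) \<partial>lborel)"
    proof (rule Bochner_Integration.integral_cong_AE)
      \<comment> \<open>The two halves overlap at \<open>q = 0\<close>, a null set.\<close>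
      show "AE q in lborel. S q = (if 0 \<le> q then S q else 0) + (if 0 \<le> 0 - q then S (0 - q) else 0)"
        using AE_lborel_singleton[of "0::real"] by eventually_elim (auto simp: Seven)
    qed (use borel_measurable_integrable[OF Si] i j in auto)
    also have "\<dots> = 2 * (\<integral>q. (if 0 \<le> q then S q else 0) \<partial>lborel)" using i j by simp
    finally show ?thesis ..
  qed
  have "radial_ft L (Suc k) r = (\<integral>t. (\<integral>q. H q t * cos (r * t) \<partial>lborel) \<partial>lborel)"
    unfolding radial_ft_def H_def M_def by (simp add: if_distrib[where f = "\<lambda>x. x * _"] flip: integral_mult_left_zero)
  also have "\<dots> = (\<integral>q. (\<integral>t. H q t * cos (r * t) \<partial>lborel) \<partial>lborel)"
    by (rule lborel_pair.Fubini_integral[OF iH])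
  also have "\<dots> = (\<integral>q. (4 * pi / r) * (if 0 \<le> q then S q else 0) \<partial>lborel)"
    unfolding Hq S_def by (intro Bochner_Integration.integral_cong) auto
  also have "\<dots> = (2 * pi / r) * (2 * (\<integral>q. (if 0 \<le> q then S q else 0) \<partial>lborel))" by simp
  also have "\<dots> = 2 * pi / r * (\<integral>t. t * iter_marginal L k t * sin (r * t) \<partial>lborel)"
    unfolding Shalf by (simp add: S_def[abs_def] M_def)
  finally show ?thesis .
qed

text \<open>\<open>deriv\<close> at \<open>r\<close> depends only on values near \<open>r\<close>,
  and a point \<open>r \<noteq> 0\<close> has a neighbourhood avoiding 0, so the induction
  hypothesis can be differentiated.\<close>

lemma Dop_iter_radial_ft:
  assumes "a - 2 * real k \<ge> 2" "r \<noteq> 0"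
  shows "(Dop ^^ k) (radial_ft L 0) r = radial_ft L k r / (2 * pi) ^ k"
  using assms
proof (induction k arbitrary: r)
  case (Suc k)
  have k: "a - 2 * real k \<ge> 4" using Suc.prems by simp
  have "\<forall>\<^sub>F x in nhds r. x \<noteq> 0" using Suc.prems(2) by (rule t1_space_nhds)
  then have ev: "\<forall>\<^sub>F x in nhds r. (Dop ^^ k) (radial_ft L 0) x = radial_ft L k x / (2 * pi) ^ k"
    using Suc.IH k by (auto elim!: eventually_mono)
  have "deriv ((Dop ^^ k) (radial_ft L 0)) r = deriv (\<lambda>x. radial_ft L k x / (2 * pi) ^ k) r"
    by (rule deriv_cong_ev[OF ev refl])
  also have "\<dots> = - (\<integral>t. t * iter_marginal L k t * sin (r * t) \<partial>lborel) / (2 * pi) ^ k"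
    by (intro DERIV_imp_deriv DERIV_cdivide radial_ft_deriv k)
  finally have d: "deriv ((Dop ^^ k) (radial_ft L 0)) r = - (\<integral>t. t * iter_marginal L k t * sin (r * t) \<partial>lborel) / (2 * pi) ^ k" .
  have "(Dop ^^ Suc k) (radial_ft L 0) r = - deriv ((Dop ^^ k) (radial_ft L 0)) r / r"
    by (simp add: Dop_def[of "(Dop ^^ k) (radial_ft L 0)" r])
  then show ?case
    unfolding d radial_ft_Suc[OF k Suc.prems(2)] using Suc.prems(2) by (simp add: field_simps)
qed simp

text \<open>Pushed forward to a coordinate axis \<open>e\<close>, the density
  \<open>L (norm w)\<close> becomes \<open>iter_marginal L k\<close>, which settles the points of
  the axis. An orthogonal map taking \<open>norm x *\<^sub>R e\<close> to \<open>x\<close> preserves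
  \<open>L (norm w)\<close> and Lebesgue measure.\<close>

lemma radial_ft_eq_integral:
  fixes x :: "real^'n"
  assumes k: "a - 2 * real k \<ge> 2" and dim: "CARD('n) = 2 * k + 1"
  shows "integrable lborel (\<lambda>w::real^'n. L (norm w))"
    and "radial_ft L k (norm x) = (\<integral>w. L (norm w) * cos (w \<bullet> x) \<partial>lborel)"
proof -
  note [measurable] = Lm
  define M where "M = iter_marginal L k"
  from iter_marginal_props[OF k] obtain D where M[measurable]: "M \<in> borel_measurable borel"
    and M0: "\<And>t. 0 \<le> M t" and Me: "\<And>t. M \<bar>t\<bar> = M t" and MD: "\<And>t. M t \<le> D * (1 + \<bar>t\<bar>) powr (- (a - 2 * real k))"
    and Mr: "\<And>t. (radial_marginal ^^ k) (\<lambda>r. ennreal (L r)) t = ennreal (M t)"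
    unfolding M_def by blast
  have Mi: "integrable lborel (\<lambda>t. \<bar>t\<bar> ^ 0 * M t)"
    using k M0 MD by (intro integrable_powr_decay[where C = D and b = "a - 2 * real k"]) auto
  obtain e :: "real^'n" where e: "e \<in> Basis" using nonempty_Basis by blast
  have marg: "(\<integral>\<^sup>+w. ennreal (L (norm w)) * u (w \<bullet> e) \<partial>lborel) = (\<integral>\<^sup>+t. ennreal (M t) * u t \<partial>lborel)"
    if "u \<in> borel_measurable borel" for u
    using nn_integral_radial_marginal[OF e, of k "\<lambda>r. ennreal (L r)" u] that dim Mr Me by simp
  have "(\<integral>\<^sup>+w. ennreal (L (norm (w::real^'n))) \<partial>lborel) = (\<integral>\<^sup>+t. ennreal (M t) \<partial>lborel)"
    using marg[of "\<lambda>_. 1"] by simp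
  also have "\<dots> < \<infinity>" using Mi M0 by (subst nn_integral_eq_integral) auto
  finally show Li: "integrable lborel (\<lambda>w::real^'n. L (norm w))"
    using L0 by (intro integrableI_bounded) auto
  have distr: "distr (density lborel (\<lambda>w::real^'n. ennreal (L (norm w)))) borel (\<lambda>w. w \<bullet> e) = density lborel (\<lambda>t. ennreal (M t))"
  proof (rule measure_eqI)
    fix A assume "A \<in> sets (distr (density lborel (\<lambda>w::real^'n. ennreal (L (norm w)))) borel (\<lambda>w. w \<bullet> e))"
    then have [measurable]: "A \<in> sets borel" by simp
    have "emeasure (distr (density lborel (\<lambda>w::real^'n. ennreal (L (norm w)))) borel (\<lambda>w. w \<bullet> e)) A
      = (\<integral>\<^sup>+w. ennreal (L (norm (w::real^'n))) * indicator A (w \<bullet> e) \<partial>lborel)"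
      by (subst nn_integral_indicator[symmetric], simp, subst nn_integral_distr, simp, simp, subst nn_integral_density) auto
    also have "\<dots> = emeasure (density lborel (\<lambda>t. ennreal (M t))) A"
      by (subst marg) (auto simp: emeasure_density)
    finally show "emeasure (distr (density lborel (\<lambda>w::real^'n. ennreal (L (norm w)))) borel (\<lambda>w. w \<bullet> e)) A
      = emeasure (density lborel (\<lambda>t. ennreal (M t))) A" .
  qed simp
  have "radial_ft L k (norm x) = (\<integral>t. cos (norm x * t) \<partial>density lborel (\<lambda>t. ennreal (M t)))"
    unfolding radial_ft_def M_def[symmetric] using M0 by (subst integral_density) auto
  also have "\<dots> = (\<integral>w. L (norm w) * cos (norm x * (w \<bullet> e)) \<partial>lborel)"
    unfolding distr[symmetric] using L0 by (subst integral_distr) (auto simp: integral_density)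
  also have "\<dots> = (\<integral>w. L (norm w) * cos (w \<bullet> x) \<partial>lborel)"
  proof -
    obtain f :: "real^'n \<Rightarrow> real^'n" where f: "orthogonal_transformation f" "f (norm x *\<^sub>R e) = x"
      using orthogonal_transformation_exists[of "norm x *\<^sub>R e" x] e by auto
    note [measurable] = lborel_distr_orthogonal(1)[OF f(1)]
    have "(\<integral>w. L (norm w) * cos (w \<bullet> x) \<partial>lborel) = (\<integral>w. L (norm w) * cos (w \<bullet> x) \<partial>distr lborel borel f)"
      unfolding lborel_distr_orthogonal(2)[OF f(1)] ..
    also have "\<dots> = (\<integral>w. L (norm (f w)) * cos (f w \<bullet> f (norm x *\<^sub>R e)) \<partial>lborel)"
      by (subst integral_distr) (auto simp: f(2))
    also have "\<dots> = (\<integral>w. L (norm w) * cos (norm x * (w \<bullet> e)) \<partial>lborel)"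
      using f(1) by (simp add: orthogonal_transformation_norm orthogonal_transformation_def)
    finally show ?thesis ..
  qed
  finally show "radial_ft L k (norm x) = (\<integral>w. L (norm w) * cos (w \<bullet> x) \<partial>lborel)" .
qed

end

section \<open>The truncated power, its transform and the Wu function\<close>

lemma f_trunc_props:
  assumes l: "0 \<le> l"
  shows "f_trunc l \<in> borel_measurable borel" "0 \<le> f_trunc l y" "f_trunc l y \<le> indicator {-1..1} y"
    "f_trunc l \<bar>y\<bar> = f_trunc l y" "f_trunc l (- y) = f_trunc l y"
proof -
  show "f_trunc l \<in> borel_measurable borel" unfolding f_trunc_def[abs_def] by measurable
  show "f_trunc l y \<le> indicator {-1..1} y"
  proof (cases "y \<in> {-1..1}")
    case True
    have "max 0 (1 - y\<^sup>2) \<le> 1" by simp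
    then have "f_trunc l y \<le> 1" unfolding f_trunc_def using l by (intro powr_le1) auto
    then show ?thesis using True by simp
  next
    case False
    then have "1 \<le> \<bar>y\<bar>" by auto
    from power_mono[OF this, of 2] have "1 \<le> y\<^sup>2" by simp
    \<comment> \<open>This includes \<open>l = 0\<close>, where \<open>0 powr 0 = 0\<close> makes
      \<open>f_trunc\<close> the indicator of the open interval.\<close>
    then show ?thesis by (simp add: f_trunc_def)
  qed
qed (auto simp: f_trunc_def)

abbreviation f_trunc_complex :: "real \<Rightarrow> real \<Rightarrow> complex" where
  "f_trunc_complex l \<equiv> \<lambda>y. complex_of_real (f_trunc l y)"

lemma L1_L2_f_trunc:
  assumes l: "0 \<le> l"
  shows "L1_L2 (f_trunc_complex l)" "integrable lborel (f_trunc l)"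
proof -
  note f = f_trunc_props[OF l]
  note [measurable] = f(1)
  have i: "integrable lborel (indicator {-1..1} :: real \<Rightarrow> real)" by (simp add: emeasure_lborel_Icc_eq)
  show j: "integrable lborel (f_trunc l)"
    by (rule Bochner_Integration.integrable_bound[OF i]) (use f in auto)
  have "integrable lborel (\<lambda>y. (f_trunc l y)\<^sup>2)"
  proof (rule Bochner_Integration.integrable_bound[OF i])
    have "(f_trunc l y)\<^sup>2 \<le> indicator {-1..1} y" for y
      using f(2,3)[of y] by (auto simp: indicator_def power_le_one split: if_splits)
    then show "AE y in lborel. norm ((f_trunc l y)\<^sup>2) \<le> norm (indicator {-1..1} y :: real)" by simp
  qed simp
  then show "L1_L2 (f_trunc_complex l)" using integrable_of_real[OF j] by (simp add: L1_L2_def)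
qed

text \<open>The sine part is odd and vanishes; the cosine part is even, so the integral over
  \<open>{0..1}\<close> counts twice. Uniqueness of the gauge integral links \<open>Icos\<close> to
  the Lebesgue integral.\<close>

lemma ft_f_trunc:
  assumes l: "0 \<le> l"
  shows "ft (f_trunc_complex l) t = of_real (2 * Icos l t)"
proof -
  note f = f_trunc_props[OF l]
  note [measurable] = f(1)
  have i: "integrable lborel (\<lambda>y. f_trunc_complex l y * cis (- (t * y)))"
    using L1_L2_f_trunc[OF l] by (intro integrable_mult_cis) (auto simp: L1_L2_def)
  have ic: "integrable lborel (\<lambda>y. f_trunc l y * cos (t * y))" using integrable_Re[OF i] by simp
  have is_sin: "integrable lborel (\<lambda>y. f_trunc l y * sin (t * y))" using integrable_Im[OF i] by simp
  have "(\<integral>y. f_trunc l y * sin (t * y) \<partial>lborel) = - (\<integral>y. f_trunc l y * sin (t * y) \<partial>lborel)"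
    using lborel_shift_integrable(4)[OF is_sin, of 0] by (simp add: f)
  then have s0: "(\<integral>y. f_trunc l y * sin (t * y) \<partial>lborel) = 0" by simp
  have half: "((\<lambda>y. f_trunc l y * cos (t * y)) has_integral Icos l t) {0..1}"
  proof (rule has_integral_eq[OF _ has_integral_Icos_Isin(1)])
    show "(1 - y\<^sup>2) powr l * cos (t * y) = f_trunc l y * cos (t * y)" if "y \<in> {0..1}" for y
      using that by (simp add: f_trunc_def power_le_one)
  qed (use l in simp)
  have "((\<lambda>y. f_trunc l (- y) * cos (t * (- y))) has_integral Icos l t) {-1..-0}"
    using half by (subst has_integral_reflect_real) simp
  then have half': "((\<lambda>y. f_trunc l y * cos (t * y)) has_integral Icos l t) {-1..0}" by (simp add: f)
  have "((\<lambda>y. f_trunc l y * cos (t * y)) has_integral (2 * Icos l t)) {-1..1}"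
    using has_integral_combine[OF _ _ half' half] by simp
  moreover have "f_trunc l y = 0" if "y \<notin> {-1..1}" for y using f(2,3)[of y] that by simp
  ultimately have "((\<lambda>y. f_trunc l y * cos (t * y)) has_integral (2 * Icos l t)) UNIV"
    by (elim has_integral_on_superset) simp_all
  moreover have "((\<lambda>y. f_trunc l y * cos (t * y)) has_integral (\<integral>y. f_trunc l y * cos (t * y) \<partial>lborel)) UNIV"
    using ic by (rule has_integral_integral_lborel)
  ultimately have c: "(\<integral>y. f_trunc l y * cos (t * y) \<partial>lborel) = 2 * Icos l t" using has_integral_unique by blast
  show ?thesis
  proof (rule complex_eqI)
    show "Re (ft (f_trunc_complex l) t) = Re (of_real (2 * Icos l t))"
      unfolding ft_def using integral_Re[OF i] c by simp
    show "Im (ft (f_trunc_complex l) t) = Im (of_real (2 * Icos l t))"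
      unfolding ft_def using integral_Im[OF i] s0 by simp
  qed
qed

text \<open>\<open>2 * Icos l\<close> is the transform of \<open>f_trunc l\<close>, and
  \<open>2 * pi\<close> is the constant in Parseval's identity on the line.\<close>

definition spectral_density :: "real \<Rightarrow> real \<Rightarrow> real" where
  "spectral_density l t = (2 * Icos l t)\<^sup>2 / (2 * pi)"

lemma spectral_density_props:
  assumes l: "0 \<le> l"
  shows "spectral_density l \<in> borel_measurable borel" "0 \<le> spectral_density l t" "spectral_density l (- t) = spectral_density l t"
    and "\<exists>C. \<forall>t. spectral_density l t \<le> C * (1 + \<bar>t\<bar>) powr (- (2 * (l + 1)))"
proof -
  have e: "2 * Icos l t = Re (ft (f_trunc_complex l) t)" for t by (simp add: ft_f_trunc[OF l])
  note [measurable] = ft_measurable[OF L1_L2_measurable[OF L1_L2_f_trunc(1)[OF l]]]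
  show "spectral_density l \<in> borel_measurable borel" unfolding spectral_density_def[abs_def] e by measurable
  show "0 \<le> spectral_density l t" by (simp add: spectral_density_def)
  have Ie: "Icos l (- t) = Icos l t" for t by (simp add: Icos_def)
  then show "spectral_density l (- t) = spectral_density l t" by (simp add: spectral_density_def)
  obtain C where C: "\<And>t. t \<ge> 1 \<Longrightarrow> \<bar>Icos l t\<bar> \<le> C * t powr (- l - 1)" using Icos_Isin_decay[of l] l by auto
  have C0: "C \<ge> 0" using C[of 1] by simp
  define B where "B = (\<integral>y. norm (f_trunc_complex l y) \<partial>lborel)"
  have B: "\<bar>2 * Icos l t\<bar> \<le> B" for t
  proof -
    have "norm (ft (f_trunc_complex l) t) \<le> B"
      unfolding ft_def B_def by (rule order_trans[OF integral_norm_bound]) (simp add: norm_mult)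
    then show ?thesis by (simp add: ft_f_trunc[OF l])
  qed
  have B0: "B \<ge> 0" using B[of 0] by linarith
  \<comment> \<open>\<open>B\<close> serves for \<open>\<bar>t\<bar> \<le> 1\<close> and
    \<open>2 * C\<close> is the decay constant beyond; passing from \<open>\<bar>t\<bar>\<close> to
    \<open>1 + \<bar>t\<bar>\<close>, which is at most \<open>2 * \<bar>t\<bar>\<close> there, costs
    \<open>2 powr (l + 1)\<close>.\<close>
  define D where "D = (B + 2 * C) * 2 powr (l + 1)"
  have pw: "(2 / x) powr a = 2 powr a * x powr (- a)" "(x / 2) powr (- a) = 2 powr a * x powr (- a)" if "x > 0" for x a :: real
    using that by (simp_all add: powr_minus_divide powr_divide)
  have key: "\<bar>2 * Icos l t\<bar> \<le> D * (1 + \<bar>t\<bar>) powr (- (l + 1))" for t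
  proof (cases "\<bar>t\<bar> \<le> 1")
    case True
    have "1 \<le> (2 / (1 + \<bar>t\<bar>)) powr (l + 1)" using True l by (intro ge_one_powr_ge_zero) auto
    also have "\<dots> = 2 powr (l + 1) * (1 + \<bar>t\<bar>) powr (- (l + 1))" by (rule pw) simp
    finally have "(B + 2 * C) * 1 \<le> (B + 2 * C) * (2 powr (l + 1) * (1 + \<bar>t\<bar>) powr (- (l + 1)))"
      using B0 C0 by (intro mult_left_mono) auto
    then show ?thesis using B[of t] C0 by (simp add: D_def mult.assoc)
  next
    case False
    have "\<bar>2 * Icos l t\<bar> = \<bar>2 * Icos l \<bar>t\<bar>\<bar>" using Ie[of t] by (simp add: abs_if)
    also have "\<dots> \<le> 2 * (C * \<bar>t\<bar> powr (- l - 1))" using C[of "\<bar>t\<bar>"] False by simp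
    also have "\<bar>t\<bar> powr (- l - 1) \<le> ((1 + \<bar>t\<bar>) / 2) powr (- l - 1)" using False l by (intro powr_mono2') auto
    also have "- l - 1 = - (l + 1)" by simp
    also have "((1 + \<bar>t\<bar>) / 2) powr (- (l + 1)) = 2 powr (l + 1) * (1 + \<bar>t\<bar>) powr (- (l + 1))"
      by (rule pw) simp
    finally have "\<bar>2 * Icos l t\<bar> \<le> 2 * C * (2 powr (l + 1) * (1 + \<bar>t\<bar>) powr (- (l + 1)))"
      using C0 by (simp add: mult_left_mono)
    also have "\<dots> \<le> (B + 2 * C) * (2 powr (l + 1) * (1 + \<bar>t\<bar>) powr (- (l + 1)))"
      using B0 by (intro mult_right_mono) auto
    finally show ?thesis by (simp add: D_def mult.assoc)
  qed
  have "spectral_density l t \<le> D\<^sup>2 / (2 * pi) * (1 + \<bar>t\<bar>) powr (- (2 * (l + 1)))" for t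
  proof -
    have "(2 * Icos l t)\<^sup>2 \<le> (D * (1 + \<bar>t\<bar>) powr (- (l + 1)))\<^sup>2"
      using key[of t] by (intro power2_le_iff_abs_le[THEN iffD2]) auto
    also have "\<dots> = D\<^sup>2 * (1 + \<bar>t\<bar>) powr (- (2 * (l + 1)))"
      by (simp add: power_mult_distrib power2_eq_square flip: powr_add)
    finally have "(2 * Icos l t)\<^sup>2 \<le> D\<^sup>2 * (1 + \<bar>t\<bar>) powr (- (2 * (l + 1)))" .
    from divide_right_mono[OF this, of "2 * pi"] show ?thesis unfolding spectral_density_def by simp
  qed
  then show "\<exists>C. \<forall>t. spectral_density l t \<le> C * (1 + \<bar>t\<bar>) powr (- (2 * (l + 1)))" by blast
qed

text \<open>Parseval for \<open>f_trunc l\<close> and its translate by \<open>r\<close>: translation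
  multiplies the transform by a factor of modulus 1, and evenness of \<open>f_trunc l\<close> turns
  the inner product into the convolution. Real parts give the cosine.\<close>

lemma f_conv_eq_cosine_transform:
  assumes l: "0 \<le> l"
  shows "f_conv l r = (\<integral>t. spectral_density l t * cos (r * t) \<partial>lborel)"
proof -
  note f = f_trunc_props[OF l]
  define v where "v = (\<lambda>y. f_trunc_complex l (y - r))"
  note u = L1_L2_f_trunc(1)[OF l]
  have v: "L1_L2 v"
    using u lborel_shift_integrable(1)[of "f_trunc_complex l" r] lborel_shift_integrable(1)[of "\<lambda>y. (norm (f_trunc_complex l y))\<^sup>2" r]
    unfolding L1_L2_def v_def by auto
  have ftv: "ft v t = cis (- (t * r)) * ft (f_trunc_complex l) t" for t
  proof -
    define g where "g y = f_trunc_complex l y * cis (- (t * y)) * cis (- (t * r))" for y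
    have g: "integrable lborel g" unfolding g_def
      using u by (intro integrable_mult_left integrable_mult_cis) (auto simp: L1_L2_def)
    have "ft v t = (\<integral>y. g (y - r) \<partial>lborel)"
      unfolding ft_def v_def g_def by (intro Bochner_Integration.integral_cong refl) (simp add: cis_mult algebra_simps)
    also have "\<dots> = (\<integral>y. g y \<partial>lborel)" by (rule lborel_shift_integrable(2)[OF g])
    also have "\<dots> = cis (- (t * r)) * ft (f_trunc_complex l) t" unfolding g_def ft_def by simp
    finally show ?thesis .
  qed
  have "ft (f_trunc_complex l) t * cnj (ft v t) = of_real (2 * pi * spectral_density l t) * cis (r * t)" for t
    unfolding ftv ft_f_trunc[OF l] by (simp add: spectral_density_def cis_cnj power2_eq_square mult_ac)
  then have "(\<integral>t. of_real (2 * pi * spectral_density l t) * cis (r * t) \<partial>lborel) = of_real (2 * pi) * (\<integral>x. f_trunc_complex l x * cnj (v x) \<partial>lborel)"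
    using parseval[OF u v] by simp
  also have "(\<integral>x. f_trunc_complex l x * cnj (v x) \<partial>lborel) = of_real (f_conv l r)"
  proof -
    have "f_trunc l \<bar>r - y\<bar> = f_trunc l (y - r)" for y by (simp add: f_trunc_def power2_commute)
    then show ?thesis unfolding f_conv_def v_def by (simp add: f flip: of_real_mult)
  qed
  finally have e: "(\<integral>t. of_real (2 * pi * spectral_density l t) * cis (r * t) \<partial>lborel) = of_real (2 * pi * f_conv l r)" by simp
  have [measurable]: "ft (f_trunc_complex l) \<in> borel_measurable borel" "ft v \<in> borel_measurable borel"
    using ft_measurable L1_L2_measurable u v by auto
  have "integrable lborel (\<lambda>t. ft (f_trunc_complex l) t * cnj (ft v t))"
    by (rule integrable_product_sq)
      (use ft_square_integrable[OF u] ft_square_integrable[OF v] ft_measurable L1_L2_measurable u v in auto)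
  then have "integrable lborel (\<lambda>t. of_real (2 * pi * spectral_density l t) * cis (r * t))"
    using \<open>\<And>t. ft (f_trunc_complex l) t * cnj (ft v t) = of_real (2 * pi * spectral_density l t) * cis (r * t)\<close> by simp
  from integral_Re[OF this] e have "(\<integral>t. 2 * pi * (spectral_density l t * cos (r * t)) \<partial>lborel) = 2 * pi * f_conv l r"
    by (simp add: mult.assoc)
  then show ?thesis by simp
qed

text \<open>Away from 0 this is the formula for iterated \<open>Dop\<close>; at 0 the right-hand
  limit in \<open>wu\<close> is evaluated by continuity of \<open>radial_ft\<close>.\<close>

lemma wu_eq_radial_ft:
  assumes l: "0 \<le> l" and k: "real k \<le> l"
  shows "wu l k r = radial_ft (spectral_density l) k r / (2 * pi) ^ k"
proof -
  obtain C where C: "\<And>t. spectral_density l t \<le> C * (1 + \<bar>t\<bar>) powr (- (2 * (l + 1)))" using spectral_density_props(4)[OF l] by blast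
  note p = spectral_density_props(1-3)[OF l] C
  have k2: "2 * (l + 1) - 2 * real k \<ge> 2" using k by simp
  have f0: "f_conv l = radial_ft (spectral_density l) 0"
    by (rule ext) (simp add: f_conv_eq_cosine_transform[OF l] radial_ft_def)
  have D: "(Dop ^^ k) (f_conv l) r = radial_ft (spectral_density l) k r / (2 * pi) ^ k" if "r \<noteq> 0" for r
    unfolding f0 by (rule Dop_iter_radial_ft[OF p k2 that])
  show ?thesis
  proof (cases "r = 0")
    case True
    have "((\<lambda>r. radial_ft (spectral_density l) k r / (2 * pi) ^ k) \<longlongrightarrow> radial_ft (spectral_density l) k 0 / (2 * pi) ^ k) (at 0)"
      by (intro tendsto_divide tendsto_const)
        (auto simp: tendsto_at_iff_sequentially comp_def intro!: radial_ft_continuous[OF p k2])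
    then have "((\<lambda>r. radial_ft (spectral_density l) k r / (2 * pi) ^ k) \<longlongrightarrow> radial_ft (spectral_density l) k 0 / (2 * pi) ^ k) (at_right 0)"
      by (rule filterlim_mono[OF _ order_refl at_le]) simp
    then have "((Dop ^^ k) (f_conv l) \<longlongrightarrow> radial_ft (spectral_density l) k 0 / (2 * pi) ^ k) (at_right 0)"
      by (rule Lim_transform_eventually) (auto simp: eventually_at_filter D)
    then have "Lim (at_right 0) ((Dop ^^ k) (f_conv l)) = radial_ft (spectral_density l) k 0 / (2 * pi) ^ k"
      by (intro tendsto_Lim) auto
    then show ?thesis using True by (simp add: wu_def)
  next
    case False
    then show ?thesis by (simp add: wu_def D)
  qed
qed

theorem theorem3p7:
  fixes k :: nat and l s :: real
  assumes "0 \<le> l" and "real k \<le> l"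
    and "CARD('n) = 2 * k + 1"
    and "real k + 1/2 < s" and "s \<le> l + 1"
  shows "native_space (\<lambda>x::real^'n. wu l k (norm x)) \<subseteq> sobolev_space s"
proof -
  obtain C where C: "\<And>t. spectral_density l t \<le> C * (1 + \<bar>t\<bar>) powr (- (2 * (l + 1)))"
    using spectral_density_props(4)[OF assms(1)] by blast
  note p = spectral_density_props(1-3)[OF assms(1)] C
  note [measurable] = p(1)
  have k2: "2 * (l + 1) - 2 * real k \<ge> 2" using assms(2) by simp
  \<comment> \<open>One factor \<open>1 / (2 * pi)\<close> for each application of
    \<open>Dop\<close>.\<close>
  define c where "c = 1 / (2 * pi) ^ k"
  have c: "c > 0" by (simp add: c_def)
  have s: "s \<ge> 0" using assms(4) by simp
  have C0: "C \<ge> 0" using C[of 0] p(2)[of 0] by simp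
  show ?thesis
  proof (rule native_space_subset_sobolev_space[where L = "\<lambda>w. c * spectral_density l (norm w)" and C = "c * C"])
    show "integrable lborel (\<lambda>w::real^'n. c * spectral_density l (norm w))"
      using radial_ft_eq_integral(1)[OF p k2 assms(3)] by simp
    show "wu l k (norm x) = (\<integral>w. c * spectral_density l (norm w) * cos (w \<bullet> x) \<partial>lborel)" for x :: "real^'n"
      unfolding wu_eq_radial_ft[OF assms(1,2)] radial_ft_eq_integral(2)[OF p k2 assms(3)]
      by (simp add: c_def mult.assoc)
    fix w :: "real^'n"
    \<comment> \<open>Replacing \<open>1 + norm w ^ 2\<close> by \<open>(1 + norm w) ^ 2\<close>
      makes the weight comparable with the decay rate, whose reciprocal it does not exceed when
      \<open>s \<le> l + 1\<close>.\<close>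
    have "(1 + (norm w)\<^sup>2) powr s \<le> ((1 + norm w)\<^sup>2) powr s"
      using s by (intro powr_mono2) (auto simp: power2_sum add_nonneg_nonneg)
    also have "\<dots> = (1 + norm w) powr (2 * s)"
      by (simp add: powr_powr flip: powr_numeral)
    also have "\<dots> \<le> (1 + norm w) powr (2 * (l + 1))" using assms(5) by (intro powr_mono) auto
    finally have "spectral_density l (norm w) * (1 + (norm w)\<^sup>2) powr s
        \<le> (C * (1 + norm w) powr (- (2 * (l + 1)))) * (1 + norm w) powr (2 * (l + 1))"
      using C[of "norm w"] p(2)[of "norm w"] C0 by (intro mult_mono) auto
    also have "\<dots> = C" using norm_ge_zero[of w] by (simp add: mult.assoc add_nonneg_eq_0_iff flip: powr_add)
    finally show "c * spectral_density l (norm w) * (1 + (norm w)\<^sup>2) powr s \<le> c * C"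
      using c by (simp add: mult.assoc)
  qed (use c p(2) s in auto)
qed

end
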